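(* Let $Q>0$. There exists $C=C(Q)$ such that for any $(q^{(1)},h^{(1)},H^{(1)}),(q^{(2)},h^{(2)},H^{(2)})\in P_Q$ with Cauchy data $\{\mathscr N^{(s)},\mathscr N_0^{(s)},\omega^{(s)},\omega_0^{(s)}\}$, $s=1,2$, $$\|q^{(1)}-q^{(2)}\|_{L_2}+|h^{(1)}-h^{(2)}|+|H^{(1)}-H^{(2)}|\le C\big(\|\mathscr N^{(1)}-\mathscr N^{(2)}\|_{L_2}+\|\mathscr N_0^{(1)}-\mathscr N_0^{(2)}\|_{L_2}+|\omega^{(1)}-\omega^{(2)}|+|\omega_0^{(1)}-\omega_0^{(2)}|\big).$$
   Context: For complex $q\in L_2(0,\pi)$, $h,H\in\mathbb C$: let $\varphi(x,\rho)$, $\psi(x,\rho)$ solve $-y''+qy=\rho^2y$ on $(0,\pi)$ with $\varphi(0,\rho)=1,\varphi'(0,\rho)=h$ and $\psi(0,\rho)=0,\psi'(0,\rho)=1$. Put $\Delta(\rho)=\varphi'(\pi,\rho)+H\varphi(\pi,\rho)$, $\Delta_0(\rho)=\psi'(\pi,\rho)+H\psi(\pi,\rho)$, $\omega=h+H+\frac12\int_0^\pi q(t)dt$, $\omega_0=H+\frac12\int_0^\pi q(t)dt$. Then there are unique $\mathscr N,\mathscr N_0\in L_2(0,\pi)$ with $\Delta(\rho)=-\rho\sin\rho\pi+\omega\cos\rho\pi+\int_0^\pi\mathscr N(t)\cos\rho t\,dt$ and $\Delta_0(\rho)=\cos\rho\pi+\omega_0\frac{\sin\rho\pi}{\rho}+\frac1\rho\int_0^\pi\mathscr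 N_0(t)\sin\rho t\,dt$; the collection $\{\mathscr N,\mathscr N_0,\omega,\omega_0\}$ is the Cauchy data of $(q,h,H)$. $P_Q=\{(q,h,H)\in L_2(0,\pi)\times\mathbb C\times\mathbb C:\|q\|_{L_2}+|h|+|H|\le Q\}$. *)

theory Defs
  imports "HOL-Analysis.Analysis"
begin

definition L2_0pi :: "(real \<Rightarrow> complex) \<Rightarrow> bool" where
  "L2_0pi f \<longleftrightarrow> set_borel_measurable lborel {0..pi} f \<and>
     set_integrable lborel {0..pi} (\<lambda>x. (norm (f x))\<^sup>2)"

definition L2_norm_0pi :: "(real \<Rightarrow> complex) \<Rightarrow> real" where
  "L2_norm_0pi f = sqrt (LINT x:{0..pi}|lborel. (norm (f x))\<^sup>2)"

text \<open>(y, dy) is a (Caratheodory) solution on [0,pi] of  -y'' + q y = rho^2 y: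
  y has derivative dy on [0,pi] and dy is absolutely continuous with
  dy' = (q - rho^2) y a.e., expressed in integrated form.\<close>
definition is_sol :: "(real \<Rightarrow> complex) \<Rightarrow> complex \<Rightarrow> (real \<Rightarrow> complex) \<Rightarrow> (real \<Rightarrow> complex) \<Rightarrow> bool" where
  "is_sol q \<rho> y dy \<longleftrightarrow>
     (\<forall>x\<in>{0..pi}. (y has_vector_derivative dy x) (at x within {0..pi})) \<and>
     (\<forall>x\<in>{0..pi}. set_integrable lborel {0..x} (\<lambda>t. (q t - \<rho>\<^sup>2) * y t) \<and>
        dy x = dy 0 + (LINT t:{0..x}|lborel. (q t - \<rho>\<^sup>2) * y t))"

definition P_Q :: "real \<Rightarrow> (real \<Rightarrow> complex) \<Rightarrow> complex \<Rightarrow> complex \<Rightarrow> bool" where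
  "P_Q Q q h H \<longleftrightarrow> L2_0pi q \<and> L2_norm_0pi q + norm h + norm H \<le> Q"

text \<open>{N, N0, omega, omega0} is the Cauchy data of (q,h,H).  Delta, Delta0 are defined via
  the (unique) solutions phi, psi; we require the representations for every solution.
  The Delta0 representation is required for rho \<noteq> 0 (at rho = 0 it is meant by continuity).\<close>
definition cauchy_data ::
  "(real \<Rightarrow> complex) \<Rightarrow> complex \<Rightarrow> complex \<Rightarrow> (real \<Rightarrow> complex) \<Rightarrow> (real \<Rightarrow> complex) \<Rightarrow> complex \<Rightarrow> complex \<Rightarrow> bool" where
  "cauchy_data q h H N N0 \<omega> \<omega>0 \<longleftrightarrow>
     L2_0pi N \<and> L2_0pi N0 \<and>
     \<omega> = h + H + (LINT t:{0..pi}|lborel. q t) / 2 \<and>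
     \<omega>0 = H + (LINT t:{0..pi}|lborel. q t) / 2 \<and>
     (\<forall>\<rho> \<phi> d\<phi>. is_sol q \<rho> \<phi> d\<phi> \<and> \<phi> 0 = 1 \<and> d\<phi> 0 = h \<longrightarrow>
        d\<phi> pi + H * \<phi> pi =
          - \<rho> * sin (\<rho> * pi) + \<omega> * cos (\<rho> * pi)
          + (LINT t:{0..pi}|lborel. N t * cos (\<rho> * t))) \<and>
     (\<forall>\<rho> \<psi> d\<psi>. \<rho> \<noteq> 0 \<and> is_sol q \<rho> \<psi> d\<psi> \<and> \<psi> 0 = 0 \<and> d\<psi> 0 = 1 \<longrightarrow>
        d\<psi> pi + H * \<psi> pi =
          cos (\<rho> * pi) + \<omega>0 * sin (\<rho> * pi) / \<rho>
          + (LINT t:{0..pi}|lborel. N0 t * sin (\<rho> * t)) / \<rho>)"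

end

theory Submission
  imports Defs "HOL-Probability.Probability"
begin

text \<open>Reflect the interval and let \<open>y\<close> solve the equation with potential \<open>q(pi - x)\<close>, \<open>y(0) = 1\<close>,
  \<open>y'(0) = H\<close>. Constancy of Wronskians gives \<open>y(pi) = Delta0\<close> and \<open>h y(pi) + y'(pi) = Delta\<close>, so for
  two problems, writing \<open>d\<close> for differences, the Wronskian of \<open>y1\<close> and \<open>y2\<close> yields
  \<open>\<integral> dq(pi - x) y1 y2 dx = dDelta Delta0_2 - dDelta0 Delta_2 - dh Delta0_1 Delta0_2 - dH\<close>,
  where \<open>dh = domega - domega0\<close> and \<open>dH + (\<integral> dq)/2 = domega0\<close>.
  Through transmutation kernels \<open>y(x) = cos(rho x) + \<integral> K(x,u) exp(i rho u) du\<close>, with \<open>K\<close> bounded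
  in terms of \<open>Q\<close> and supported in \<open>\<bar>u\<bar> \<le> x\<close>, both sides become Fourier transforms. Uniqueness of the
  transform leaves a Volterra equation for \<open>dq(pi - x)\<close> with bounded kernel and a right-hand side that is
  linear in the differences of the Cauchy data, and Gronwall's inequality concludes.
  Only real \<open>rho \<noteq> 0\<close> are needed.\<close>

section \<open>Fourier transforms and bounded kernels of compact support\<close>

text \<open>The inverse problem is nonlinear, but once both solutions in the product are expanded
  through kernels bounded in terms of Q, the difference of the potentials enters linearly; so one
  constant serves all of P_Q. The obstacle is that neither side of the Wronskian identity is, as it
  stands, the Fourier transform of a function. On the left, cos^2 = (1 + cos(2 rho x)) / 2 leaves
  half of the integral of dq as a constant. On the right, Delta_2 grows like rho; this is
  compensated by dDelta0, which is of order 1 / rho, and the remainder domega0 sin^2 joins domega0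
  cos^2 to the constant domega0. The relation between dH, domega0 and the integral of dq says
  exactly that these constants cancel. The term cos(2 rho x) / 2 also makes the equation one of the
  second kind: it returns dq itself at u = 2 x, while the kernel of the product at u = 2 t sees only
  x >= t. Finally, the kernels supply existence: Cauchy data speak about all solutions, so they
  carry information only once solutions with the prescribed initial values are exhibited.\<close>

definition ft :: "(real \<Rightarrow> complex) \<Rightarrow> real \<Rightarrow> complex" where
  "ft f r = (\<integral>u. f u * cis (r * u) \<partial>lborel)"

text \<open>Convolution with the mean of the unit point masses at \<open>a\<close> and
  \<open>- a\<close>. A cosine factor is not the transform of a density, so it acts on kernels
  through this operator and not through \<open>conv\<close>.\<close>

definition sym_shift :: "real \<Rightarrow> (real \<Rightarrow> complex) \<Rightarrow> real \<Rightarrow> complex" where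
  "sym_shift a f u = (f (u - a) + f (u + a)) / 2"

definition conv :: "(real \<Rightarrow> complex) \<Rightarrow> (real \<Rightarrow> complex) \<Rightarrow> real \<Rightarrow> complex" where
  "conv f g u = (\<integral>s. f s * g (u - s) \<partial>lborel)"

lemma cis_measurable [measurable]: "cis \<in> borel_measurable borel"
  by (intro borel_measurable_continuous_onI continuous_intros)

lemma integrable_mult_cis:
  assumes "integrable lborel f"
  shows "integrable lborel (\<lambda>u. f u * cis (r * u))"
proof -
  have [measurable]: "f \<in> borel_measurable borel" using assms by auto
  show ?thesis
    by (rule Bochner_Integration.integrable_bound[OF assms]) (auto simp: norm_mult)
qed

lemma ft_add:
  assumes "integrable lborel f" "integrable lborel g"
  shows "ft (\<lambda>u. f u + g u) r = ft f r + ft g r"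
  using assms by (simp add: ft_def ring_distribs integrable_mult_cis)

lemma ft_diff:
  assumes "integrable lborel f" "integrable lborel g"
  shows "ft (\<lambda>u. f u - g u) r = ft f r - ft g r"
  using assms by (simp add: ft_def ring_distribs integrable_mult_cis)

lemma ft_cmult: "ft (\<lambda>u. c * f u) r = c * ft f r"
  by (simp add: ft_def mult.assoc)

lemma norm_ft_le:
  "norm (ft f r) \<le> (\<integral>u. norm (f u) \<partial>lborel)"
  unfolding ft_def
  by (rule order_trans[OF integral_norm_bound]) (simp add: norm_mult)

lemma lborel_integral_translate:
  fixes f :: "real \<Rightarrow> 'a::{banach, second_countable_topology}"
  shows "(\<integral>u. f (u + a) \<partial>lborel) = (\<integral>u. f u \<partial>lborel)"
  using lborel_integral_real_affine[of 1 f a] by (simp add: add.commute)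

lemma lborel_integrable_translate:
  fixes f :: "real \<Rightarrow> 'a::{banach, second_countable_topology}"
  assumes "integrable lborel f"
  shows "integrable lborel (\<lambda>u. f (u + a))"
  using lborel_integrable_real_affine[OF assms, of 1 a] by (simp add: add.commute)

lemma ft_translate: "ft (\<lambda>u. f (u + a)) r = cis (- (r * a)) * ft f r"
proof -
  have "ft (\<lambda>u. f (u + a)) r = (\<integral>u. cis (- (r * a)) * (f (u + a) * cis (r * (u + a))) \<partial>lborel)"
    unfolding ft_def
  proof (intro Bochner_Integration.integral_cong refl)
    fix u
    have "cis (r * u) = cis (- (r * a)) * cis (r * (u + a))"
      by (simp add: cis_mult algebra_simps)
    then show "f (u + a) * cis (r * u) = cis (- (r * a)) * (f (u + a) * cis (r * (u + a)))" by simp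
  qed
  also have "\<dots> = cis (- (r * a)) * (\<integral>u. f (u + a) * cis (r * (u + a)) \<partial>lborel)"
    by simp
  also have "(\<integral>u. f (u + a) * cis (r * (u + a)) \<partial>lborel) = ft f r"
    unfolding ft_def using lborel_integral_translate[of "\<lambda>u. f u * cis (r * u)" a] .
  finally show ?thesis .
qed

lemma integrable_sym_shift:
  assumes "integrable lborel f"
  shows "integrable lborel (sym_shift a f)"
  unfolding sym_shift_def
  using lborel_integrable_translate[OF assms, of a] lborel_integrable_translate[OF assms, of "-a"]
  by simp

lemma cis_plus_cis_minus: "cis t + cis (- t) = 2 * of_real (cos t)"
  by (simp add: complex_eq_iff)

lemma ft_sym_shift:
  assumes "integrable lborel f"
  shows "ft (sym_shift a f) r = of_real (cos (r * a)) * ft f r"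
proof -
  have "ft (sym_shift a f) r = ft (\<lambda>u. (1/2) * (f (u + - a) + f (u + a))) r"
    by (simp add: sym_shift_def[abs_def])
  also have "\<dots> = (1/2) * (ft (\<lambda>u. f (u + - a)) r + ft (\<lambda>u. f (u + a)) r)"
    by (simp only: ft_cmult ft_add[OF lborel_integrable_translate[OF assms] lborel_integrable_translate[OF assms]])
  also have "\<dots> = (1/2) * (cis (r * a) + cis (- (r * a))) * ft f r"
    unfolding ft_translate[of f a r] ft_translate[of f "-a" r] by (simp add: ring_distribs)
  finally show ?thesis unfolding cis_plus_cis_minus by simp
qed

lemma conv_product_integrable:
  fixes f g :: "real \<Rightarrow> complex"
  assumes f: "integrable lborel f" and g: "integrable lborel g"
  shows "integrable (lborel \<Otimes>\<^sub>M lborel) (\<lambda>(s, u). f s * g (u - s))"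
proof (rule lborel_pair.Fubini_integrable)
  have [measurable]: "f \<in> borel_measurable borel" "g \<in> borel_measurable borel" using f g by auto
  show "(\<lambda>(s, u). f s * g (u - s)) \<in> borel_measurable (lborel \<Otimes>\<^sub>M lborel)" by measurable
  have "(\<integral>u. norm (g (u - s)) \<partial>lborel) = (\<integral>u. norm (g u) \<partial>lborel)" for s
    using lborel_integral_translate[of "\<lambda>u. norm (g u)" "-s"] by simp
  then show "integrable lborel (\<lambda>s. \<integral>u. norm (case (s, u) of (s, u) \<Rightarrow> f s * g (u - s)) \<partial>lborel)"
    using f by (simp add: norm_mult)
  show "AE s in lborel. integrable lborel (\<lambda>u. case (s, u) of (s, u) \<Rightarrow> f s * g (u - s))"
  proof (intro AE_I2)
    fix s
    show "integrable lborel (\<lambda>u. case (s, u) of (s, u) \<Rightarrow> f s * g (u - s))"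
      using lborel_integrable_translate[OF g, of "-s"] by simp
  qed
qed

lemma integrable_conv:
  assumes "integrable lborel f" "integrable lborel g"
  shows "integrable lborel (conv f g)"
  unfolding conv_def[abs_def] by (rule lborel_pair.integrable_snd[OF conv_product_integrable[OF assms]])

lemma ft_conv:
  assumes f: "integrable lborel f" and g: "integrable lborel g"
  shows "ft (conv f g) r = ft f r * ft g r"
proof -
  have int: "integrable (lborel \<Otimes>\<^sub>M lborel) (\<lambda>(s, u). (f s * cis (r * s)) * (g (u - s) * cis (r * (u - s))))"
    by (rule conv_product_integrable) (rule integrable_mult_cis f g)+
  have "ft (conv f g) r = (\<integral>u. (\<integral>s. (f s * cis (r * s)) * (g (u - s) * cis (r * (u - s))) \<partial>lborel) \<partial>lborel)"
    unfolding ft_def conv_def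
  proof (intro Bochner_Integration.integral_cong refl)
    fix u
    have "(f s * cis (r * s)) * (g (u - s) * cis (r * (u - s))) = f s * g (u - s) * cis (r * u)" for s
      using cis_mult[of "r * s" "r * (u - s)"] by (simp add: algebra_simps)
    then have "(\<lambda>s. (f s * cis (r * s)) * (g (u - s) * cis (r * (u - s)))) = (\<lambda>s. f s * g (u - s) * cis (r * u))"
      by (intro ext)
    then show "(\<integral>s. f s * g (u - s) \<partial>lborel) * cis (r * u) =
      (\<integral>s. (f s * cis (r * s)) * (g (u - s) * cis (r * (u - s))) \<partial>lborel)"
      by (simp only: integral_mult_left_zero)
  qed
  also have "\<dots> = (\<integral>s. (\<integral>u. (f s * cis (r * s)) * (g (u - s) * cis (r * (u - s))) \<partial>lborel) \<partial>lborel)"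
    by (rule lborel_pair.Fubini_integral[OF int])
  also have "\<dots> = (\<integral>s. (f s * cis (r * s)) * ft g r \<partial>lborel)"
  proof (intro Bochner_Integration.integral_cong refl)
    fix s
    have "(\<integral>u. g (u - s) * cis (r * (u - s)) \<partial>lborel) = ft g r"
      unfolding ft_def using lborel_integral_translate[of "\<lambda>u. g u * cis (r * u)" "-s"] by simp
    then show "(\<integral>u. (f s * cis (r * s)) * (g (u - s) * cis (r * (u - s))) \<partial>lborel) = (f s * cis (r * s)) * ft g r"
      by simp
  qed
  finally show ?thesis by (simp add: ft_def)
qed

text \<open>Kernels carry their sup bound and support radius explicitly, because the final constant
  may depend on Q only. Joint measurability is what allows an integral over the parameter to be
  exchanged with the Fourier transform.\<close>

definition bker :: "'p measure \<Rightarrow> ('p \<Rightarrow> real \<Rightarrow> complex) \<Rightarrow> real \<Rightarrow> real \<Rightarrow> bool" where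
  "bker N K B a \<longleftrightarrow> case_prod K \<in> borel_measurable (N \<Otimes>\<^sub>M borel) \<and>
     (\<forall>p u. norm (K p u) \<le> B) \<and> (\<forall>p u. \<bar>u\<bar> > a \<longrightarrow> K p u = 0)"

lemma bkerI:
  assumes "case_prod K \<in> borel_measurable (N \<Otimes>\<^sub>M borel)"
    and "\<And>p u. norm (K p u) \<le> B" and "\<And>p u. \<bar>u\<bar> > a \<Longrightarrow> K p u = 0"
  shows "bker N K B a"
  using assms by (simp add: bker_def)

lemma bker_measurable: "bker N K B a \<Longrightarrow> case_prod K \<in> borel_measurable (N \<Otimes>\<^sub>M borel)"
  by (simp add: bker_def)

lemma bker_measurable_comp:
  assumes "bker N K B a" "f \<in> measurable M N" "g \<in> borel_measurable M"
  shows "(\<lambda>x. K (f x) (g x)) \<in> borel_measurable M"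
proof -
  note [measurable] = bker_measurable[OF assms(1)] assms(2,3)
  have "(\<lambda>x. case_prod K (f x, g x)) \<in> borel_measurable M" by measurable
  then show ?thesis by simp
qed

lemma bker_bound: "bker N K B a \<Longrightarrow> norm (K p u) \<le> B"
  by (simp add: bker_def)

lemma bker_supp: "bker N K B a \<Longrightarrow> \<bar>u\<bar> > a \<Longrightarrow> K p u = 0"
  by (simp add: bker_def)

lemma bker_nonneg: "bker N K B a \<Longrightarrow> 0 \<le> B"
  using bker_bound[of N K B a] norm_ge_zero order_trans by blast

lemma bker_mono: "bker N K B a \<Longrightarrow> B \<le> B' \<Longrightarrow> a \<le> a' \<Longrightarrow> bker N K B' a'"
  unfolding bker_def by (auto intro: order_trans)

lemma integrable_bounded_support:
  fixes f :: "real \<Rightarrow> 'b::{banach, second_countable_topology}"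
  assumes [measurable]: "f \<in> borel_measurable borel"
    and "\<And>u. norm (f u) \<le> B" and "\<And>u. \<bar>u\<bar> > a \<Longrightarrow> f u = 0"
  shows "integrable lborel f"
proof (rule Bochner_Integration.integrable_bound)
  show "integrable lborel (\<lambda>u. B * indicator {-a..a} u :: real)"
    by (intro integrable_mult_right integrable_real_indicator) (auto simp: emeasure_lborel_Icc_eq)
  have "norm (f u) \<le> norm (B * indicator {-a..a} u :: real)" for u
    using assms(2)[of u] assms(3)[of u] order_trans[OF norm_ge_zero assms(2)[of u]]
    by (auto simp: indicator_def)
  then show "AE u in lborel. norm (f u) \<le> norm (B * indicator {-a..a} u :: real)" by simp
qed simp

lemma integral_norm_bounded_support:
  fixes f :: "real \<Rightarrow> 'b::{banach, second_countable_topology}"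
  assumes [measurable]: "f \<in> borel_measurable borel"
    and "\<And>u. norm (f u) \<le> B" and "\<And>u. \<bar>u\<bar> > a \<Longrightarrow> f u = 0" and "0 \<le> a"
  shows "(\<integral>u. norm (f u) \<partial>lborel) \<le> 2 * a * B"
proof -
  have "(\<integral>u. norm (f u) \<partial>lborel) \<le> (\<integral>u. B * indicator {-a..a} u \<partial>lborel)"
  proof (rule integral_mono)
    show "integrable lborel (\<lambda>u. norm (f u))"
      by (intro integrable_norm integrable_bounded_support[OF assms(1-3)])
    show "norm (f u) \<le> B * indicator {-a..a} u" for u
      using assms(2)[of u] assms(3)[of u] by (auto simp: indicator_def)
  qed (intro integrable_mult_right integrable_real_indicator, auto simp: emeasure_lborel_Icc_eq)
  also have "\<dots> = 2 * a * B" using assms(4) by simp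
  finally show ?thesis .
qed

lemma bker_section_measurable:
  assumes "bker N K B a" "p \<in> space N"
  shows "K p \<in> borel_measurable borel"
  using bker_measurable_comp[OF assms(1), of "\<lambda>_. p" borel "\<lambda>u. u"] assms(2) by simp

lemma bker_integrable:
  assumes "bker N K B a" "p \<in> space N"
  shows "integrable lborel (K p)"
  by (rule integrable_bounded_support[OF bker_section_measurable[OF assms] bker_bound[OF assms(1)] bker_supp[OF assms(1)]])

lemma bker_ft_measurable:
  assumes "bker N K B a"
  shows "(\<lambda>p. ft (K p) r) \<in> borel_measurable N"
proof -
  note [measurable] = bker_measurable[OF assms]
  show ?thesis unfolding ft_def by measurable
qed

lemma bker_norm_ft_le:
  assumes "bker N K B a" "p \<in> space N" "0 \<le> a"
  shows "norm (ft (K p) r) \<le> 2 * a * B"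
  by (rule order_trans[OF norm_ft_le])
     (rule integral_norm_bounded_support[OF bker_section_measurable[OF assms(1,2)] bker_bound[OF assms(1)] bker_supp[OF assms(1)] assms(3)])

lemma bker_reparam:
  assumes "bker N K B a" "f \<in> measurable M N"
  shows "bker M (\<lambda>x. K (f x)) B a"
proof (rule bkerI)
  note [measurable] = assms(2)
  show "case_prod (\<lambda>x. K (f x)) \<in> borel_measurable (M \<Otimes>\<^sub>M borel)"
    using bker_measurable_comp[OF assms(1), of "\<lambda>z. f (fst z)" "M \<Otimes>\<^sub>M borel" snd]
    by (simp add: case_prod_beta')
qed (rule bker_bound[OF assms(1)] bker_supp[OF assms(1)], assumption?)+

lemma bker_add:
  assumes "bker N K B a" "bker N L C a"
  shows "bker N (\<lambda>p u. K p u + L p u) (B + C) a"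
proof (rule bkerI)
  note [measurable] = bker_measurable[OF assms(1)] bker_measurable[OF assms(2)]
  show "case_prod (\<lambda>p u. K p u + L p u) \<in> borel_measurable (N \<Otimes>\<^sub>M borel)" by measurable
  show "norm (K p u + L p u) \<le> B + C" for p u
    by (rule norm_triangle_mono) (rule bker_bound assms)+
qed (simp add: bker_supp[OF assms(1)] bker_supp[OF assms(2)])

lemma bker_cmult:
  assumes "bker N K B a"
  shows "bker N (\<lambda>p u. c * K p u) (norm c * B) a"
proof (rule bkerI)
  note [measurable] = bker_measurable[OF assms(1)]
  show "case_prod (\<lambda>p u. c * K p u) \<in> borel_measurable (N \<Otimes>\<^sub>M borel)" by measurable
  show "norm (c * K p u) \<le> norm c * B" for p u
    by (simp add: norm_mult mult_left_mono bker_bound[OF assms])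
qed (simp add: bker_supp[OF assms(1)])

lemma bker_shift:
  assumes "bker N K B a" "b \<in> borel_measurable N" "\<And>p. \<bar>b p\<bar> \<le> c"
  shows "bker N (\<lambda>p. sym_shift (b p) (K p)) B (a + c)"
proof (rule bkerI)
  note [measurable] = assms(2)
  have [measurable]: "(\<lambda>z. K (fst z) (snd z - b (fst z))) \<in> borel_measurable (N \<Otimes>\<^sub>M borel)"
    "(\<lambda>z. K (fst z) (snd z + b (fst z))) \<in> borel_measurable (N \<Otimes>\<^sub>M borel)"
    by (rule bker_measurable_comp[OF assms(1)]; measurable)+
  show "case_prod (\<lambda>p. sym_shift (b p) (K p)) \<in> borel_measurable (N \<Otimes>\<^sub>M borel)"
    unfolding sym_shift_def case_prod_beta' by measurable
  show "norm (sym_shift (b p) (K p) u) \<le> B" for p u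
    using norm_triangle_mono[OF bker_bound[OF assms(1)] bker_bound[OF assms(1)], of p "u - b p" p "u + b p"]
    by (simp add: sym_shift_def norm_divide)
  show "sym_shift (b p) (K p) u = 0" if "\<bar>u\<bar> > a + c" for p u
  proof -
    have "\<bar>u - b p\<bar> > a" "\<bar>u + b p\<bar> > a" using that assms(3)[of p] by linarith+
    then show ?thesis by (simp add: sym_shift_def bker_supp[OF assms(1)])
  qed
qed

lemma norm_conv_le:
  assumes "integrable lborel f" "\<And>u. norm (g u) \<le> B"
  shows "norm (conv f g u) \<le> (\<integral>s. norm (f s) \<partial>lborel) * B"
proof -
  have "norm (conv f g u) \<le> (\<integral>s. norm (f s) * norm (g (u - s)) \<partial>lborel)"
    unfolding conv_def by (rule order_trans[OF integral_norm_bound]) (simp add: norm_mult)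
  also have "\<dots> \<le> (\<integral>s. norm (f s) * B \<partial>lborel)"
  proof (rule integral_mono_AE')
    show "integrable lborel (\<lambda>s. norm (f s) * B)" using assms(1) by simp
    show "AE s in lborel. norm (f s) * norm (g (u - s)) \<le> norm (f s) * B"
      by (intro AE_I2 mult_left_mono assms) simp
    show "AE s in lborel. 0 \<le> norm (f s) * B"
      using order_trans[OF norm_ge_zero assms(2)] by (intro AE_I2 mult_nonneg_nonneg) auto
  qed
  finally show ?thesis by simp
qed

text \<open>The L1 norm of one factor times the sup norm of the other bounds a convolution, and the
  radii of supports add. Assumption \<open>sp\<close> reconciles two ranges: \<open>bker\<close>
  bounds all parameters, while sections are known to be measurable only for parameters in the
  space.\<close>

lemma bker_conv:
  assumes "bker N K B a" "bker N L C b" "0 \<le> a"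
    and K1: "\<And>p. p \<in> space N \<Longrightarrow> (\<integral>s. norm (K p s) \<partial>lborel) \<le> D"
    and sp: "\<And>p. p \<in> space N"
  shows "bker N (\<lambda>p. conv (K p) (L p)) (D * C) (a + b)"
proof (rule bkerI)
  have [measurable]: "(\<lambda>z. K (fst (fst z)) (snd z)) \<in> borel_measurable ((N \<Otimes>\<^sub>M borel) \<Otimes>\<^sub>M borel)"
    "(\<lambda>z. L (fst (fst z)) (snd (fst z) - snd z)) \<in> borel_measurable ((N \<Otimes>\<^sub>M borel) \<Otimes>\<^sub>M borel)"
    by (rule bker_measurable_comp[OF assms(1)] bker_measurable_comp[OF assms(2)]; measurable)+
  have "(\<lambda>x. \<integral>s. K (fst x) s * L (fst x) (snd x - s) \<partial>lborel) \<in> borel_measurable (N \<Otimes>\<^sub>M borel)"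
    by (rule lborel.borel_measurable_lebesgue_integral) (simp add: case_prod_beta')
  then show "case_prod (\<lambda>p. conv (K p) (L p)) \<in> borel_measurable (N \<Otimes>\<^sub>M borel)"
    unfolding conv_def case_prod_beta' .
  show "norm (conv (K p) (L p) u) \<le> D * C" for p u
    by (rule order_trans[OF norm_conv_le[OF bker_integrable[OF assms(1) sp] bker_bound[OF assms(2)]]])
       (intro mult_right_mono K1 sp bker_nonneg[OF assms(2)])
  show "conv (K p) (L p) u = 0" if "\<bar>u\<bar> > a + b" for p u
  proof -
    have "K p s * L p (u - s) = 0" for s
    proof (cases "\<bar>s\<bar> > a")
      case False
      then have "\<bar>u - s\<bar> > b" using that by linarith
      then show ?thesis by (simp add: bker_supp[OF assms(2)])
    qed (simp add: bker_supp[OF assms(1)])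
    then have "(\<lambda>s. K p s * L p (u - s)) = (\<lambda>s. 0)" by (intro ext)
    then show ?thesis unfolding conv_def by (simp only: Bochner_Integration.integral_zero)
  qed
qed

text \<open>The dominating function is |q(t)| times \<open>B\<close> on the band |u| <=
  \<open>a\<close>, so integrability of \<open>q\<close> alone suffices.\<close>

lemma superpose_product_integrable:
  assumes q: "integrable lborel q" and K: "bker (N \<Otimes>\<^sub>M borel) K B a" and p: "p \<in> space N"
  shows "integrable (lborel \<Otimes>\<^sub>M lborel) (\<lambda>(t, u). q t * K (p, t) u)"
proof -
  have [measurable]: "q \<in> borel_measurable borel" using q by auto
  have [measurable]: "(\<lambda>z. K (p, fst z) (snd z)) \<in> borel_measurable (lborel \<Otimes>\<^sub>M lborel)"
    by (rule bker_measurable_comp[OF K]) (use p in measurable)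
  have "integrable (lborel \<Otimes>\<^sub>M lborel) (\<lambda>(t, u). q t * (complex_of_real B * indicator {-a..a} u))"
  proof (intro lborel_pair.Fubini_integrable)
    show "(\<lambda>(t, u). q t * (complex_of_real B * indicator {-a..a} u)) \<in> borel_measurable (lborel \<Otimes>\<^sub>M lborel)"
      by measurable
    show "integrable lborel (\<lambda>t. \<integral>u. norm (case (t, u) of (t, u) \<Rightarrow> q t * (complex_of_real B * indicator {-a..a} u)) \<partial>lborel)"
      using q by (simp add: norm_mult)
    show "AE t in lborel. integrable lborel (\<lambda>u. case (t, u) of (t, u) \<Rightarrow> q t * (complex_of_real B * indicator {-a..a} u))"
    proof (intro AE_I2)
      fix t
      have "integrable lborel (indicator {-a..a} :: real \<Rightarrow> complex)"
        by (rule integrable_bounded_support[where B=1 and a=a]) (auto simp: indicator_def)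
      then show "integrable lborel (\<lambda>u. case (t, u) of (t, u) \<Rightarrow> q t * (complex_of_real B * indicator {-a..a} u))"
        unfolding case_prod_conv by (intro integrable_mult_right)
    qed
  qed
  then show ?thesis
  proof (rule Bochner_Integration.integrable_bound)
    show "(\<lambda>(t, u). q t * K (p, t) u) \<in> borel_measurable (lborel \<Otimes>\<^sub>M lborel)"
      unfolding case_prod_beta' by measurable
    have "norm (q t * K (p, t) u) \<le> norm (q t * (complex_of_real B * indicator {-a..a} u))" for t u
      using bker_bound[OF K, of "(p,t)" u] bker_supp[OF K, of u "(p,t)"] bker_nonneg[OF K]
      by (auto simp: norm_mult indicator_def intro!: mult_left_mono)
    then show "AE z in lborel \<Otimes>\<^sub>M lborel. norm (case z of (t, u) \<Rightarrow> q t * K (p, t) u) \<le>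
       norm (case z of (t, u) \<Rightarrow> q t * (complex_of_real B * indicator {-a..a} u))"
      by auto
  qed
qed

text \<open>This is how an integral equation with \<open>r\<close> as a parameter and an equation
  between kernels are translated into each other.\<close>

lemma ft_superpose:
  assumes q: "integrable lborel q" and K: "bker (N \<Otimes>\<^sub>M borel) K B a" and p: "p \<in> space N"
  shows "ft (\<lambda>u. \<integral>t. q t * K (p, t) u \<partial>lborel) r = (\<integral>t. q t * ft (K (p, t)) r \<partial>lborel)"
proof -
  have [measurable]: "q \<in> borel_measurable borel" using q by auto
  have [measurable]: "(\<lambda>z. K (p, fst z) (snd z)) \<in> borel_measurable (lborel \<Otimes>\<^sub>M lborel)"
    by (rule bker_measurable_comp[OF K]) (use p in measurable)
  have int: "integrable (lborel \<Otimes>\<^sub>M lborel) (\<lambda>(t, u). q t * K (p, t) u * cis (r * u))"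
  proof (rule Bochner_Integration.integrable_bound[OF superpose_product_integrable[OF assms]])
    show "(\<lambda>(t, u). q t * K (p, t) u * cis (r * u)) \<in> borel_measurable (lborel \<Otimes>\<^sub>M lborel)"
      unfolding case_prod_beta' by measurable
  qed (auto simp: norm_mult)
  have "ft (\<lambda>u. \<integral>t. q t * K (p, t) u \<partial>lborel) r = (\<integral>u. \<integral>t. q t * K (p, t) u * cis (r * u) \<partial>lborel \<partial>lborel)"
    by (simp add: ft_def)
  also have "\<dots> = (\<integral>t. \<integral>u. q t * K (p, t) u * cis (r * u) \<partial>lborel \<partial>lborel)"
    by (rule lborel_pair.Fubini_integral[OF int])
  finally show ?thesis by (simp add: ft_def mult.assoc)
qed

lemma norm_superpose_le:
  assumes q: "integrable lborel q" and K: "\<And>t. norm (g t) \<le> B"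
  shows "norm (\<integral>t. q t * g t \<partial>lborel :: complex) \<le> (\<integral>t. norm (q t) \<partial>lborel) * B"
proof -
  have "norm (\<integral>t. q t * g t \<partial>lborel) \<le> (\<integral>t. norm (q t) * norm (g t) \<partial>lborel)"
    by (rule order_trans[OF integral_norm_bound]) (simp add: norm_mult)
  also have "\<dots> \<le> (\<integral>t. norm (q t) * B \<partial>lborel)"
  proof (rule integral_mono_AE')
    show "integrable lborel (\<lambda>s. norm (q s) * B)" using assms(1) by simp
    show "AE s in lborel. norm (q s) * norm (g s) \<le> norm (q s) * B"
      by (intro AE_I2 mult_left_mono assms) simp
    show "AE s in lborel. 0 \<le> norm (q s) * B"
      using order_trans[OF norm_ge_zero assms(2)] by (intro AE_I2 mult_nonneg_nonneg) auto
  qed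
  finally show ?thesis by simp
qed

lemma bker_superpose:
  assumes q: "integrable lborel q" and K: "bker (N \<Otimes>\<^sub>M borel) K B a"
    and D: "(\<integral>t. norm (q t) \<partial>lborel) \<le> D"
  shows "bker N (\<lambda>p u. \<integral>t. q t * K (p, t) u \<partial>lborel) (D * B) a"
proof (rule bkerI)
  have [measurable]: "q \<in> borel_measurable borel" using q by auto
  have [measurable]: "(\<lambda>z. K (fst (fst z), snd z) (snd (fst z))) \<in> borel_measurable ((N \<Otimes>\<^sub>M borel) \<Otimes>\<^sub>M borel)"
    by (rule bker_measurable_comp[OF K]; measurable)
  have "(\<lambda>x. \<integral>t. q t * K (fst x, t) (snd x) \<partial>lborel) \<in> borel_measurable (N \<Otimes>\<^sub>M borel)"
    by (rule lborel.borel_measurable_lebesgue_integral) (simp add: case_prod_beta')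
  then show "case_prod (\<lambda>p u. \<integral>t. q t * K (p, t) u \<partial>lborel) \<in> borel_measurable (N \<Otimes>\<^sub>M borel)"
    unfolding case_prod_beta' .
  show "norm (\<integral>t. q t * K (p, t) u \<partial>lborel) \<le> D * B" for p u
    by (rule order_trans[OF norm_superpose_le[OF q bker_bound[OF K]]])
       (intro mult_right_mono D bker_nonneg[OF K])
qed (simp add: bker_supp[OF K])

section \<open>Volterra operators on kernels\<close>

lemma integrable_L2_mult:
  fixes f g :: "real \<Rightarrow> real"
  assumes [measurable]: "f \<in> borel_measurable M" "g \<in> borel_measurable M"
    and f: "integrable M (\<lambda>x. (f x)\<^sup>2)" and g: "integrable M (\<lambda>x. (g x)\<^sup>2)"
  shows "integrable M (\<lambda>x. f x * g x)"
proof (rule Bochner_Integration.integrable_bound)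
  show "integrable M (\<lambda>x. ((f x)\<^sup>2 + (g x)\<^sup>2) / 2)" using f g by simp
  have "\<bar>f x * g x\<bar> \<le> ((f x)\<^sup>2 + (g x)\<^sup>2) / 2" for x
    using sum_squares_bound[of "\<bar>f x\<bar>" "\<bar>g x\<bar>"] by (simp add: abs_mult)
  then show "AE x in M. norm (f x * g x) \<le> norm (((f x)\<^sup>2 + (g x)\<^sup>2) / 2)"
    by simp
qed simp

lemma Cauchy_Schwarz_integral:
  fixes f g :: "real \<Rightarrow> real"
  assumes [measurable]: "f \<in> borel_measurable M" "g \<in> borel_measurable M"
    and f: "integrable M (\<lambda>x. (f x)\<^sup>2)" and g: "integrable M (\<lambda>x. (g x)\<^sup>2)"
    and "\<And>x. 0 \<le> f x" "\<And>x. 0 \<le> g x"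
  shows "(\<integral>x. f x * g x \<partial>M) \<le> sqrt (\<integral>x. (f x)\<^sup>2 \<partial>M) * sqrt (\<integral>x. (g x)\<^sup>2 \<partial>M)"
proof -
  have "(\<integral>\<^sup>+x. ennreal (f x) * ennreal (g x) \<partial>M)\<^sup>2
      \<le> (\<integral>\<^sup>+x. (ennreal (f x))\<^sup>2 \<partial>M) * (\<integral>\<^sup>+x. (ennreal (g x))\<^sup>2 \<partial>M)"
    by (rule Cauchy_Schwarz_nn_integral) auto
  also have "(\<integral>\<^sup>+x. (ennreal (f x))\<^sup>2 \<partial>M) = ennreal (\<integral>x. (f x)\<^sup>2 \<partial>M)"
    using assms by (simp add: nn_integral_eq_integral[symmetric] ennreal_power)
  also have "(\<integral>\<^sup>+x. (ennreal (g x))\<^sup>2 \<partial>M) = ennreal (\<integral>x. (g x)\<^sup>2 \<partial>M)"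
    using assms by (simp add: nn_integral_eq_integral[symmetric] ennreal_power)
  also have "(\<integral>\<^sup>+x. ennreal (f x) * ennreal (g x) \<partial>M) = ennreal (\<integral>x. f x * g x \<partial>M)"
    using assms integrable_L2_mult[OF assms(1-4)]
    by (simp add: nn_integral_eq_integral[symmetric] ennreal_mult)
  finally have "ennreal ((\<integral>x. f x * g x \<partial>M)\<^sup>2) \<le> ennreal ((\<integral>x. (f x)\<^sup>2 \<partial>M) * (\<integral>x. (g x)\<^sup>2 \<partial>M))"
    using assms(5,6) by (simp add: ennreal_power ennreal_mult integral_nonneg)
  then have "(\<integral>x. f x * g x \<partial>M)\<^sup>2 \<le> (\<integral>x. (f x)\<^sup>2 \<partial>M) * (\<integral>x. (g x)\<^sup>2 \<partial>M)"
    by (subst (asm) ennreal_le_iff) (auto intro!: mult_nonneg_nonneg integral_nonneg)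
  then show ?thesis by (metis real_le_rsqrt real_sqrt_mult)
qed

text \<open>The norm ball on the whole line: functions vanish off [0, pi], so translations,
  reflections and Fourier transforms need no set integrals. The radius is compared through squares;
  hence \<open>0 \<le> Q\<close> is a separate hypothesis wherever the norm itself is
  wanted.\<close>

definition L2_ball :: "real \<Rightarrow> (real \<Rightarrow> complex) \<Rightarrow> bool" where
  "L2_ball Q q \<longleftrightarrow> q \<in> borel_measurable borel \<and> (\<forall>t. t \<notin> {0..pi} \<longrightarrow> q t = 0) \<and>
     integrable lborel (\<lambda>t. (norm (q t))\<^sup>2) \<and> (\<integral>t. (norm (q t))\<^sup>2 \<partial>lborel) \<le> Q\<^sup>2"

lemma L2_ball_integral_mult_le:
  fixes g :: "real \<Rightarrow> real"
  assumes q: "L2_ball Q q" and "0 \<le> Q" and [measurable]: "g \<in> borel_measurable borel"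
    and g: "integrable lborel (\<lambda>x. (g x)\<^sup>2)" and "\<And>x. 0 \<le> g x"
  shows "integrable lborel (\<lambda>t. norm (q t) * g t)"
    and "(\<integral>t. norm (q t) * g t \<partial>lborel) \<le> Q * sqrt (\<integral>t. (g t)\<^sup>2 \<partial>lborel)"
proof -
  have [measurable]: "q \<in> borel_measurable borel" and
    i: "integrable lborel (\<lambda>t. (norm (q t))\<^sup>2)" and le: "(\<integral>t. (norm (q t))\<^sup>2 \<partial>lborel) \<le> Q\<^sup>2"
    using q by (auto simp: L2_ball_def)
  show "integrable lborel (\<lambda>t. norm (q t) * g t)"
    by (rule integrable_L2_mult) (use i g in auto)
  have "(\<integral>t. norm (q t) * g t \<partial>lborel) \<le> sqrt (\<integral>t. (norm (q t))\<^sup>2 \<partial>lborel) * sqrt (\<integral>t. (g t)\<^sup>2 \<partial>lborel)"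
    by (rule Cauchy_Schwarz_integral) (use i g assms(5) in auto)
  also have "\<dots> \<le> Q * sqrt (\<integral>t. (g t)\<^sup>2 \<partial>lborel)"
    using real_sqrt_le_mono[OF le] \<open>0 \<le> Q\<close> by (intro mult_right_mono) (auto intro: integral_nonneg)
  finally show "(\<integral>t. norm (q t) * g t \<partial>lborel) \<le> Q * sqrt (\<integral>t. (g t)\<^sup>2 \<partial>lborel)" .
qed

lemma L2_ball_integrable:
  assumes q: "L2_ball Q q" and "0 \<le> Q"
  shows "integrable lborel q" and "(\<integral>t. norm (q t) \<partial>lborel) \<le> Q * sqrt pi"
proof -
  have [measurable]: "q \<in> borel_measurable borel" using q by (auto simp: L2_ball_def)
  have eq: "norm (q t) * indicator {0..pi} t = norm (q t)" for t
    using q by (auto simp: L2_ball_def indicator_def)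
  have sq: "(indicator {0..pi} t :: real)\<^sup>2 = indicator {0..pi} t" for t by (auto simp: indicator_def)
  have i: "integrable lborel (indicat_real {0..pi})" 
    by (intro integrable_real_indicator) (auto simp: emeasure_lborel_Icc_eq)
  have "integrable lborel (\<lambda>t. norm (q t))"
    using L2_ball_integral_mult_le(1)[OF assms, of "indicator {0..pi}"] i
    unfolding eq sq by simp
  then show "integrable lborel q" by (simp add: integrable_norm_iff)
  show "(\<integral>t. norm (q t) \<partial>lborel) \<le> Q * sqrt pi"
    using L2_ball_integral_mult_le(2)[OF assms, of "indicator {0..pi}"] i
    unfolding eq sq by simp
qed

text \<open>Cauchy-Schwarz against the weight, whose square exp(2 l t) integrates to at most exp(2 l
  x) / (2 l). The factor 1 / sqrt(2 l) is the gain: for large \<open>l\<close> it compensates any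
  radius \<open>Q\<close>.\<close>

lemma L2_ball_exp_le:
  assumes q: "L2_ball Q q" and "0 \<le> Q" and "0 < l" and x: "0 \<le> x"
  shows "integrable lborel (\<lambda>t. norm (q t) * (indicator {0..x} t * exp (l * t)))"
    and "(\<integral>t. norm (q t) * (indicator {0..x} t * exp (l * t)) \<partial>lborel) \<le> Q / sqrt (2 * l) * exp (l * x)"
proof -
  let ?g = "\<lambda>t. indicator {0..x} t * exp (l * t) :: real"
  have sq: "(?g t)\<^sup>2 = exp (2 * l * t) * indicator {0..x} t" for t
    by (auto simp: indicator_def exp_double[symmetric] mult.assoc)
  have F: "\<And>t. 0 \<le> t \<Longrightarrow> t \<le> x \<Longrightarrow> ((\<lambda>t. exp (2 * l * t) / (2 * l)) has_real_derivative exp (2 * l * t)) (at t)"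
    using \<open>0 < l\<close> by (auto intro!: derivative_eq_intros)
  have hb: "has_bochner_integral lborel (\<lambda>t. (?g t)\<^sup>2) (exp (2 * l * x) / (2 * l) - exp (2 * l * 0) / (2 * l))"
    unfolding sq by (rule has_bochner_integral_FTC_Icc_real[OF x F]) (auto intro!: continuous_intros)
  then have i: "integrable lborel (\<lambda>t. (?g t)\<^sup>2)" by (rule integrable.intros)
  show "integrable lborel (\<lambda>t. norm (q t) * ?g t)"
    by (rule L2_ball_integral_mult_le(1)[OF assms(1,2) _ i]) auto
  have "(\<integral>t. norm (q t) * ?g t \<partial>lborel) \<le> Q * sqrt (\<integral>t. (?g t)\<^sup>2 \<partial>lborel)"
    by (rule L2_ball_integral_mult_le(2)[OF assms(1,2) _ i]) auto
  also have "\<dots> \<le> Q * sqrt ((exp (l * x))\<^sup>2 / (2 * l))"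
    using \<open>0 < l\<close> \<open>0 \<le> Q\<close> has_bochner_integral_integral_eq[OF hb]
    by (intro mult_left_mono real_sqrt_le_mono) (auto simp: exp_double[symmetric] mult.assoc)
  also have "\<dots> = Q / sqrt (2 * l) * exp (l * x)"
    by (simp add: real_sqrt_divide)
  finally show "(\<integral>t. norm (q t) * ?g t \<partial>lborel) \<le> Q / sqrt (2 * l) * exp (l * x)" .
qed

text \<open>For \<^term>\<open>0 \<le> a \<and> a \<le> pi\<close> the transform of \<open>half_box a\<close> is $\sin(\rho a)/\rho$; the cut-off at
  \<^term>\<open>pi\<close> only makes the supports uniformly bounded.\<close>
definition half_box :: "real \<Rightarrow> real \<Rightarrow> complex" where
  "half_box a u = (if \<bar>u\<bar> \<le> a \<and> a \<le> pi then 1 / 2 else 0)"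

lemma bker_half_box: "bker borel half_box (1 / 2) pi"
proof (rule bkerI)
  show "case_prod half_box \<in> borel_measurable (borel \<Otimes>\<^sub>M borel)"
    unfolding half_box_def case_prod_beta' by measurable
qed (auto simp: half_box_def)

lemma integral_norm_half_box_le: "0 \<le> a \<Longrightarrow> (\<integral>u. norm (half_box a u) \<partial>lborel) \<le> a"
  using integral_norm_bounded_support[of "half_box a" "1/2" a] bker_section_measurable[OF bker_half_box, of a]
  by (simp add: half_box_def)

lemma integral_norm_half_box_le_pi: "(\<integral>u. norm (half_box a u) \<partial>lborel) \<le> pi"
proof (cases "0 \<le> a \<and> a \<le> pi")
  case True
  then show ?thesis using integral_norm_half_box_le[of a] by linarith
next
  case False
  then have "half_box a = (\<lambda>_. 0)" by (auto simp: half_box_def fun_eq_iff)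
  then show ?thesis by simp
qed

lemma ft_half_box:
  assumes "0 \<le> a" "a \<le> pi" "r \<noteq> 0"
  shows "ft (half_box a) r = of_real (sin (r * a) / r)"
proof -
  have "ft (half_box a) r = (\<integral>u. indicator {-a..a} u *\<^sub>R (cis (r * u) / 2) \<partial>lborel)"
    unfolding ft_def by (intro Bochner_Integration.integral_cong refl) (use assms in \<open>auto simp: half_box_def indicator_def\<close>)
  also have "\<dots> = cis (r * a) / (2 * \<i> * r) - cis (r * (- a)) / (2 * \<i> * r)"
  proof (rule integral_FTC_atLeastAtMost)
    fix x assume "- a \<le> x" "x \<le> a"
    have *: "((\<lambda>u. inverse (2 * \<i> * r) * cis (r * u)) has_vector_derivative
        inverse (2 * \<i> * r) * (r *\<^sub>R (\<i> * cis (r * x)))) (at x within {- a..a})"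
      by (intro has_vector_derivative_mult_right) (auto simp: has_vector_derivative_def intro!: derivative_eq_intros)
    then show "((\<lambda>u. cis (r * u) / (2 * \<i> * r)) has_vector_derivative cis (r * x) / 2) (at x within {- a..a})"
    proof -
      have "inverse (2 * \<i> * r) * (r *\<^sub>R (\<i> * cis (r * x))) = cis (r * x) / 2"
        using assms by (simp add: complex_eq_iff scaleR_conv_of_real Re_divide Im_divide power2_eq_square)
      moreover have "cis (r * u) / (2 * \<i> * r) = inverse (2 * \<i> * r) * cis (r * u)" for u
        by (simp only: divide_inverse mult.commute)
      ultimately show ?thesis using * by presburger
    qed
  qed (use assms in \<open>auto intro!: continuous_intros\<close>)
  also have "\<dots> = of_real (sin (r * a) / r)"
    using assms by (simp add: complex_eq_iff Re_divide Im_divide power2_eq_square field_simps)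
  finally show ?thesis .
qed

text \<open>Variation of constants on the level of kernels: for x in [0, pi] the transform in
  \<open>u\<close> is the integral over 0 <= t <= x of q(t), sin(r (x - t)) / r and ft (K t) r
  multiplied together. The guard \<open>x \<le> pi\<close> makes the family vanish beyond pi, which
  keeps bound and support uniform over all real \<open>x\<close>.\<close>

definition volterra :: "(real \<Rightarrow> complex) \<Rightarrow> (real \<Rightarrow> real \<Rightarrow> complex) \<Rightarrow> real \<Rightarrow> real \<Rightarrow> complex" where
  "volterra q K x u = (\<integral>t. q t * (if 0 \<le> t \<and> t \<le> x \<and> x \<le> pi then conv (half_box (x - t)) (K t) u else 0) \<partial>lborel)"

lemma bker_if:
  assumes "bker N K B a" "Measurable.pred N P"
  shows "bker N (\<lambda>p u. if P p then K p u else 0) B a"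
proof (rule bkerI)
  note [measurable] = bker_measurable[OF assms(1)] assms(2)
  show "(\<lambda>(p, u). if P p then K p u else 0) \<in> borel_measurable (N \<Otimes>\<^sub>M borel)"
    by measurable
qed (auto simp: bker_bound[OF assms(1)] bker_supp[OF assms(1)] bker_nonneg[OF assms(1)])

lemma bker_volterra_kernel:
  assumes K: "bker borel K B pi"
  shows "bker (borel \<Otimes>\<^sub>M borel)
    (\<lambda>(x, t) u. if 0 \<le> t \<and> t \<le> x \<and> x \<le> pi then conv (half_box (x - t)) (K t) u else 0) (pi * B) (pi + pi)"
proof -
  have "bker (borel \<Otimes>\<^sub>M borel) (\<lambda>p. conv (half_box (fst p - snd p)) (K (snd p))) (pi * B) (pi + pi)"
    by (rule bker_conv[OF bker_reparam[OF bker_half_box] bker_reparam[OF K]]) (auto simp: integral_norm_half_box_le_pi space_pair_measure)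
  then have "bker (borel \<Otimes>\<^sub>M borel) (\<lambda>p u. if 0 \<le> snd p \<and> snd p \<le> fst p \<and> fst p \<le> pi
     then conv (half_box (fst p - snd p)) (K (snd p)) u else 0) (pi * B) (pi + pi)"
    by (rule bker_if) measurable
  then show ?thesis by (simp add: case_prod_beta')
qed

text \<open>Supports add up: (x - t) + t = x. This finite speed of propagation is what finally makes
  the equation for the potential triangular.\<close>

lemma volterra_support:
  assumes K: "\<And>t u. \<bar>u\<bar> > t \<Longrightarrow> K t u = 0" and "\<bar>u\<bar> > x"
  shows "volterra q K x u = 0"
proof -
  have "conv (half_box (x - t)) (K t) u = 0" for t
  proof -
    have "half_box (x - t) s * K t (u - s) = 0" for s
    proof (cases "\<bar>s\<bar> \<le> x - t")
      case True
      then have "\<bar>u - s\<bar> > t" using assms(2) by linarith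
      then show ?thesis using K by simp
    qed (simp add: half_box_def)
    then have "(\<lambda>s. half_box (x - t) s * K t (u - s)) = (\<lambda>s. 0)" by (intro ext)
    then show ?thesis unfolding conv_def by (simp only: Bochner_Integration.integral_zero)
  qed
  then have "(\<lambda>t. q t * (if 0 \<le> t \<and> t \<le> x \<and> x \<le> pi then conv (half_box (x - t)) (K t) u else 0)) = (\<lambda>t. 0)"
    by (intro ext) (simp only: if_cancel mult_zero_right)
  then show ?thesis unfolding volterra_def by (simp only: Bochner_Integration.integral_zero)
qed

text \<open>Convolution alone would give the support radius 2 pi. \<open>volterra_support\<close>
  for \<open>x \<le> pi\<close>, and the guard for larger \<open>x\<close>, bring it back to pi, so
  that the operator can be iterated.\<close>

lemma bker_volterra:
  assumes q: "integrable lborel q" and K: "bker borel K B pi" and s: "\<And>t u. \<bar>u\<bar> > t \<Longrightarrow> K t u = 0"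
  shows "bker borel (volterra q K) ((\<integral>t. norm (q t) \<partial>lborel) * (pi * B)) pi"
proof -
  have *: "bker borel (volterra q K) ((\<integral>t. norm (q t) \<partial>lborel) * (pi * B)) (pi + pi)"
    using bker_superpose[OF q bker_volterra_kernel[OF K]] by (simp add: volterra_def[abs_def])
  show ?thesis
  proof (rule bkerI)
    show "case_prod (volterra q K) \<in> borel_measurable (borel \<Otimes>\<^sub>M borel)" using * by (rule bker_measurable)
    show "norm (volterra q K x u) \<le> (\<integral>t. norm (q t) \<partial>lborel) * (pi * B)" for x u using * by (rule bker_bound)
    show "volterra q K x u = 0" if "\<bar>u\<bar> > pi" for x u
    proof (cases "x \<le> pi")
      case True
      then show ?thesis using that by (intro volterra_support[OF s]) auto
    next
      case False
      then have "\<not> (0 \<le> t \<and> t \<le> x \<and> x \<le> pi)" for t by auto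
      then show ?thesis unfolding volterra_def by (simp only: if_False) simp
    qed
  qed
qed

text \<open>A sup norm weighted by exp(- l x) turns the operator into a contraction by 1/2:
  \<open>half_box\<close> contributes its L1 norm, at most pi, \<open>L2_ball_exp_le\<close>
  contributes Q / sqrt(2 l), and the condition on \<open>l\<close> says that pi Q / sqrt(2 l) is at
  most 1/2.\<close>

lemma volterra_contraction:
  assumes q: "L2_ball Q q" and Q: "0 \<le> Q" "0 < l" "2 * pi * Q \<le> sqrt (2 * l)"
    and K: "\<And>t u. norm (K t u) \<le> c * exp (l * t)"
  shows "norm (volterra q K x u) \<le> c / 2 * exp (l * x)"
proof (cases "0 \<le> x \<and> x \<le> pi")
  case True
  have c: "0 \<le> c" using order_trans[OF norm_ge_zero K[of 0 0]] by simp
  have "norm (volterra q K x u) \<le> (\<integral>t. pi * c * (norm (q t) * (indicator {0..x} t * exp (l * t))) \<partial>lborel)"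
    unfolding volterra_def
  proof (rule order_trans[OF integral_norm_bound], rule integral_mono_AE')
    show "integrable lborel (\<lambda>t. pi * c * (norm (q t) * (indicator {0..x} t * exp (l * t))))"
      using L2_ball_exp_le(1)[OF q Q(1,2)] True by simp
    have "norm (conv (half_box (x - t)) (K t) u) \<le> pi * (c * exp (l * t))" for t
      by (rule order_trans[OF norm_conv_le[OF bker_integrable[OF bker_half_box] K]])
         (use c in \<open>auto intro!: mult_right_mono integral_norm_half_box_le_pi\<close>)
    then have "norm (q t * (if 0 \<le> t \<and> t \<le> x \<and> x \<le> pi then conv (half_box (x - t)) (K t) u else 0))
        \<le> norm (q t) * (indicator {0..x} t * (pi * (c * exp (l * t))))" for t
      using c by (auto simp: norm_mult indicator_def intro!: mult_left_mono)
    then show "AE t in lborel. norm (q t * (if 0 \<le> t \<and> t \<le> x \<and> x \<le> pi then conv (half_box (x - t)) (K t) u else 0))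
        \<le> pi * c * (norm (q t) * (indicator {0..x} t * exp (l * t)))"
      by (simp add: ac_simps)
  qed (use c in auto)
  also have "\<dots> \<le> pi * c * (Q / sqrt (2 * l) * exp (l * x))"
    unfolding integral_mult_right_zero
    using True c by (intro mult_left_mono L2_ball_exp_le(2)[OF q Q(1,2)]) auto
  also have "\<dots> = c * exp (l * x) * (pi * Q / sqrt (2 * l))" by simp
  also have "\<dots> \<le> c * exp (l * x) * (1 / 2)"
    using Q c by (intro mult_left_mono) (auto simp: divide_simps)
  finally show ?thesis by simp
next
  case False
  then have "\<not> (0 \<le> t \<and> t \<le> x \<and> x \<le> pi)" for t by auto
  then have "volterra q K x u = 0" unfolding volterra_def by (simp only: if_False) simp
  moreover have "0 \<le> c" using order_trans[OF norm_ge_zero K[of 0 0]] by simp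
  ultimately show ?thesis by simp
qed

lemma conv_diff_right:
  assumes f: "integrable lborel f" and "bker N K B a" "bker N L C b" "p \<in> space N"
  shows "conv f (\<lambda>u. K p u - L p u) u = conv f (K p) u - conv f (L p) u"
proof -
  have i: "integrable lborel (\<lambda>s. f s * g (u - s))"
    if [measurable]: "g \<in> borel_measurable borel" and g: "\<And>u. norm (g u) \<le> B" for g :: "real \<Rightarrow> complex" and B
  proof (rule Bochner_Integration.integrable_bound)
    have [measurable]: "f \<in> borel_measurable borel" using f by auto
    show "integrable lborel (\<lambda>s. f s * complex_of_real B)" using f by simp
    show "(\<lambda>s. f s * g (u - s)) \<in> borel_measurable lborel" by measurable
    have "norm (f s * g (u - s)) \<le> norm (f s * complex_of_real B)" for s
      using g[of "u - s"] by (auto simp: norm_mult intro!: mult_left_mono order_trans[OF g])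
    then show "AE s in lborel. norm (f s * g (u - s)) \<le> norm (f s * complex_of_real B)" by simp
  qed
  show ?thesis
    unfolding conv_def right_diff_distrib
    by (intro Bochner_Integration.integral_diff i[OF bker_section_measurable[OF assms(2,4)] bker_bound[OF assms(2)]]
        i[OF bker_section_measurable[OF assms(3,4)] bker_bound[OF assms(3)]])
qed

lemma volterra_integrand_integrable:
  assumes q: "integrable lborel q" and K: "bker borel K B pi"
  shows "integrable lborel (\<lambda>t. q t * (if 0 \<le> t \<and> t \<le> x \<and> x \<le> pi then conv (half_box (x - t)) (K t) u else 0))"
proof (rule Bochner_Integration.integrable_bound)
  have [measurable]: "q \<in> borel_measurable borel" using q by auto
  let ?G = "\<lambda>(x :: real, t) u. if 0 \<le> t \<and> t \<le> x \<and> x \<le> pi then conv (half_box (x - t)) (K t) u else 0"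
  have [measurable]: "(\<lambda>t. if 0 \<le> t \<and> t \<le> x \<and> x \<le> pi then conv (half_box (x - t)) (K t) u else 0) \<in> borel_measurable borel"
    using bker_measurable_comp[OF bker_volterra_kernel[OF K], of "\<lambda>t. (x, t)" borel "\<lambda>_. u"] by simp
  show "(\<lambda>t. q t * (if 0 \<le> t \<and> t \<le> x \<and> x \<le> pi then conv (half_box (x - t)) (K t) u else 0)) \<in> borel_measurable lborel"
    by measurable
  show "integrable lborel (\<lambda>t. q t * complex_of_real (pi * B))" using q by simp
  have *: "norm (?G (x, t) u) \<le> pi * B" for t using bker_bound[OF bker_volterra_kernel[OF K]] .
  have "norm (q t * ?G (x, t) u) \<le> norm (q t * complex_of_real (pi * B))" for t
    unfolding norm_mult norm_of_real by (rule mult_left_mono[OF order_trans[OF * abs_ge_self]]) simp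
  then show "AE t in lborel. norm (q t * (if 0 \<le> t \<and> t \<le> x \<and> x \<le> pi then conv (half_box (x - t)) (K t) u else 0))
      \<le> norm (q t * complex_of_real (pi * B))" by simp
qed

lemma volterra_diff:
  assumes q: "integrable lborel q" and K: "bker borel K B pi" and L: "bker borel L C pi"
  shows "volterra q (\<lambda>x u. K x u - L x u) x u = volterra q K x u - volterra q L x u"
  unfolding volterra_def
  by (subst Bochner_Integration.integral_diff[symmetric, OF volterra_integrand_integrable[OF q K] volterra_integrand_integrable[OF q L]])
     (auto intro!: Bochner_Integration.integral_cong
        simp: conv_diff_right[OF bker_integrable[OF bker_half_box] K L] right_diff_distrib)

section \<open>Transmutation kernels\<close>

text \<open>The inhomogeneous term of the kernel equation: what the integral equation for y has on
  its right besides cos(r x) when y under the integral is replaced by the free solution cos(r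
  t).\<close>

definition volterra_free :: "(real \<Rightarrow> complex) \<Rightarrow> complex \<Rightarrow> real \<Rightarrow> real \<Rightarrow> complex" where
  "volterra_free q H x u = H * half_box x u +
     (\<integral>t. q t * (if 0 \<le> t \<and> t \<le> x \<and> x \<le> pi then sym_shift t (half_box (x - t)) u else 0) \<partial>lborel)"

lemma bker_free_kernel:
  "bker (borel \<Otimes>\<^sub>M borel)
    (\<lambda>(x, t) u. if 0 \<le> t \<and> t \<le> x \<and> x \<le> pi then sym_shift t (half_box (x - t)) u else 0) (1 / 2) (pi + pi)"
proof -
  \<comment> \<open>\<open>bker_shift\<close> wants a shift that is bounded for every parameter, so
    \<open>t\<close> is clamped to [0, pi]. Where the guard of the final kernel holds, clamping
    changes nothing.\<close>
  have "bker (borel \<Otimes>\<^sub>M borel) (\<lambda>p. sym_shift (max 0 (min (snd p) pi)) (half_box (fst p - snd p))) (1 / 2) (pi + pi)"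
    by (rule bker_shift[OF bker_reparam[OF bker_half_box]]) auto
  then have "bker (borel \<Otimes>\<^sub>M borel) (\<lambda>p u. if 0 \<le> snd p \<and> snd p \<le> fst p \<and> fst p \<le> pi
     then sym_shift (max 0 (min (snd p) pi)) (half_box (fst p - snd p)) u else 0) (1 / 2) (pi + pi)"
    by (rule bker_if) measurable
  then show ?thesis by (simp add: case_prod_beta' cong: if_cong)
qed

lemma volterra_free_support:
  assumes "\<bar>u\<bar> > x"
  shows "volterra_free q H x u = 0"
proof -
  have "(if 0 \<le> t \<and> t \<le> x \<and> x \<le> pi then sym_shift t (half_box (x - t)) u else 0) = 0" for t
    using assms by (auto simp: sym_shift_def half_box_def)
  then show ?thesis using assms unfolding volterra_free_def by (simp only: mult_zero_right) (simp add: half_box_def)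
qed

lemma bker_volterra_free:
  assumes q: "integrable lborel q"
  shows "bker borel (volterra_free q H) (norm H * (1 / 2) + (\<integral>t. norm (q t) \<partial>lborel) * (1 / 2)) pi"
proof -
  have "bker borel (\<lambda>x u. H * half_box x u) (norm H * (1 / 2)) (pi + pi)"
    by (rule bker_mono[OF bker_cmult[OF bker_half_box]]) auto
  from bker_add[OF this bker_superpose[OF q bker_free_kernel order.refl]]
  have *: "bker borel (volterra_free q H) (norm H * (1 / 2) + (\<integral>t. norm (q t) \<partial>lborel) * (1 / 2)) (pi + pi)"
    by (simp add: volterra_free_def[abs_def])
  show ?thesis
  proof (rule bkerI)
    show "volterra_free q H x u = 0" if "\<bar>u\<bar> > pi" for x u
    proof (cases "x \<le> pi")
      case True
      then show ?thesis using that by (intro volterra_free_support) auto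
    next
      case False
      then have "\<not> (0 \<le> t \<and> t \<le> x \<and> x \<le> pi)" for t by auto
      then show ?thesis using False unfolding volterra_free_def by (simp only: if_False) (simp add: half_box_def)
    qed
  qed (rule bker_measurable[OF *] bker_bound[OF *])+
qed

text \<open>The factor 2 sums a geometric series of ratio 1/2. The bracket bounds
  \<open>volterra_free\<close> through |H| <= Q and the L1 bound Q sqrt(pi) of the potential. The
  exponential is the weight exp(l x) at x = pi, where l = 2 pi^2 Q^2 + 1 is positive and satisfies
  (2 pi Q)^2 <= 2 l, as \<open>volterra_contraction\<close> demands.\<close>

definition tm_bound :: "real \<Rightarrow> real" where
  "tm_bound Q = 2 * (Q * (1 / 2) + Q * sqrt pi * (1 / 2)) * exp ((2 * pi\<^sup>2 * Q\<^sup>2 + 1) * pi)"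

text \<open>A Neumann series, convergent in the sup norm weighted by exp(- l x). All iterates live
  in |u| <= x, hence so does the sum.\<close>

lemma transmutation_kernel:
  assumes q: "L2_ball Q q" and Q: "0 \<le> Q" and H: "norm H \<le> Q"
  obtains K where "bker borel K (tm_bound Q) pi" "\<And>x u. \<bar>u\<bar> > x \<Longrightarrow> K x u = 0"
    "\<And>x u. K x u = volterra_free q H x u + volterra q K x u"
proof -
  note qi = L2_ball_integrable[OF q Q]
  define l where "l = 2 * pi\<^sup>2 * Q\<^sup>2 + 1"
  have l: "0 < l" by (auto simp: l_def intro!: add_nonneg_pos mult_nonneg_nonneg)
  have "(2 * pi * Q)\<^sup>2 \<le> 2 * l" by (simp add: l_def power_mult_distrib)
  then have l2: "2 * pi * Q \<le> sqrt (2 * l)" by (rule real_le_rsqrt)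
  define c where "c = Q * (1 / 2) + Q * sqrt pi * (1 / 2)"
  have c: "0 \<le> c" using Q by (simp add: c_def)
  define D where "D n = (volterra q ^^ n) (volterra_free q H)" for n
  have D0: "D 0 = volterra_free q H" and DS: "D (Suc n) = volterra q (D n)" for n by (simp_all add: D_def)
  have Dsupp: "D n x u = 0" if "\<bar>u\<bar> > x" for n x u
    using that by (induction n arbitrary: x u) (simp_all add: D0 DS volterra_free_support volterra_support)
  have "\<exists>B. bker borel (D n) B pi" for n
  proof (induction n)
    case 0 show ?case unfolding D0 by (rule exI, rule bker_volterra_free[OF qi(1)])
  next
    case (Suc n)
    then obtain B where "bker borel (D n) B pi" by blast
    then show ?case unfolding DS by (intro exI) (rule bker_volterra[OF qi(1) _ Dsupp])
  qed
  then obtain B where DB: "bker borel (D n) (B n) pi" for n by metis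
  have Dle: "norm (D n x u) \<le> c / 2 ^ n * exp (l * x)" for n x u
  proof (induction n arbitrary: x u)
    case 0
    \<comment> \<open>Off the support the kernel vanishes. On it \<open>x\<close> is at least |u|,
      hence nonnegative, so the weight exp(l x) is at least 1 and may be inserted.\<close>
    show ?case
    proof (cases "\<bar>u\<bar> > x")
      case False
      then have "0 \<le> x" by linarith
      have "norm (D 0 x u) \<le> norm H * (1 / 2) + (\<integral>t. norm (q t) \<partial>lborel) * (1 / 2)"
        unfolding D0 by (rule bker_bound[OF bker_volterra_free[OF qi(1)]])
      also have "\<dots> \<le> c" unfolding c_def using H qi(2) by (intro add_mono mult_right_mono) auto
      also have "\<dots> \<le> c * exp (l * x)" using mult_left_mono[OF _ c, of 1 "exp (l * x)"] \<open>0 \<le> x\<close> l by simp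
      finally show ?thesis by simp
    qed (use Dsupp c in simp)
  next
    case (Suc n)
    show ?case unfolding DS using volterra_contraction[OF q Q l l2, of "D n" "c / 2 ^ n" x u] Suc by (simp add: mult.commute)
  qed
  define K where "K x u = (\<Sum>n. D n x u)" for x u
  have sg: "summable (\<lambda>n. c / 2 ^ n * exp (l * x))" for x
    using summable_mult2[OF summable_mult[OF summable_geometric[of "1/2 :: real"]], of c "exp (l * x)"]
    by (simp add: power_divide)
  have sD: "summable (\<lambda>n. D n x u)" for x u
    by (rule summable_comparison_test'[OF sg Dle])
  define S where "S N x u = (\<Sum>n<N. D n x u)" for N x u
  have tail: "norm (K x u - S N x u) \<le> 2 * c / 2 ^ N * exp (l * x)" for x u N
  proof -
    have "K x u - S N x u = (\<Sum>n. D (n + N) x u)"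
      unfolding K_def S_def using suminf_minus_initial_segment[OF sD[of x u], of N] by simp
    also have "norm \<dots> \<le> (\<Sum>n. c / 2 ^ (n + N) * exp (l * x))"
      by (rule norm_suminf_le[OF Dle]) (use sg summable_ignore_initial_segment in blast)
    also have "\<dots> = (\<Sum>n. (c / 2 ^ N * exp (l * x)) * (1 / 2) ^ n)"
      by (simp add: power_add power_divide field_simps)
    also have "\<dots> = (c / 2 ^ N * exp (l * x)) * 2"
      by (subst suminf_mult) (auto simp: suminf_geometric)
    finally show ?thesis by (simp add: field_simps)
  qed
  have Kle: "norm (K x u) \<le> 2 * c * exp (l * x)" for x u using tail[of x u 0] by (simp add: S_def)
  have Kpi: "K x u = 0" if "x > pi" for x u
  proof -
    have "\<not> (0 \<le> t \<and> t \<le> x \<and> x \<le> pi)" for t using that by auto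
    then have "volterra_free q H x u = 0" "volterra q L x u = 0" for L
      unfolding volterra_free_def volterra_def using that by (simp only: if_False, simp add: half_box_def)+
    then have "D n x u = 0" for n by (cases n) (simp_all only: D0 DS)
    then show ?thesis by (simp add: K_def)
  qed
  have Ksupp: "K x u = 0" if "\<bar>u\<bar> > x" for x u using Dsupp[OF that] by (simp add: K_def)
  have Kb: "bker borel K (tm_bound Q) pi"
  proof (rule bkerI)
    have [measurable]: "(\<lambda>z. D n (fst z) (snd z)) \<in> borel_measurable (borel \<Otimes>\<^sub>M borel)" for n
      using bker_measurable[OF DB[of n]] by (simp add: case_prod_beta')
    show "case_prod K \<in> borel_measurable (borel \<Otimes>\<^sub>M borel)"
      unfolding K_def case_prod_beta' by measurable
    show "norm (K x u) \<le> tm_bound Q" for x u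
    proof (cases "x \<le> pi")
      case True
      have "norm (K x u) \<le> 2 * c * exp (l * x)" by (rule Kle)
      also have "\<dots> \<le> 2 * c * exp (l * pi)" using True l c by (intro mult_left_mono) auto
      also have "\<dots> = tm_bound Q" by (simp add: tm_bound_def c_def l_def)
      finally show ?thesis .
    next
      case False
      then show ?thesis using Kpi[of x u] Q by (simp add: tm_bound_def)
    qed
    show "K x u = 0" if "\<bar>u\<bar> > pi" for x u
      using that by (cases "x > pi") (auto intro: Kpi Ksupp)
  qed
  have Sb: "\<exists>C. bker borel (S N) C pi" for N
  proof (induction N)
    case 0 show ?case by (rule exI[of _ 0], rule bkerI) (simp_all add: S_def case_prod_beta')
  next
    case (Suc N)
    then obtain C where "bker borel (S N) C pi" by blast
    from bker_add[OF this DB[of N]] show ?case by (auto simp: S_def[abs_def])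
  qed
  then obtain C where SC: "bker borel (S N) (C N) pi" for N by metis
  \<comment> \<open>The operator shifts the partial sum by one index and loses the free term.
    Additivity over the finite sum is obtained by letting \<open>volterra_diff\<close> peel off one
    iterate at a time.\<close>
  have VS: "volterra q (S N) x u = S (Suc N) x u - volterra_free q H x u" for N x u
  proof (induction N)
    case 0 show ?case by (simp add: S_def volterra_def conv_def D0 cong: if_cong)
  next
    case (Suc N)
    have "volterra q (\<lambda>x u. S (Suc N) x u - D N x u) x u = volterra q (S (Suc N)) x u - volterra q (D N) x u"
      by (rule volterra_diff[OF qi(1) SC DB])
    moreover have "(\<lambda>x u. S (Suc N) x u - D N x u) = S N" by (simp add: S_def fun_eq_iff)
    ultimately have "volterra q (S N) x u = volterra q (S (Suc N)) x u - volterra q (D N) x u" by simp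
    moreover have "S (Suc (Suc N)) x u = S (Suc N) x u + volterra q (D N) x u" by (simp add: S_def DS)
    ultimately show ?case using Suc by algebra
  qed
  \<comment> \<open>No series is exchanged with an integral: \<open>K\<close> and \<open>S N\<close>
    differ by at most 2 c / 2^N in the weighted norm, the contraction halves this difference, and N
    tends to infinity.\<close>
  have "K x u = volterra_free q H x u + volterra q K x u" for x u
  proof -
    have "norm (volterra q K x u - (S (Suc N) x u - volterra_free q H x u)) \<le> 2 * c / 2 ^ N / 2 * exp (l * x)" for N
      using volterra_contraction[OF q Q l l2, of "\<lambda>x u. K x u - S N x u" "2 * c / 2 ^ N" x u] tail
      by (simp add: volterra_diff[OF qi(1) Kb SC] VS)
    moreover have "norm (K x u - S (Suc N) x u) \<le> 2 * c / 2 ^ (Suc N) * exp (l * x)" for N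
      by (rule tail)
    ultimately have le: "norm (volterra_free q H x u + volterra q K x u - K x u) \<le> 2 * c * exp (l * x) * (1 / 2) ^ N" for N
    proof -
      have "volterra_free q H x u + volterra q K x u - K x u = (volterra q K x u - (S (Suc N) x u - volterra_free q H x u)) - (K x u - S (Suc N) x u)"
        by simp
      also have "norm \<dots> \<le> 2 * c / 2 ^ N / 2 * exp (l * x) + 2 * c / 2 ^ (Suc N) * exp (l * x)"
        by (rule order_trans[OF norm_triangle_ineq4 add_mono]) fact+
      also have "\<dots> = 2 * c * exp (l * x) * (1 / 2) ^ N" by (simp add: power_divide)
      finally show ?thesis .
    qed
    have "(\<lambda>N. 2 * c * exp (l * x) * (1 / 2 :: real) ^ N) \<longlonglongrightarrow> 2 * c * exp (l * x) * 0"
      by (intro tendsto_intros LIMSEQ_power_zero) simp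
    then have "norm (volterra_free q H x u + volterra q K x u - K x u) \<le> 0"
      using LIMSEQ_le_const[OF _ , of _ "0::real"] le by (intro LIMSEQ_le_const) auto
    then show ?thesis by simp
  qed
  with Kb Ksupp show ?thesis by (rule that)
qed

section \<open>The solution represented by the kernel\<close>

definition csol :: "(real \<Rightarrow> real \<Rightarrow> complex) \<Rightarrow> real \<Rightarrow> real \<Rightarrow> complex" where
  "csol K r x = of_real (cos (r * x)) + ft (K x) r"

text \<open>Under the Fourier transform in \<open>u\<close>, convolutions of the fixed point
  equation become products and symmetric shifts become cosines. The two integrals then merge,
  because cos(r t) + ft (K t) r is \<open>csol\<close> again. The result is the variation of
  constants formula for y(0) = 1, y'(0) = H.\<close>

lemma csol_volterra:
  assumes q: "integrable lborel q" and K: "bker borel K B pi"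
    and eq: "\<And>x u. K x u = volterra_free q H x u + volterra q K x u"
    and x: "0 \<le> x" "x \<le> pi" and r: "r \<noteq> 0"
  shows "csol K r x = of_real (cos (r * x)) + H * of_real (sin (r * x) / r) +
    (\<integral>t. q t * (if 0 \<le> t \<and> t \<le> x then of_real (sin (r * (x - t)) / r) * csol K r t else 0) \<partial>lborel)"
proof -
  let ?A = "\<lambda>(x, t) u. if 0 \<le> t \<and> t \<le> x \<and> x \<le> pi then sym_shift t (half_box (x - t)) u else 0"
  let ?C = "\<lambda>(x, t) u. if 0 \<le> t \<and> t \<le> x \<and> x \<le> pi then conv (half_box (x - t)) (K t) u else 0"
  have kA: "bker (borel \<Otimes>\<^sub>M borel) ?A (1 / 2) (pi + pi)" by (rule bker_free_kernel)
  have kC: "bker (borel \<Otimes>\<^sub>M borel) ?C (pi * B) (pi + pi)" by (rule bker_volterra_kernel[OF K])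
  have iV: "integrable lborel (volterra q K x)"
    using bker_integrable[OF bker_superpose[OF q kC order.refl], of x] by (simp add: volterra_def[abs_def])
  have iA: "integrable lborel (\<lambda>u. \<integral>t. q t * ?A (x, t) u \<partial>lborel)"
    using bker_integrable[OF bker_superpose[OF q kA order.refl], of x] by simp
  have iH: "integrable lborel (\<lambda>u. H * half_box x u)"
    using bker_integrable[OF bker_half_box, of x] by simp
  have f1: "volterra_free q H x = (\<lambda>u. H * half_box x u + (\<integral>t. q t * ?A (x, t) u \<partial>lborel))"
    by (simp add: volterra_free_def fun_eq_iff)
  have iF: "integrable lborel (volterra_free q H x)" unfolding f1 using iH iA by (rule Bochner_Integration.integrable_add)
  have "ft (K x) r = ft (\<lambda>u. volterra_free q H x u + volterra q K x u) r"
    using eq by (intro arg_cong2[where f=ft]) auto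
  also have "\<dots> = ft (volterra_free q H x) r + ft (volterra q K x) r"
    by (rule ft_add[OF iF iV])
  also have "ft (volterra_free q H x) r = H * ft (half_box x) r + (\<integral>t. q t * ft (?A (x, t)) r \<partial>lborel)"
    unfolding f1 ft_add[OF iH iA] ft_cmult using ft_superpose[OF q kA, of x r] by simp
  also have "ft (volterra q K x) r = (\<integral>t. q t * ft (?C (x, t)) r \<partial>lborel)"
    using ft_superpose[OF q kC, of x r] by (simp add: volterra_def[abs_def])
  also have "H * ft (half_box x) r + (\<integral>t. q t * ft (?A (x, t)) r \<partial>lborel) + (\<integral>t. q t * ft (?C (x, t)) r \<partial>lborel)
    = H * ft (half_box x) r + (\<integral>t. q t * ft (?A (x, t)) r + q t * ft (?C (x, t)) r \<partial>lborel)"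
  proof -
    have b: "integrable lborel (\<lambda>t. q t * g t)" if [measurable]: "g \<in> borel_measurable borel" and g: "\<And>t. norm (g t) \<le> M" for g :: "real \<Rightarrow> complex" and M
    proof (rule Bochner_Integration.integrable_bound)
      have [measurable]: "q \<in> borel_measurable borel" using q by auto
      show "integrable lborel (\<lambda>t. q t * complex_of_real M)" using q by simp
      show "(\<lambda>t. q t * g t) \<in> borel_measurable lborel" by measurable
      show "AE t in lborel. norm (q t * g t) \<le> norm (q t * complex_of_real M)"
        unfolding norm_mult norm_of_real by (intro AE_I2 mult_left_mono order_trans[OF g abs_ge_self]) auto
    qed
    have m: "(\<lambda>t. ft (k (x, t)) r) \<in> borel_measurable borel" if "bker (borel \<Otimes>\<^sub>M borel) k M N" for k :: "real \<times> real \<Rightarrow> real \<Rightarrow> complex" and M N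
      using bker_ft_measurable[OF bker_reparam[OF that, of "\<lambda>t. (x, t)" borel]] by simp
    have n: "norm (ft (k (x, t)) r) \<le> 2 * (pi + pi) * M" if "bker (borel \<Otimes>\<^sub>M borel) k M (pi + pi)" for k :: "real \<times> real \<Rightarrow> real \<Rightarrow> complex" and M t
      by (rule bker_norm_ft_le[OF that]) (auto simp: space_pair_measure)
    show ?thesis
      using Bochner_Integration.integral_add[OF b[OF m[OF kA] n[OF kA]] b[OF m[OF kC] n[OF kC]]] by simp
  qed
  also have "ft (half_box x) r = of_real (sin (r * x) / r)" by (rule ft_half_box[OF x r])
  also have "(\<integral>t. q t * ft (?A (x, t)) r + q t * ft (?C (x, t)) r \<partial>lborel) =
    (\<integral>t. q t * (if 0 \<le> t \<and> t \<le> x then of_real (sin (r * (x - t)) / r) * csol K r t else 0) \<partial>lborel)"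
  proof (intro Bochner_Integration.integral_cong refl)
    fix t
    show "q t * ft (?A (x, t)) r + q t * ft (?C (x, t)) r =
      q t * (if 0 \<le> t \<and> t \<le> x then of_real (sin (r * (x - t)) / r) * csol K r t else 0)"
    proof (cases "0 \<le> t \<and> t \<le> x")
      case True
      have hb: "ft (half_box (x - t)) r = of_real (sin (r * (x - t)) / r)" by (rule ft_half_box) (use x True r in auto)
      have "ft (?A (x, t)) r = of_real (cos (r * t)) * of_real (sin (r * (x - t)) / r)"
        using True x ft_sym_shift[OF bker_integrable[OF bker_half_box], of "x - t" t r] by (simp add: hb)
      moreover have "ft (?C (x, t)) r = of_real (sin (r * (x - t)) / r) * ft (K t) r"
        using True x ft_conv[OF bker_integrable[OF bker_half_box] bker_integrable[OF K], of "x - t" t r] by (simp add: hb)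
      ultimately show ?thesis using True by (simp add: csol_def ring_distribs add_divide_distrib mult_ac)
    next
      case False
      then have "?A (x, t) = (\<lambda>u. 0)" "?C (x, t) = (\<lambda>u. 0)" by auto
      then have "ft (?A (x, t)) r = 0" "ft (?C (x, t)) r = 0" by (simp_all add: ft_def)
      then show ?thesis using False by (simp only: if_False) simp
    qed
  qed
  finally show ?thesis by (simp add: csol_def)
qed

section \<open>Wronskians of Caratheodory solutions\<close>

lemma integrable_mult_bounded:
  fixes f g :: "real \<Rightarrow> complex"
  assumes f: "integrable M f" and [measurable]: "g \<in> borel_measurable M" and g: "\<And>t. norm (g t) \<le> B"
  shows "integrable M (\<lambda>t. f t * g t)"
proof (rule Bochner_Integration.integrable_bound)
  have [measurable]: "f \<in> borel_measurable M" using f by auto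
  show "integrable M (\<lambda>t. f t * complex_of_real B)" using f by simp
  show "(\<lambda>t. f t * g t) \<in> borel_measurable M" by measurable
  show "AE t in M. norm (f t * g t) \<le> norm (f t * complex_of_real B)"
    unfolding norm_mult norm_of_real by (intro AE_I2 mult_left_mono order_trans[OF g abs_ge_self]) auto
qed

lemma integrable_lborel_indicator_Icc [simp]: "integrable lborel (indicat_real {a..b::real})"
  by (intro integrable_real_indicator) (auto simp: emeasure_lborel_Icc_eq)

lemma set_integrable_subinterval:
  fixes f :: "real \<Rightarrow> complex"
  assumes "set_integrable lborel {0..b} f" "x \<le> b"
  shows "set_integrable lborel {0..x} f"
  by (rule set_integrable_subset[OF assms(1)]) (use assms(2) in auto)

lemma LINT_cmult: "(LINT t:A|M. c * f t) = c * (LINT t:A|M. f t :: complex)"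
  unfolding set_lebesgue_integral_def mult_scaleR_right[symmetric] by (rule integral_mult_right_zero)

lemma LINT_singleton:
  fixes a :: real
  shows "(LINT t:{a..a}|lborel. f t) = (0 :: complex)"
  unfolding set_lebesgue_integral_def
  by (rule integral_eq_zero_AE, rule AE_mp[OF AE_lborel_singleton[of a]]) (simp add: indicator_def)

lemma continuous_on_LINT:
  fixes f :: "real \<Rightarrow> complex"
  assumes "set_integrable lborel {0..b} f"
  shows "continuous_on {0..b} (\<lambda>x. LINT t:{0..x}|lborel. f t)"
proof -
  have "continuous_on {0..b} (\<lambda>x. integral {0..x} f)"
    by (rule indefinite_integral_continuous_1) (rule set_borel_integral_eq_integral(1)[OF assms])
  moreover have "(LINT t:{0..x}|lborel. f t) = integral {0..x} f" if "x \<in> {0..b}" for x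
    using that by (intro set_borel_integral_eq_integral(2) set_integrable_subinterval[OF assms]) auto
  ultimately show ?thesis by (rule continuous_on_eq[OF _ sym])
qed

lemma LINT_has_vector_derivative:
  fixes f :: "real \<Rightarrow> complex"
  assumes f: "continuous_on {0..b} f" and x: "x \<in> {0..b}"
  shows "((\<lambda>x. LINT t:{0..x}|lborel. f t) has_vector_derivative f x) (at x within {0..b})"
proof (rule has_vector_derivative_transform[OF x _ integral_has_vector_derivative[OF f x]])
  fix y assume "y \<in> {0..b}"
  then show "(LINT t:{0..y}|lborel. f t) = integral {0..y} f"
    by (intro set_borel_integral_eq_integral(2) set_integrable_subinterval[OF borel_integrable_atLeastAtMost'[OF f]]) simp
qed

lemma LINT_vector_derivative:
  fixes f :: "real \<Rightarrow> complex"
  assumes "a \<le> b" "\<And>x. a \<le> x \<Longrightarrow> x \<le> b \<Longrightarrow> (F has_vector_derivative f x) (at x within {a..b})" "continuous_on {a..b} f"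
  shows "(LINT t:{a..b}|lborel. f t) = F b - F a"
  unfolding set_lebesgue_integral_def by (rule integral_FTC_atLeastAtMost[OF assms])

text \<open>The derivative of a convolution, in integrated form because \<^term>\<open>g\<close> is merely integrable.\<close>
lemma volterra_convolution_eq:
  fixes w w' :: "real \<Rightarrow> real" and g :: "real \<Rightarrow> complex"
  assumes g: "integrable lborel g" and w: "\<And>x. (w has_real_derivative w' x) (at x)"
    and w': "continuous_on UNIV w'" and M: "\<And>x. \<bar>w' x\<bar> \<le> M" and x: "0 \<le> x"
  shows "(\<integral>t. g t * (if 0 \<le> t \<and> t \<le> x then of_real (w (x - t)) else 0) \<partial>lborel) =
    of_real (w 0) * (LINT t:{0..x}|lborel. g t) +
    (LINT s:{0..x}|lborel. (\<integral>t. g t * (if 0 \<le> t \<and> t \<le> s then of_real (w' (s - t)) else 0) \<partial>lborel))"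
proof -
  have [measurable]: "g \<in> borel_measurable borel" "w' \<in> borel_measurable borel"
    using g w' by (auto intro: borel_measurable_continuous_onI)
  let ?h = "\<lambda>t s. g t * (if 0 \<le> t \<and> t \<le> s \<and> s \<le> x then complex_of_real (w' (s - t)) else 0)"
  have inner: "(\<integral>s. (if 0 \<le> t \<and> t \<le> s \<and> s \<le> x then complex_of_real (w' (s - t)) else 0) \<partial>lborel) =
      (if 0 \<le> t \<and> t \<le> x then of_real (w (x - t)) - of_real (w 0) else 0)" for t
  proof (cases "0 \<le> t \<and> t \<le> x")
    case True
    have "(\<integral>s. (if 0 \<le> t \<and> t \<le> s \<and> s \<le> x then complex_of_real (w' (s - t)) else 0) \<partial>lborel) =
        (LINT s:{t..x}|lborel. complex_of_real (w' (s - t)))"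
      unfolding set_lebesgue_integral_def
      by (intro Bochner_Integration.integral_cong refl) (use True in \<open>auto simp: indicator_def\<close>)
    also have "\<dots> = of_real (w (x - t)) - of_real (w (t - t))"
    proof (rule LINT_vector_derivative)
      fix s
      have "((\<lambda>s. w (s - t)) has_vector_derivative w' (s - t)) (at s within {t..x})"
      proof -
        have "((\<lambda>s. s - t) has_real_derivative 1) (at s within {t..x})"
          by (auto intro!: derivative_eq_intros)
        from DERIV_chain2[OF w this] show ?thesis
          by (simp add: has_real_derivative_iff_has_vector_derivative)
      qed
      then show "((\<lambda>s. complex_of_real (w (s - t))) has_vector_derivative complex_of_real (w' (s - t))) (at s within {t..x})"
        using bounded_linear.has_vector_derivative[OF bounded_linear_of_real] by blast
    qed (use True in \<open>auto intro!: continuous_intros continuous_on_compose2[OF w']\<close>)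
    finally show ?thesis using True by simp
  next
    case False
    then have "(if 0 \<le> t \<and> t \<le> s \<and> s \<le> x then complex_of_real (w' (s - t)) else 0) = 0" for s by auto
    then show ?thesis using False by (simp only: if_False) simp
  qed
  have int: "integrable (lborel \<Otimes>\<^sub>M lborel) (\<lambda>(t, s). ?h t s)"
  proof -
    \<comment> \<open>The dummy first parameter \<open>p\<close> brings the integrand into the form
      treated by \<open>superpose_product_integrable\<close>.\<close>
    have bk: "bker (borel \<Otimes>\<^sub>M borel) (\<lambda>(p::real, t) s. if 0 \<le> t \<and> t \<le> s \<and> s \<le> x then complex_of_real (w' (s - t)) else 0) M x"
    proof (rule bkerI)
      show "(\<lambda>(p, s). (case p of (p::real, t) \<Rightarrow> \<lambda>s. if 0 \<le> t \<and> t \<le> s \<and> s \<le> x then complex_of_real (w' (s - t)) else 0) s)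
         \<in> borel_measurable ((borel \<Otimes>\<^sub>M borel) \<Otimes>\<^sub>M borel)"
        unfolding case_prod_beta' by measurable
    qed (use M order_trans[OF abs_ge_zero M] in auto)
    then show ?thesis
      using superpose_product_integrable[OF g bk, of 0] by (simp add: case_prod_beta' cong: if_cong)
  qed
  have "(LINT s:{0..x}|lborel. (\<integral>t. g t * (if 0 \<le> t \<and> t \<le> s then of_real (w' (s - t)) else 0) \<partial>lborel)) =
      (\<integral>s. (\<integral>t. ?h t s \<partial>lborel) \<partial>lborel)"
    unfolding set_lebesgue_integral_def
  proof (intro Bochner_Integration.integral_cong refl)
    fix s
    show "indicator {0..x} s *\<^sub>R (\<integral>t. g t * (if 0 \<le> t \<and> t \<le> s then of_real (w' (s - t)) else 0) \<partial>lborel) = (\<integral>t. ?h t s \<partial>lborel)"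
      unfolding integral_scaleR_right[symmetric]
      by (intro Bochner_Integration.integral_cong refl) (auto simp: indicator_def)
  qed
  also have "\<dots> = (\<integral>t. (\<integral>s. ?h t s \<partial>lborel) \<partial>lborel)"
    by (rule lborel_pair.Fubini_integral[OF int])
  also have "\<dots> = (\<integral>t. g t * (if 0 \<le> t \<and> t \<le> x then of_real (w (x - t)) - of_real (w 0) else 0) \<partial>lborel)"
    by (simp only: integral_mult_right_zero inner)
  also have "\<dots> = (\<integral>t. g t * (if 0 \<le> t \<and> t \<le> x then of_real (w (x - t)) else 0) - of_real (w 0) * (indicator {0..x} t *\<^sub>R g t) \<partial>lborel)"
    by (intro Bochner_Integration.integral_cong refl) (auto simp: indicator_def algebra_simps)
  also have "\<dots> = (\<integral>t. g t * (if 0 \<le> t \<and> t \<le> x then of_real (w (x - t)) else 0) \<partial>lborel) - of_real (w 0) * (LINT t:{0..x}|lborel. g t)"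
  proof -
    have cw: "continuous_on UNIV w" using w by (meson DERIV_isCont continuous_at_imp_continuous_on)
    then have [measurable]: "w \<in> borel_measurable borel" by (rule borel_measurable_continuous_onI)
    have "compact (w ` {0..x})"
      by (intro compact_continuous_image continuous_on_subset[OF cw]) auto
    then obtain B where B: "\<And>u. u \<in> {0..x} \<Longrightarrow> \<bar>w u\<bar> \<le> B"
      using compact_imp_bounded bounded_iff by (metis (no_types, opaque_lifting) imageI real_norm_def)
    have B0: "0 \<le> B" using B[of 0] x by simp
    have "integrable lborel (\<lambda>t. g t * (if 0 \<le> t \<and> t \<le> x then complex_of_real (w (x - t)) else 0))"
      by (rule integrable_mult_bounded[OF g, of _ B]) (use B B0 in auto)
    moreover have "integrable lborel (\<lambda>t. of_real (w 0) * (indicator {0..x} t *\<^sub>R g t))"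
      by (intro integrable_mult_right integrable_mult_indicator g) simp
    ultimately show ?thesis
      unfolding set_lebesgue_integral_def integral_mult_right_zero[symmetric]
      by (rule Bochner_Integration.integral_diff)
  qed
  finally show ?thesis by simp
qed

text \<open>Integration by parts where \<open>F\<close> is only an indefinite integral while
  \<open>v\<close> is continuously differentiable. Fubini on the triangle t <= s takes the place of
  differentiating the product.\<close>

lemma AC_product:
  fixes F f v v' :: "real \<Rightarrow> complex"
  assumes f: "set_integrable lborel {0..b} f" and b: "0 \<le> b"
    and F: "\<And>x. x \<in> {0..b} \<Longrightarrow> F x = F 0 + (LINT t:{0..x}|lborel. f t)"
    and v: "\<And>x. x \<in> {0..b} \<Longrightarrow> (v has_vector_derivative v' x) (at x within {0..b})"
    and v': "continuous_on {0..b} v'"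
  shows "(LINT t:{0..b}|lborel. f t * v t) + (LINT t:{0..b}|lborel. F t * v' t) = F b * v b - F 0 * v 0"
    and "set_integrable lborel {0..b} (\<lambda>t. f t * v t)" and "set_integrable lborel {0..b} (\<lambda>t. F t * v' t)"
proof -
  define f0 where "f0 t = indicator {0..b} t *\<^sub>R f t" for t
  define w where "w t = indicator {0..b} t *\<^sub>R v' t" for t
  have f0: "integrable lborel f0" using f by (simp add: f0_def[abs_def] set_integrable_def)
  have w: "integrable lborel w"
    using borel_integrable_atLeastAtMost'[OF v'] by (simp add: w_def[abs_def] set_integrable_def)
  have [measurable]: "f0 \<in> borel_measurable borel" "w \<in> borel_measurable borel" using f0 w by auto
  have cv: "continuous_on {0..b} v"
    by (rule continuous_on_vector_derivative[OF v])
  have bdd: "\<exists>B. \<forall>t\<in>{0..b}. norm (g t) \<le> B" if "continuous_on {0..b} g" for g :: "real \<Rightarrow> complex"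
    using compact_imp_bounded[OF compact_continuous_image[OF that compact_Icc]] unfolding bounded_iff by auto
  obtain B where B: "\<And>t. t \<in> {0..b} \<Longrightarrow> norm (v t) \<le> B" using bdd[OF cv] by blast
  obtain C where C: "\<And>t. t \<in> {0..b} \<Longrightarrow> norm (v' t) \<le> C" using bdd[OF v'] by blast
  have B0: "0 \<le> B" "0 \<le> C" using order_trans[OF norm_ge_zero B[of 0]] order_trans[OF norm_ge_zero C[of 0]] b by auto
  have mv [measurable]: "(\<lambda>t. indicator {0..b} t *\<^sub>R v t) \<in> borel_measurable borel"
    using borel_measurable_continuous_on_indicator[OF _ cv] by simp
  have fv: "integrable lborel (\<lambda>t. f0 t * (indicator {0..b} t *\<^sub>R v t))"
    by (rule integrable_mult_bounded[OF f0, of _ B]) (use B B0 mv in \<open>auto simp: indicator_def\<close>)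
  have fv_eq: "f0 t * (indicator {0..b} t *\<^sub>R v t) = indicator {0..b} t *\<^sub>R (f t * v t)" for t
    by (simp add: f0_def indicator_def)
  show sfv: "set_integrable lborel {0..b} (\<lambda>t. f t * v t)"
    using fv unfolding fv_eq set_integrable_def .
  have cF: "continuous_on {0..b} F"
    by (rule continuous_on_eq[OF continuous_on_add[OF continuous_on_const continuous_on_LINT[OF f]] F[symmetric]])
  show sFv: "set_integrable lborel {0..b} (\<lambda>t. F t * v' t)"
    by (intro borel_integrable_atLeastAtMost' continuous_intros cF v')
  have int: "integrable (lborel \<Otimes>\<^sub>M lborel) (\<lambda>(t, s). f0 t * (if t \<le> s then w s else 0))"
  proof -
    have bk: "bker (borel \<Otimes>\<^sub>M borel) (\<lambda>(p::real, t) s. if t \<le> s then w s else 0) C b"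
    proof (rule bkerI)
      show "(\<lambda>(p, s). (case p of (p::real, t) \<Rightarrow> \<lambda>s. if t \<le> s then w s else 0) s)
         \<in> borel_measurable ((borel \<Otimes>\<^sub>M borel) \<Otimes>\<^sub>M borel)"
        unfolding case_prod_beta' by measurable
    qed (use B0 C in \<open>auto simp: w_def indicator_def\<close>)
    then show ?thesis
      using superpose_product_integrable[OF f0 bk, of 0] by (simp add: case_prod_beta' cong: if_cong)
  qed
  \<comment> \<open>Integrating v' over s >= t gives v(b) - v(t): the first part will produce the
    boundary term, the second the integral of f v.\<close>
  have vint: "(\<integral>s. (if t \<le> s then w s else 0) \<partial>lborel) = v b - v t" if t: "t \<in> {0..b}" for t
  proof -
    have "(\<integral>s. (if t \<le> s then w s else 0) \<partial>lborel) = (LINT s:{t..b}|lborel. v' s)"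
      unfolding set_lebesgue_integral_def
      by (intro Bochner_Integration.integral_cong refl) (use t in \<open>auto simp: w_def indicator_def\<close>)
    also have "\<dots> = v b - v t"
      by (rule LINT_vector_derivative)
         (use t in \<open>auto intro: has_vector_derivative_within_subset[OF v] continuous_on_subset[OF v']\<close>)
    finally show ?thesis .
  qed
  have "(LINT s:{0..b}|lborel. F s * v' s) = (LINT s:{0..b}|lborel. F 0 * v' s + (LINT t:{0..s}|lborel. f t) * v' s)"
  proof (rule set_lebesgue_integral_cong)
    show "\<forall>s. s \<in> {0..b} \<longrightarrow> F s * v' s = F 0 * v' s + (LINT t:{0..s}|lborel. f t) * v' s"
      by (intro allI impI) (subst F, assumption, simp add: ring_distribs)
  qed simp
  also have "\<dots> = (LINT s:{0..b}|lborel. F 0 * v' s) + (LINT s:{0..b}|lborel. (LINT t:{0..s}|lborel. f t) * v' s)"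
    by (intro set_integral_add borel_integrable_atLeastAtMost' continuous_intros v' continuous_on_LINT[OF f])
  also have "(LINT s:{0..b}|lborel. F 0 * v' s) = F 0 * (v b - v 0)"
    using LINT_vector_derivative[OF b, of v v'] v v' by simp
  also have "(LINT s:{0..b}|lborel. (LINT t:{0..s}|lborel. f t) * v' s) = (\<integral>s. (\<integral>t. f0 t * (if t \<le> s then w s else 0) \<partial>lborel) \<partial>lborel)"
    unfolding set_lebesgue_integral_def
  proof (intro Bochner_Integration.integral_cong refl)
    fix s
    show "indicator {0..b} s *\<^sub>R ((\<integral>t. indicator {0..s} t *\<^sub>R f t \<partial>lborel) * v' s) = (\<integral>t. f0 t * (if t \<le> s then w s else 0) \<partial>lborel)"
      unfolding integral_mult_left_zero[symmetric] integral_scaleR_right[symmetric]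
      by (intro Bochner_Integration.integral_cong refl) (auto simp: indicator_def f0_def w_def)
  qed
  also have "\<dots> = (\<integral>t. (\<integral>s. f0 t * (if t \<le> s then w s else 0) \<partial>lborel) \<partial>lborel)"
    by (rule lborel_pair.Fubini_integral[OF int])
  also have "\<dots> = (\<integral>t. f0 t * v b - f0 t * (indicator {0..b} t *\<^sub>R v t) \<partial>lborel)"
  proof (intro Bochner_Integration.integral_cong refl)
    fix t
    show "(\<integral>s. f0 t * (if t \<le> s then w s else 0) \<partial>lborel) = f0 t * v b - f0 t * (indicator {0..b} t *\<^sub>R v t)"
      unfolding integral_mult_right_zero using vint[of t]
      by (cases "t \<in> {0..b}") (simp_all add: f0_def right_diff_distrib)
  qed
  also have "\<dots> = (\<integral>t. f0 t \<partial>lborel) * v b - (\<integral>t. f0 t * (indicator {0..b} t *\<^sub>R v t) \<partial>lborel)"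
    using f0 fv by simp
  also have "(\<integral>t. f0 t \<partial>lborel) = F b - F 0"
    using F[of b] b by (simp add: f0_def set_lebesgue_integral_def)
  also have "(\<integral>t. f0 t * (indicator {0..b} t *\<^sub>R v t) \<partial>lborel) = (LINT t:{0..b}|lborel. f t * v t)"
    unfolding fv_eq set_lebesgue_integral_def ..
  finally show "(LINT t:{0..b}|lborel. f t * v t) + (LINT t:{0..b}|lborel. F t * v' t) = F b * v b - F 0 * v 0"
    by (simp add: algebra_simps)
qed

section \<open>Wronskians, reflection and superposition of solutions\<close>

lemma is_solD:
  assumes "is_sol q \<rho> y dy" "x \<in> {0..pi}"
  shows "(y has_vector_derivative dy x) (at x within {0..pi})"
    and "set_integrable lborel {0..x} (\<lambda>t. (q t - \<rho>\<^sup>2) * y t)"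
    and "dy x = dy 0 + (LINT t:{0..x}|lborel. (q t - \<rho>\<^sup>2) * y t)"
  using assms unfolding is_sol_def by blast+

lemma is_sol_continuous_deriv:
  assumes "is_sol q \<rho> y dy"
  shows "continuous_on {0..pi} dy"
proof -
  have "pi \<in> {0..pi}" by simp
  note i = is_solD(2)[OF assms this]
  show ?thesis
    by (rule continuous_on_eq[OF continuous_on_add[OF continuous_on_const continuous_on_LINT[OF i]] is_solD(3)[OF assms, symmetric]])
qed

text \<open>Almost everywhere (u' v - u v')' = (q1 - q2) u v. In integrated form, u' and v' are each
  integrated by parts against the other solution; the terms with u' v' and with rho^2 cancel in the
  difference.\<close>

lemma wronskian_identity:
  assumes u: "is_sol q1 \<rho> u du" and v: "is_sol q2 \<rho> v dv"
  shows "(LINT t:{0..pi}|lborel. (q1 t - q2 t) * (u t * v t)) =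
    (du pi * v pi - u pi * dv pi) - (du 0 * v 0 - u 0 * dv 0)"
proof -
  have pi: "pi \<in> {0..pi}" by simp
  note su = is_solD(2)[OF u pi] is_solD(3)[OF u] is_solD(1)[OF u]
  note sv = is_solD(2)[OF v pi] is_solD(3)[OF v] is_solD(1)[OF v]
  note A = AC_product[OF su(1) pi_ge_zero su(2) sv(3) is_sol_continuous_deriv[OF v]]
  note B = AC_product[OF sv(1) pi_ge_zero sv(2) su(3) is_sol_continuous_deriv[OF u]]
  have "(LINT t:{0..pi}|lborel. (q1 t - q2 t) * (u t * v t)) =
     (LINT t:{0..pi}|lborel. (q1 t - \<rho>\<^sup>2) * u t * v t - (q2 t - \<rho>\<^sup>2) * v t * u t)"
    by (rule set_lebesgue_integral_cong) (auto simp: algebra_simps)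
  also have "\<dots> = (LINT t:{0..pi}|lborel. (q1 t - \<rho>\<^sup>2) * u t * v t) - (LINT t:{0..pi}|lborel. (q2 t - \<rho>\<^sup>2) * v t * u t)"
    by (rule set_integral_diff(2)[OF A(2) B(2)])
  also have "(LINT t:{0..pi}|lborel. (q1 t - \<rho>\<^sup>2) * u t * v t) = du pi * v pi - du 0 * v 0 - (LINT t:{0..pi}|lborel. du t * dv t)"
    using A(1) by (simp add: algebra_simps)
  also have "(LINT t:{0..pi}|lborel. (q2 t - \<rho>\<^sup>2) * v t * u t) = dv pi * u pi - dv 0 * u 0 - (LINT t:{0..pi}|lborel. dv t * du t)"
    using B(1) by (simp add: algebra_simps)
  finally show ?thesis by (simp add: algebra_simps)
qed

lemma LINT_reflect:
  fixes f :: "real \<Rightarrow> complex"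
  shows "(LINT t:{a..b}|lborel. f (c - t)) = (LINT t:{c - b..c - a}|lborel. f t)"
    and "set_integrable lborel {c - b..c - a} f \<Longrightarrow> set_integrable lborel {a..b} (\<lambda>t. f (c - t))"
proof -
  have eq: "indicator {c - b..c - a} (c + - 1 * t) *\<^sub>R f (c + - 1 * t) = indicator {a..b} t *\<^sub>R f (c - t)" for t
    by (auto simp: indicator_def)
  show "(LINT t:{a..b}|lborel. f (c - t)) = (LINT t:{c - b..c - a}|lborel. f t)"
    unfolding set_lebesgue_integral_def
    using lborel_integral_real_affine[of "-1" "\<lambda>t. indicator {c - b..c - a} t *\<^sub>R f t" c] unfolding eq by simp
  show "set_integrable lborel {a..b} (\<lambda>t. f (c - t))" if "set_integrable lborel {c - b..c - a} f"
    using lborel_integrable_real_affine[OF that[unfolded set_integrable_def], of "-1" c]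
    unfolding eq by (simp add: set_integrable_def)
qed

lemma is_sol_reflect:
  assumes "is_sol q \<rho> y dy"
  shows "is_sol (\<lambda>x. q (pi - x)) \<rho> (\<lambda>x. y (pi - x)) (\<lambda>x. - dy (pi - x))"
  unfolding is_sol_def
proof (intro conjI ballI)
  let ?f = "\<lambda>t. (q t - \<rho>\<^sup>2) * y t"
  have "pi \<in> {0..pi}" by simp
  note i = is_solD(2)[OF assms this] and dy = is_solD(3)[OF assms] and y = is_solD(1)[OF assms]
  fix x assume x: "x \<in> {0..pi}"
  have "((\<lambda>x. pi - x) has_real_derivative - 1) (at x within {0..pi})"
    by (auto intro!: derivative_eq_intros)
  moreover have "(y has_vector_derivative dy (pi - x)) (at (pi - x) within (\<lambda>x. pi - x) ` {0..pi})"
    by (rule has_vector_derivative_within_subset[OF y]) (use x in auto)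
  ultimately show "((\<lambda>x. y (pi - x)) has_vector_derivative - dy (pi - x)) (at x within {0..pi})"
    using vector_diff_chain_within[of "\<lambda>x. pi - x" "-1" x "{0..pi}" y "dy (pi - x)"]
    by (simp add: o_def has_real_derivative_iff_has_vector_derivative)
  show "set_integrable lborel {0..x} (\<lambda>t. (q (pi - t) - \<rho>\<^sup>2) * y (pi - t))"
    by (rule LINT_reflect(2)[of pi x 0 ?f]) (rule set_integrable_subset[OF i]; use x in auto)
  have "(LINT t:{0..pi}|lborel. ?f t) = (LINT t:{0..pi - x}|lborel. ?f t) + (LINT t:{pi - x..pi}|lborel. ?f t)"
  proof -
    have "(LINT t:{0..pi}|lborel. ?f t) = (LINT t:{0..pi - x} \<union> {pi - x<..pi}|lborel. ?f t)"
      using x by (intro arg_cong2[where f="set_lebesgue_integral lborel"]) auto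
    also have "\<dots> = (LINT t:{0..pi - x}|lborel. ?f t) + (LINT t:{pi - x<..pi}|lborel. ?f t)"
      by (rule set_integral_Un) (use x in \<open>auto intro!: set_integrable_subset[OF i]\<close>)
    also have "(LINT t:{pi - x<..pi}|lborel. ?f t) = (LINT t:{pi - x..pi}|lborel. ?f t)"
      unfolding set_lebesgue_integral_def
      by (rule integral_discrete_difference[of "{pi - x}"]) (auto simp: indicator_def)
    finally show ?thesis .
  qed
  then show "- dy (pi - x) = - dy (pi - 0) + (LINT t:{0..x}|lborel. (q (pi - t) - \<rho>\<^sup>2) * y (pi - t))"
    using LINT_reflect(1)[of 0 x ?f pi] dy[of "pi - x"] dy[of pi] x by simp
qed

lemma is_sol_cong:
  assumes "\<And>t. t \<in> {0..pi} \<Longrightarrow> q t = q' t" "is_sol q \<rho> y dy"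
  shows "is_sol q' \<rho> y dy"
proof -
  have eq: "(\<lambda>t. indicat_real {0..x} t *\<^sub>R ((q t - \<rho>\<^sup>2) * y t)) = (\<lambda>t. indicat_real {0..x} t *\<^sub>R ((q' t - \<rho>\<^sup>2) * y t))"
    if "x \<in> {0..pi}" for x
    using that assms(1) by (auto simp: indicator_def fun_eq_iff)
  show ?thesis
    unfolding is_sol_def
  proof (intro conjI ballI)
    fix x assume x: "x \<in> {0..pi}"
    show "(y has_vector_derivative dy x) (at x within {0..pi})" by (rule is_solD(1)[OF assms(2) x])
    show "set_integrable lborel {0..x} (\<lambda>t. (q' t - \<rho>\<^sup>2) * y t)"
      using is_solD(2)[OF assms(2) x] unfolding set_integrable_def eq[OF x] .
    show "dy x = dy 0 + (LINT t:{0..x}|lborel. (q' t - \<rho>\<^sup>2) * y t)"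
      using is_solD(3)[OF assms(2) x] unfolding set_lebesgue_integral_def eq[OF x] .
  qed
qed

text \<open>The kernels yield solutions with y(0) = 1 only. The solution with psi(0) = 0, psi'(0) =
  1 is obtained as a difference of two of them.\<close>

lemma is_sol_diff:
  assumes "is_sol q \<rho> y dy" "is_sol q \<rho> z dz"
  shows "is_sol q \<rho> (\<lambda>x. y x - z x) (\<lambda>x. dy x - dz x)"
  unfolding is_sol_def
proof (intro conjI ballI)
  fix x assume x: "x \<in> {0..pi}"
  show "((\<lambda>x. y x - z x) has_vector_derivative dy x - dz x) (at x within {0..pi})"
    by (intro has_vector_derivative_diff is_solD(1)[OF assms(1) x] is_solD(1)[OF assms(2) x])
  note i = is_solD(2)[OF assms(1) x] is_solD(2)[OF assms(2) x]
  show "set_integrable lborel {0..x} (\<lambda>t. (q t - \<rho>\<^sup>2) * (y t - z t))"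
    using set_integral_diff(1)[OF i] by (simp add: right_diff_distrib)
  show "dy x - dz x = dy 0 - dz 0 + (LINT t:{0..x}|lborel. (q t - \<rho>\<^sup>2) * (y t - z t))"
    using set_integral_diff(2)[OF i] is_solD(3)[OF assms(1) x] is_solD(3)[OF assms(2) x]
    by (simp add: right_diff_distrib)
qed

text \<open>The formal derivative in \<open>x\<close> of the variation of constants formula. No
  boundary term arises, since sin(r (x - t)) / r vanishes on the diagonal.\<close>

definition dcsol :: "(real \<Rightarrow> complex) \<Rightarrow> complex \<Rightarrow> (real \<Rightarrow> real \<Rightarrow> complex) \<Rightarrow> real \<Rightarrow> real \<Rightarrow> complex" where
  "dcsol q H K r x = of_real (- r * sin (r * x)) + H * of_real (cos (r * x)) +
    (\<integral>t. q t * csol K r t * (if 0 \<le> t \<and> t \<le> x then of_real (cos (r * (x - t))) else 0) \<partial>lborel)"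

lemma csol_measurable:
  assumes "bker borel K B pi"
  shows "csol K r \<in> borel_measurable borel"
proof -
  note [measurable] = bker_ft_measurable[OF assms, of r]
  show ?thesis unfolding csol_def[abs_def] by measurable
qed

lemma norm_csol_le:
  assumes "bker borel K B pi"
  shows "norm (csol K r x) \<le> 1 + 2 * pi * B"
  unfolding csol_def
  by (rule norm_triangle_mono) (use bker_norm_ft_le[OF assms, of x r] in auto)

lemma csol_integrable:
  assumes "integrable lborel q" "bker borel K B pi"
  shows "integrable lborel (\<lambda>t. q t * csol K r t)"
  by (rule integrable_mult_bounded[OF assms(1) _ norm_csol_le[OF assms(2)]])
     (use csol_measurable[OF assms(2)] in simp)

lemma LINT_cos: "0 \<le> x \<Longrightarrow> r \<noteq> 0 \<Longrightarrow> (LINT s:{0..x}|lborel. complex_of_real (cos (r * s))) = of_real (sin (r * x) / r)"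
proof -
  assume "0 \<le> x" "r \<noteq> 0"
  have "((\<lambda>s. complex_of_real (sin (r * s) / r)) has_vector_derivative complex_of_real (cos (r * s))) (at s within A)" for s A
    using \<open>r \<noteq> 0\<close>
    by (intro bounded_linear.has_vector_derivative[OF bounded_linear_of_real])
       (auto simp: has_real_derivative_iff_has_vector_derivative[symmetric] intro!: derivative_eq_intros)
  moreover have "continuous_on {0..x} (\<lambda>s. complex_of_real (cos (r * s)))" by (intro continuous_intros)
  ultimately show ?thesis
    using LINT_vector_derivative[OF \<open>0 \<le> x\<close>, of "\<lambda>s. complex_of_real (sin (r * s) / r)"] by simp
qed

lemma LINT_sin: "0 \<le> x \<Longrightarrow> r \<noteq> 0 \<Longrightarrow> (LINT s:{0..x}|lborel. complex_of_real (sin (r * s))) = of_real ((1 - cos (r * x)) / r)"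
proof -
  assume "0 \<le> x" "r \<noteq> 0"
  have "((\<lambda>s. complex_of_real (- cos (r * s) / r)) has_vector_derivative complex_of_real (sin (r * s))) (at s within A)" for s A
    using \<open>r \<noteq> 0\<close>
    by (intro bounded_linear.has_vector_derivative[OF bounded_linear_of_real])
       (auto simp: has_real_derivative_iff_has_vector_derivative[symmetric] intro!: derivative_eq_intros)
  moreover have "continuous_on {0..x} (\<lambda>s. complex_of_real (sin (r * s)))" by (intro continuous_intros)
  ultimately show ?thesis
    using LINT_vector_derivative[OF \<open>0 \<le> x\<close>, of "\<lambda>s. complex_of_real (- cos (r * s) / r)"]
    by (simp add: diff_divide_distrib)
qed

text \<open>For a merely integrable potential the convolution with the cosine need not be
  differentiable, so everything stays in integrated form. With g = q y, the convolutions
  \<open>?S\<close> and \<open>?C\<close> of g with sine and cosine satisfy S = r times the integral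
  of C, and C = integral of g minus r times the integral of S. These give y = 1 + integral of y',
  and then y' = H + integral of (q - r^2) y.\<close>

lemma is_sol_csol:
  assumes q: "integrable lborel q" and K: "bker borel K B pi"
    and eq: "\<And>x u. K x u = volterra_free q H x u + volterra q K x u" and r: "r \<noteq> 0"
  shows "is_sol q (of_real r) (csol K r) (dcsol q H K r)" "csol K r 0 = 1" "dcsol q H K r 0 = H"
proof -
  let ?y = "csol K r" and ?g = "\<lambda>t. q t * csol K r t"
  let ?C = "\<lambda>x. \<integral>t. ?g t * (if 0 \<le> t \<and> t \<le> x then of_real (cos (r * (x - t))) else 0) \<partial>lborel"
  let ?S = "\<lambda>x. \<integral>t. ?g t * (if 0 \<le> t \<and> t \<le> x then of_real (sin (r * (x - t))) else 0) \<partial>lborel"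
  have g: "integrable lborel ?g" by (rule csol_integrable[OF q K])
  have gs: "set_integrable lborel {0..x} ?g" for x
    unfolding set_integrable_def by (rule integrable_mult_indicator[OF _ g]) simp
  have y: "?y x = of_real (cos (r * x)) + H * of_real (sin (r * x) / r) + ?S x / of_real r" if "0 \<le> x" "x \<le> pi" for x
  proof -
    have "(\<integral>t. q t * (if 0 \<le> t \<and> t \<le> x then of_real (sin (r * (x - t)) / r) * csol K r t else 0) \<partial>lborel) =
      (\<integral>t. ?g t * (if 0 \<le> t \<and> t \<le> x then of_real (sin (r * (x - t))) else 0) / of_real r \<partial>lborel)"
      by (intro Bochner_Integration.integral_cong refl) auto
    then show ?thesis using csol_volterra[OF q K eq that r] by simp
  qed
  have C0: "?C x = (LINT t:{0..x}|lborel. ?g t) + (LINT s:{0..x}|lborel. - of_real r * ?S s)" if "0 \<le> x" for x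
  proof -
    have "?C x = of_real (cos (r * 0)) * (LINT t:{0..x}|lborel. ?g t) + (LINT s:{0..x}|lborel.
       (\<integral>t. ?g t * (if 0 \<le> t \<and> t \<le> s then of_real (- r * sin (r * (s - t))) else 0) \<partial>lborel))"
      by (rule volterra_convolution_eq[OF g _ _ _ that, of "\<lambda>u. cos (r * u)" _ "\<bar>r\<bar>"])
         (auto intro!: derivative_eq_intros continuous_intros simp: abs_mult mult_left_le)
    moreover have "(\<integral>t. ?g t * (if 0 \<le> t \<and> t \<le> s then of_real (- r * sin (r * (s - t))) else 0) \<partial>lborel) = - of_real r * ?S s" for s
      unfolding integral_mult_right_zero[symmetric]
      by (intro Bochner_Integration.integral_cong refl) auto
    ultimately show ?thesis by (simp only:) simp
  qed
  have S0: "?S x = (LINT s:{0..x}|lborel. of_real r * ?C s)" if "0 \<le> x" for x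
  proof -
    have "?S x = of_real (sin (r * 0)) * (LINT t:{0..x}|lborel. ?g t) + (LINT s:{0..x}|lborel.
       (\<integral>t. ?g t * (if 0 \<le> t \<and> t \<le> s then of_real (r * cos (r * (s - t))) else 0) \<partial>lborel))"
      by (rule volterra_convolution_eq[OF g _ _ _ that, of "\<lambda>u. sin (r * u)" _ "\<bar>r\<bar>"])
         (auto intro!: derivative_eq_intros continuous_intros simp: abs_mult mult_left_le)
    moreover have "(\<integral>t. ?g t * (if 0 \<le> t \<and> t \<le> s then of_real (r * cos (r * (s - t))) else 0) \<partial>lborel) = of_real r * ?C s" for s
      unfolding integral_mult_right_zero[symmetric]
      by (intro Bochner_Integration.integral_cong refl) auto
    ultimately show ?thesis by (simp only:) simp
  qed
  have Sm: "set_integrable lborel {0..x} ?S" and Cm: "set_integrable lborel {0..x} ?C" for x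
  proof -
    have m: "set_integrable lborel {0..x} (\<lambda>x. \<integral>t. ?g t * (if 0 \<le> t \<and> t \<le> x then of_real (w (x - t)) else 0) \<partial>lborel)"
      if [measurable]: "w \<in> borel_measurable borel" and w: "\<And>u. \<bar>w u\<bar> \<le> 1" for w :: "real \<Rightarrow> real"
      unfolding set_integrable_def
    proof (rule integrableI_bounded_set_indicator[where B = "\<integral>t. norm (?g t) \<partial>lborel"])
      have [measurable]: "?g \<in> borel_measurable borel" using g by auto
      show "(\<lambda>x. \<integral>t. ?g t * (if 0 \<le> t \<and> t \<le> x then complex_of_real (w (x - t)) else 0) \<partial>lborel) \<in> borel_measurable lborel"
        by measurable
      show "AE s in lborel. s \<in> {0..x} \<longrightarrow> norm (\<integral>t. ?g t * (if 0 \<le> t \<and> t \<le> s then complex_of_real (w (s - t)) else 0) \<partial>lborel) \<le> (\<integral>t. norm (?g t) \<partial>lborel)"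
        using norm_superpose_le[OF g, of "\<lambda>t. if 0 \<le> t \<and> t \<le> s then complex_of_real (w (s - t)) else 0" 1 for s] w by auto
    qed (auto simp: emeasure_lborel_Icc_eq)
    show "set_integrable lborel {0..x} ?S" using m[of "\<lambda>u. sin (r * u)"] by simp
    show "set_integrable lborel {0..x} ?C" using m[of "\<lambda>u. cos (r * u)"] by simp
  qed
  have ci: "set_integrable lborel {0..x} f" if "continuous_on UNIV f" for f :: "real \<Rightarrow> complex" and x
    by (rule borel_integrable_atLeastAtMost'[OF continuous_on_subset[OF that]]) simp
  let ?d = "dcsol q H K r"
  have dci: "set_integrable lborel {0..x} ?d" for x
    unfolding dcsol_def[abs_def] by (intro set_integral_add Cm ci continuous_intros)
  have z: "?y 0 = 1"
    using y[of 0] S0[of 0] by (simp add: LINT_singleton del: atLeastAtMost_singleton)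
  have yi: "?y x = 1 + (LINT s:{0..x}|lborel. ?d s)" if x: "0 \<le> x" "x \<le> pi" for x
  proof -
    have "(LINT s:{0..x}|lborel. ?d s) = - of_real r * (LINT s:{0..x}|lborel. of_real (sin (r * s))) + H * (LINT s:{0..x}|lborel. of_real (cos (r * s))) + (LINT s:{0..x}|lborel. ?C s)"
    proof -
      have "(LINT s:{0..x}|lborel. ?d s) = (LINT s:{0..x}|lborel. - of_real r * of_real (sin (r * s)) + H * of_real (cos (r * s))) + (LINT s:{0..x}|lborel. ?C s)"
        unfolding dcsol_def of_real_mult of_real_minus
        by (intro set_integral_add(2) ci Cm continuous_intros)
      also have "(LINT s:{0..x}|lborel. - of_real r * of_real (sin (r * s)) + H * of_real (cos (r * s))) =
          (LINT s:{0..x}|lborel. - of_real r * of_real (sin (r * s))) + (LINT s:{0..x}|lborel. H * of_real (cos (r * s)))"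
        by (intro set_integral_add(2) ci continuous_intros)
      finally show ?thesis by (simp only: LINT_cmult)
    qed
    then have d: "(LINT s:{0..x}|lborel. ?d s) = of_real (cos (r * x)) - 1 + H * of_real (sin (r * x) / r) + (LINT s:{0..x}|lborel. ?C s)"
      unfolding LINT_sin[OF x(1) r] LINT_cos[OF x(1) r] using r by (simp add: right_diff_distrib diff_divide_distrib)
    have "?S x / of_real r = (LINT s:{0..x}|lborel. ?C s)"
      unfolding S0[OF x(1)] LINT_cmult using r by simp
    then show ?thesis unfolding d y[OF x] by simp
  qed
  have yc: "set_integrable lborel {0..x} ?y" for x
    unfolding set_integrable_def
    by (rule integrableI_bounded_set_indicator[where B = "1 + 2 * pi * B"])
       (use csol_measurable[OF K] norm_csol_le[OF K] in \<open>auto simp: emeasure_lborel_Icc_eq\<close>)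
  have yr: "set_integrable lborel {0..x} (\<lambda>t. (of_real r)\<^sup>2 * ?y t)" for x
    using yc by simp
  have di: "?d x = H + (LINT t:{0..x}|lborel. (q t - (of_real r)\<^sup>2) * ?y t)" if x: "0 \<le> x" "x \<le> pi" for x
  proof -
    have "(LINT t:{0..x}|lborel. (q t - (of_real r)\<^sup>2) * ?y t) = (LINT t:{0..x}|lborel. ?g t) - (LINT t:{0..x}|lborel. (of_real r)\<^sup>2 * ?y t)"
      using set_integral_diff(2)[OF gs yr] by (simp add: left_diff_distrib)
    also have "(LINT t:{0..x}|lborel. (of_real r)\<^sup>2 * ?y t) = (LINT t:{0..x}|lborel. (of_real r)\<^sup>2 * of_real (cos (r * t)) + of_real r * H * of_real (sin (r * t)) + of_real r * ?S t)"
    proof (rule set_lebesgue_integral_cong)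
      show "\<forall>t. t \<in> {0..x} \<longrightarrow> (of_real r)\<^sup>2 * ?y t = (of_real r)\<^sup>2 * of_real (cos (r * t)) + of_real r * H * of_real (sin (r * t)) + of_real r * ?S t"
      proof (intro allI impI)
        fix t assume t: "t \<in> {0..x}"
        then have "?y t = of_real (cos (r * t)) + H * of_real (sin (r * t) / r) + ?S t / of_real r" using x by (intro y) auto
        then show "(of_real r)\<^sup>2 * ?y t = (of_real r)\<^sup>2 * of_real (cos (r * t)) + of_real r * H * of_real (sin (r * t)) + of_real r * ?S t"
          using r by (simp only:) (simp add: field_simps power2_eq_square)
      qed
    qed simp
    also have "\<dots> = (of_real r)\<^sup>2 * (LINT s:{0..x}|lborel. of_real (cos (r * s))) + of_real r * H * (LINT s:{0..x}|lborel. of_real (sin (r * s))) + (LINT s:{0..x}|lborel. of_real r * ?S s)"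
    proof -
      have "(LINT t:{0..x}|lborel. (of_real r)\<^sup>2 * of_real (cos (r * t)) + of_real r * H * of_real (sin (r * t)) + of_real r * ?S t)
        = (LINT t:{0..x}|lborel. (of_real r)\<^sup>2 * of_real (cos (r * t)) + of_real r * H * of_real (sin (r * t))) + (LINT t:{0..x}|lborel. of_real r * ?S t)"
        by (intro set_integral_add(2) ci set_integrable_mult_right Sm continuous_intros)
      also have "(LINT t:{0..x}|lborel. (of_real r)\<^sup>2 * of_real (cos (r * t)) + of_real r * H * of_real (sin (r * t)))
        = (LINT t:{0..x}|lborel. (of_real r)\<^sup>2 * of_real (cos (r * t))) + (LINT t:{0..x}|lborel. of_real r * H * of_real (sin (r * t)))"
        by (intro set_integral_add(2) ci continuous_intros)
      finally show ?thesis by (simp only: LINT_cmult)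
    qed
    finally have e: "(LINT t:{0..x}|lborel. (q t - (of_real r)\<^sup>2) * ?y t) = (LINT t:{0..x}|lborel. ?g t) -
      (of_real (r * sin (r * x)) + H * (1 - of_real (cos (r * x))) + of_real r * (LINT s:{0..x}|lborel. ?S s))"
      unfolding LINT_sin[OF x(1) r] LINT_cos[OF x(1) r] LINT_cmult using r by (simp add: power2_eq_square)
    show ?thesis
      unfolding e dcsol_def C0[OF x(1)] LINT_cmult by (simp add: ring_distribs)
  qed
  show "csol K r 0 = 1" by (rule z)
  have d0: "?d 0 = H" using di[of 0] by (simp add: LINT_singleton del: atLeastAtMost_singleton)
  then show "dcsol q H K r 0 = H" .
  have gi: "set_integrable lborel {0..x} (\<lambda>t. (q t - (of_real r)\<^sup>2) * ?y t)" for x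
    using set_integral_diff(1)[OF gs yr] by (simp add: left_diff_distrib)
  \<comment> \<open>Continuity of y' is read off from its integrated equation; it turns y = 1 +
    integral of y' into a pointwise derivative.\<close>
  have dc: "continuous_on {0..pi} ?d"
    by (rule continuous_on_eq[OF continuous_on_add[OF continuous_on_const continuous_on_LINT[OF gi]] di[symmetric]]) auto
  show "is_sol q (of_real r) ?y ?d"
    unfolding is_sol_def
  proof (intro conjI ballI gi)
    fix x assume x: "x \<in> {0..pi}"
    have "((\<lambda>x. 1 + (LINT s:{0..x}|lborel. ?d s)) has_vector_derivative 0 + ?d x) (at x within {0..pi})"
      by (intro has_vector_derivative_add has_vector_derivative_const LINT_has_vector_derivative[OF dc x])
    then have "((\<lambda>x. 1 + (LINT s:{0..x}|lborel. ?d s)) has_vector_derivative ?d x) (at x within {0..pi})"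
      by (simp only: add_0)
    then show "(?y has_vector_derivative ?d x) (at x within {0..pi})"
    proof (rule has_vector_derivative_transform[OF x, rotated])
      fix z assume "z \<in> {0..pi}"
      then show "?y z = 1 + (LINT s:{0..z}|lborel. ?d s)" by (intro yi) auto
    qed
    show "?d x = ?d 0 + (LINT t:{0..x}|lborel. (q t - (of_real r)\<^sup>2) * ?y t)"
      unfolding d0 by (rule di) (use x in auto)
  qed
qed

section \<open>Uniqueness of the Fourier transform and a Gronwall inequality\<close>

text \<open>The identities between transforms are available for nonzero \<open>r\<close> only,
  because of the quotients sin(r a) / r. Dominated convergence along r = 1 / (n + 1) recovers r = 0,
  where the uniqueness argument reads off the total mass.\<close>

lemma ft_at_zero:
  assumes f: "integrable lborel f" and z: "\<And>r. r \<noteq> 0 \<Longrightarrow> ft f r = 0"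
  shows "ft f r = 0"
proof (cases "r = 0")
  case True
  have [measurable]: "f \<in> borel_measurable borel" using f by auto
  have "(\<lambda>n. ft f (1 / real (Suc n))) \<longlonglongrightarrow> ft f 0"
    unfolding ft_def
  proof (rule integral_dominated_convergence)
    show "integrable lborel (\<lambda>u. norm (f u))" using f by simp
    show "AE u in lborel. (\<lambda>n. f u * cis (1 / real (Suc n) * u)) \<longlonglongrightarrow> f u * cis (0 * u)"
    proof (rule AE_I2)
      fix u
      have "(\<lambda>n. 1 / real (Suc n) * u) \<longlonglongrightarrow> 0 * u"
        by (intro tendsto_intros lim_1_over_n[THEN LIMSEQ_Suc])
      then have "(\<lambda>n. cis (1 / real (Suc n) * u)) \<longlonglongrightarrow> cis (0 * u)"
      proof (rule isCont_tendsto_compose[rotated])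
        have "continuous_on UNIV cis" by (intro continuous_intros)
        then show "isCont cis (0 * u)" by (simp add: continuous_on_eq_continuous_at)
      qed
      then show "(\<lambda>n. f u * cis (1 / real (Suc n) * u)) \<longlonglongrightarrow> f u * cis (0 * u)"
        by (rule tendsto_mult[OF tendsto_const])
    qed
  qed (auto simp: norm_mult)
  moreover have "ft f (1 / real (Suc n)) = 0" for n by (rule z) simp
  ultimately show ?thesis using True by (simp add: LIMSEQ_const_iff)
qed (rule z)

text \<open>Positive and negative part have equal transforms, in particular equal mass at r = 0. If
  the mass is zero both vanish; otherwise, divided by it, they are probability densities with the
  same characteristic function, and Levy's theorem applies.\<close>

lemma ft_unique_real:
  fixes g :: "real \<Rightarrow> real"
  assumes g: "integrable lborel g" and z: "\<And>r. ft (\<lambda>u. of_real (g u)) r = 0"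
  shows "AE u in lborel. g u = 0"
proof -
  have [measurable]: "g \<in> borel_measurable borel" using g by auto
  define gp where "gp u = max 0 (g u)" for u
  define gn where "gn u = max 0 (- g u)" for u
  have gd: "g u = gp u - gn u" for u by (simp add: gp_def gn_def max_def)
  have ip: "integrable lborel gp" and inn: "integrable lborel gn"
    using g by (auto simp: gp_def[abs_def] gn_def[abs_def])
  have [measurable]: "gp \<in> borel_measurable borel" "gn \<in> borel_measurable borel"
    using ip inn by auto
  have pos: "0 \<le> gp u" "0 \<le> gn u" for u by (simp_all add: gp_def gn_def)
  have eq: "ft (\<lambda>u. of_real (gp u)) r = ft (\<lambda>u. of_real (gn u)) r" for r
    using z[of r] ft_diff[of "\<lambda>u. of_real (gp u)" "\<lambda>u. of_real (gn u)" r] ip inn by (simp add: gd)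
  define c where "c = (\<integral>u. gp u \<partial>lborel)"
  have cn: "c = (\<integral>u. gn u \<partial>lborel)"
    using eq[of 0] unfolding ft_def c_def by simp
  show ?thesis
  proof (cases "c = 0")
    case True
    have "AE u in lborel. gp u = 0" "AE u in lborel. gn u = 0"
      using True integral_nonneg_eq_0_iff_AE[OF ip] integral_nonneg_eq_0_iff_AE[OF inn] pos
      by (auto simp: c_def[symmetric] cn[symmetric])
    then show ?thesis by eventually_elim (simp add: gd)
  next
    case False
    have c: "0 < c" using False Bochner_Integration.integral_nonneg[of lborel gp] pos by (auto simp: c_def less_le)
    have rd: "real_distribution (density lborel (\<lambda>u. ennreal (k u / c)))"
      if k: "integrable lborel k" "\<And>u. 0 \<le> k u" "(\<integral>u. k u \<partial>lborel) = c" for k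
    proof -
      have [measurable]: "k \<in> borel_measurable borel" using k(1) by auto
      have "(\<integral>\<^sup>+u. ennreal (k u / c) \<partial>lborel) = ennreal (\<integral>u. k u / c \<partial>lborel)"
        using k c by (intro nn_integral_eq_integral) auto
      also have "\<dots> = 1" using k c by simp
      finally have "emeasure (density lborel (\<lambda>u. ennreal (k u / c))) UNIV = 1"
        by (simp add: emeasure_density)
      then interpret prob_space "density lborel (\<lambda>u. ennreal (k u / c))"
        by (intro prob_spaceI) simp
      show ?thesis by unfold_locales simp
    qed
    have ch: "char (density lborel (\<lambda>u. ennreal (k u / c))) r = ft (\<lambda>u. of_real (k u)) r / c"
      if k: "integrable lborel k" "\<And>u. 0 \<le> k u" for k r
    proof -
      have [measurable]: "k \<in> borel_measurable borel" using k(1) by auto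
      have "char (density lborel (\<lambda>u. ennreal (k u / c))) r = (\<integral>u. (k u / c) *\<^sub>R iexp (r * u) \<partial>lborel)"
        unfolding char_def using k c by (subst integral_density) auto
      also have "\<dots> = (\<integral>u. of_real (k u) * cis (r * u) / of_real c \<partial>lborel)"
        by (intro Bochner_Integration.integral_cong refl) (simp add: cis_conv_exp scaleR_conv_of_real)
      finally show ?thesis by (simp add: ft_def)
    qed
    have "density lborel (\<lambda>u. ennreal (gp u / c)) = density lborel (\<lambda>u. ennreal (gn u / c))"
      by (rule Levy_uniqueness)
         (use rd[OF ip] rd[OF inn] ch[OF ip] ch[OF inn] pos eq cn in \<open>auto simp: c_def fun_eq_iff\<close>)
    then have "AE u in lborel. ennreal (gp u / c) = ennreal (gn u / c)"
      by (intro sigma_finite_measure.density_unique[OF sigma_finite_lborel]) auto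
    then show ?thesis
    proof eventually_elim
      case (elim u)
      then have "gp u / c = gn u / c" using pos c by (simp add: ennreal_inj)
      then show "g u = 0" using c by (simp add: gd)
    qed
  qed
qed

lemma ft_reflect: "ft (\<lambda>u. f (- u)) r = ft f (- r)"
  unfolding ft_def using lborel_integral_real_affine[of "-1" "\<lambda>u. f u * cis (- r * u)" 0] by simp

text \<open>The transform of the complex conjugate of \<open>f\<close> at \<open>r\<close> is the
  conjugate of ft f (- r). Hence the transforms of real and imaginary part vanish as well, and the
  real case applies to both.\<close>

lemma ft_unique:
  assumes f: "integrable lborel f" and z: "\<And>r. r \<noteq> 0 \<Longrightarrow> ft f r = 0"
  shows "AE u in lborel. f u = 0"
proof -
  note z0 = ft_at_zero[OF f z]
  have icnj: "integrable lborel (\<lambda>u. cnj (f u))" using f by simp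
  have cnj0: "ft (\<lambda>u. cnj (f u)) r = 0" for r
  proof -
    have "cnj (ft f (- r)) = (\<integral>u. cnj (f u * cis (- r * u)) \<partial>lborel)"
      unfolding ft_def by (simp only: Bochner_Integration.integral_cnj)
    also have "\<dots> = ft (\<lambda>u. cnj (f u)) r"
      unfolding ft_def by (intro Bochner_Integration.integral_cong refl) (simp add: cis_cnj)
    finally have "ft (\<lambda>u. cnj (f u)) r = cnj (ft f (- r))" ..
    then show ?thesis using z0 by simp
  qed
  have "of_real (Re (f u)) = (1 / 2) * (f u + cnj (f u))" "of_real (Im (f u)) = (1 / (2 * \<i>)) * (f u - cnj (f u))" for u
    by (simp_all add: complex_eq_iff)
  then have "ft (\<lambda>u. of_real (Re (f u))) r = 0" "ft (\<lambda>u. of_real (Im (f u))) r = 0" for r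
    using z0 cnj0 by (simp_all only: ft_cmult ft_add[OF f icnj] ft_diff[OF f icnj]) simp_all
  then have "AE u in lborel. Re (f u) = 0" "AE u in lborel. Im (f u) = 0"
    using f by (auto intro!: ft_unique_real)
  then show ?thesis by eventually_elim (simp add: complex_eq_iff)
qed

lemma integrable_reflect:
  fixes f :: "real \<Rightarrow> 'a::{banach, second_countable_topology}"
  assumes "integrable lborel f" shows "integrable lborel (\<lambda>u. f (- u))"
  using lborel_integrable_real_affine[OF assms, of "-1" 0] by simp

lemma ft_even:
  assumes f: "integrable lborel f"
  shows "ft (\<lambda>u. f u + f (- u)) r = 2 * (\<integral>u. f u * of_real (cos (r * u)) \<partial>lborel)"
proof -
  have "ft (\<lambda>u. f u + f (- u)) r = ft f r + ft f (- r)"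
    using ft_add[OF f integrable_reflect[OF f]] by (simp add: ft_reflect)
  also have "\<dots> = (\<integral>u. f u * cis (r * u) + f u * cis (- r * u) \<partial>lborel)"
    unfolding ft_def using integrable_mult_cis[OF f, of r] integrable_mult_cis[OF f, of "- r"] by simp
  also have "\<dots> = (\<integral>u. 2 * (f u * of_real (cos (r * u))) \<partial>lborel)"
    by (intro Bochner_Integration.integral_cong refl) (simp add: complex_eq_iff)
  finally show ?thesis by simp
qed

lemma ft_odd:
  assumes f: "integrable lborel f"
  shows "ft (\<lambda>u. f u - f (- u)) r = 2 * \<i> * (\<integral>u. f u * of_real (sin (r * u)) \<partial>lborel)"
proof -
  have "ft (\<lambda>u. f u - f (- u)) r = ft f r - ft f (- r)"
    using ft_diff[OF f integrable_reflect[OF f]] by (simp add: ft_reflect)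
  also have "\<dots> = (\<integral>u. f u * cis (r * u) - f u * cis (- r * u) \<partial>lborel)"
    unfolding ft_def using integrable_mult_cis[OF f, of r] integrable_mult_cis[OF f, of "- r"] by simp
  also have "\<dots> = (\<integral>u. 2 * \<i> * (f u * of_real (sin (r * u))) \<partial>lborel)"
    by (intro Bochner_Integration.integral_cong refl) (simp add: complex_eq_iff)
  finally show ?thesis by simp
qed

text \<open>How multiplication by cos(r a) + ft L r acts on a kernel \<open>g\<close>. With
  \<open>a = x\<close> and \<open>L = K x\<close> this factor is \<open>csol K r x\<close>.\<close>

definition mulk :: "real \<Rightarrow> (real \<Rightarrow> complex) \<Rightarrow> (real \<Rightarrow> complex) \<Rightarrow> real \<Rightarrow> complex" where
  "mulk a L g u = sym_shift a g u + conv L g u"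

lemma integrable_mulk: "integrable lborel L \<Longrightarrow> integrable lborel g \<Longrightarrow> integrable lborel (mulk a L g)"
  unfolding mulk_def[abs_def] by (intro Bochner_Integration.integrable_add integrable_sym_shift integrable_conv)

lemma ft_mulk:
  assumes "integrable lborel L" "integrable lborel g"
  shows "ft (mulk a L g) r = (of_real (cos (r * a)) + ft L r) * ft g r"
  unfolding mulk_def[abs_def] ft_add[OF integrable_sym_shift[OF assms(2)] integrable_conv[OF assms]]
  by (simp add: ft_sym_shift[OF assms(2)] ft_conv[OF assms] ring_distribs)

lemma bker_mulk:
  assumes L: "bker N L B pi" and g: "bker N g C b" and a: "a \<in> borel_measurable N" "\<And>p. \<bar>a p\<bar> \<le> pi"
    and sp: "\<And>p. p \<in> space N"
  shows "bker N (\<lambda>p. mulk (a p) (L p) (g p)) ((1 + 2 * pi * B) * C) (b + pi)"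
proof -
  have i: "(\<integral>s. norm (L p s) \<partial>lborel) \<le> 2 * pi * B" for p
    by (rule integral_norm_bounded_support[OF bker_section_measurable[OF L sp] bker_bound[OF L] bker_supp[OF L]]) simp_all
  have "bker N (\<lambda>p u. sym_shift (a p) (g p) u + conv (L p) (g p) u) (C + 2 * pi * B * C) (b + pi)"
    using bker_add[OF bker_shift[OF g a] bker_mono[OF bker_conv[OF L g pi_ge_zero i sp] order.refl]] by (simp add: add.commute)
  then show ?thesis by (simp add: mulk_def[abs_def] ring_distribs)
qed

text \<open>The inequality holds only almost everywhere and \<open>p\<close> is only integrable, so
  it is multiplied by the weight exp(2 M t) and integrated rather than iterated. After Fubini the
  weight integrated over t <= s is at most exp(2 M s) / (2 M); the double integral is thus at most
  half of the left-hand side and is absorbed there, whence the factor 2.\<close>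

lemma gronwall_backward:
  fixes p b :: "real \<Rightarrow> real"
  assumes p: "integrable lborel p" "\<And>t. 0 \<le> p t" "\<And>t. t \<notin> {0..pi} \<Longrightarrow> p t = 0"
    and b: "integrable lborel b" "\<And>t. 0 \<le> b t" and M: "0 < M"
    and le: "AE t in lborel. t \<in> {0..pi} \<longrightarrow> p t \<le> b t + M * (\<integral>s. p s * (if t \<le> s then 1 else 0) \<partial>lborel)"
  shows "(\<integral>t. p t \<partial>lborel) \<le> 2 * exp (2 * M * pi) * (\<integral>t. b t \<partial>lborel)"
proof -
  have [measurable]: "p \<in> borel_measurable borel" "b \<in> borel_measurable borel" using p b by auto
  define w where "w t = indicator {0..pi} t * exp (2 * M * t)" for t :: real
  have w_le: "w t \<le> exp (2 * M * pi)" and w0: "0 \<le> w t" for t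
    using M by (auto simp: w_def indicator_def)
  have [measurable]: "w \<in> borel_measurable borel" unfolding w_def[abs_def] by measurable
  have ib: "integrable lborel (\<lambda>t. f t * w t)" if "integrable lborel f" for f :: "real \<Rightarrow> real"
  proof (rule Bochner_Integration.integrable_bound)
    show "integrable lborel (\<lambda>t. f t * exp (2 * M * pi))" using that by simp
    show "AE t in lborel. norm (f t * w t) \<le> norm (f t * exp (2 * M * pi))"
      using w_le w0 by (intro AE_I2) (simp add: abs_mult mult_left_mono)
    have [measurable]: "f \<in> borel_measurable borel" using that by auto
    show "(\<lambda>t. f t * w t) \<in> borel_measurable lborel" by measurable
  qed
  have wi: "integrable lborel w"
    by (rule integrable_bounded_support[of w "exp (2 * M * pi)" pi]) (use w_le w0 in \<open>auto simp: w_def indicator_def\<close>)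
  have int: "integrable (lborel \<Otimes>\<^sub>M lborel) (\<lambda>(s, t). w t * (p s * (if t \<le> s then 1 else 0)))"
  proof (rule Bochner_Integration.integrable_bound)
    show "integrable (lborel \<Otimes>\<^sub>M lborel) (\<lambda>(s, t). w t * p s)"
    proof (rule lborel_pair.Fubini_integrable)
      show "integrable lborel (\<lambda>s. \<integral>t. norm (case (s, t) of (s, t) \<Rightarrow> w t * p s) \<partial>lborel)"
        using p(1) by (simp add: abs_mult)
      show "AE s in lborel. integrable lborel (\<lambda>t. case (s, t) of (s, t) \<Rightarrow> w t * p s)"
        using wi by simp
    qed measurable
    show "(\<lambda>(s, t). w t * (p s * (if t \<le> s then 1 else 0))) \<in> borel_measurable (lborel \<Otimes>\<^sub>M lborel)"
      by measurable
  qed auto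
  have inner: "(\<integral>t. w t * (p s * (if t \<le> s then 1 else 0)) \<partial>lborel) \<le> p s * w s / (2 * M)" for s
  proof (cases "s \<in> {0..pi}")
    case True
    have F: "((\<lambda>t. exp (2 * M * t) / (2 * M)) has_real_derivative exp (2 * M * t)) (at t)" for t
      using M by (auto intro!: derivative_eq_intros)
    have "(\<integral>t. exp (2 * M * t) * indicator {0..s} t \<partial>lborel) = exp (2 * M * s) / (2 * M) - exp (2 * M * 0) / (2 * M)"
      by (rule integral_FTC_Icc_real[OF _ F]) (use True in \<open>auto intro!: continuous_intros\<close>)
    also have "\<dots> \<le> w s / (2 * M)" using M True by (simp add: w_def)
    finally have le: "(\<integral>t. exp (2 * M * t) * indicator {0..s} t \<partial>lborel) \<le> w s / (2 * M)" .
    have "w t * (p s * (if t \<le> s then 1 else 0)) = p s * (exp (2 * M * t) * indicator {0..s} t)" for t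
      using True by (auto simp: w_def indicator_def)
    then have "(\<integral>t. w t * (p s * (if t \<le> s then 1 else 0)) \<partial>lborel) = p s * (\<integral>t. exp (2 * M * t) * indicator {0..s} t \<partial>lborel)"
      by (simp only: integral_mult_right_zero)
    also have "\<dots> \<le> p s * (w s / (2 * M))" by (rule mult_left_mono[OF le p(2)])
    finally show ?thesis by simp
  next
    case False
    then show ?thesis using p(3)[of s] by simp
  qed
  have "(\<integral>t. p t * w t \<partial>lborel) \<le> (\<integral>t. b t * w t + M * (\<integral>s. w t * (p s * (if t \<le> s then 1 else 0)) \<partial>lborel) \<partial>lborel)"
  proof (rule integral_mono_AE)
    show "integrable lborel (\<lambda>t. b t * w t + M * (\<integral>s. w t * (p s * (if t \<le> s then 1 else 0)) \<partial>lborel))"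
      by (intro Bochner_Integration.integrable_add ib b(1) integrable_mult_right lborel_pair.integrable_snd[OF int])
    show "AE t in lborel. p t * w t \<le> b t * w t + M * (\<integral>s. w t * (p s * (if t \<le> s then 1 else 0)) \<partial>lborel)"
      using le
    proof eventually_elim
      case (elim t)
      show ?case
      proof (cases "t \<in> {0..pi}")
        case True
        then have "p t * w t \<le> (b t + M * (\<integral>s. p s * (if t \<le> s then 1 else 0) \<partial>lborel)) * w t"
          using elim w0 by (intro mult_right_mono) auto
        then show ?thesis unfolding integral_mult_right_zero by (simp add: algebra_simps)
      qed (simp add: w_def)
    qed
  qed (rule ib[OF p(1)])
  also have "\<dots> = (\<integral>t. b t * w t \<partial>lborel) + M * (\<integral>t. (\<integral>s. w t * (p s * (if t \<le> s then 1 else 0)) \<partial>lborel) \<partial>lborel)"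
    by (rule trans[OF Bochner_Integration.integral_add[OF ib[OF b(1)] integrable_mult_right[OF lborel_pair.integrable_snd[OF int]]]
          arg_cong2[where f=plus, OF refl integral_mult_right_zero]])
  also have "(\<integral>t. (\<integral>s. w t * (p s * (if t \<le> s then 1 else 0)) \<partial>lborel) \<partial>lborel) = (\<integral>s. (\<integral>t. w t * (p s * (if t \<le> s then 1 else 0)) \<partial>lborel) \<partial>lborel)"
    by (rule lborel_pair.Fubini_integral[OF int])
  also have "\<dots> \<le> (\<integral>s. p s * w s / (2 * M) \<partial>lborel)"
    using lborel_pair.integrable_fst[OF int] ib[OF p(1)] inner by (intro integral_mono) auto
  finally have "(\<integral>t. p t * w t \<partial>lborel) \<le> 2 * (\<integral>t. b t * w t \<partial>lborel)"
    using M by simp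
  also have "(\<integral>t. b t * w t \<partial>lborel) \<le> (\<integral>t. b t * exp (2 * M * pi) \<partial>lborel)"
    using ib[OF b(1)] b w_le by (intro integral_mono mult_left_mono) auto
  finally have "(\<integral>t. p t * w t \<partial>lborel) \<le> 2 * exp (2 * M * pi) * (\<integral>t. b t \<partial>lborel)" by (simp add: mult_ac)
  moreover have "(\<integral>t. p t \<partial>lborel) \<le> (\<integral>t. p t * w t \<partial>lborel)"
  proof (rule integral_mono[OF p(1) ib[OF p(1)]])
    fix t
    show "p t \<le> p t * w t"
      using p(2)[of t] p(3)[of t] M mult_left_mono[of 1 "exp (2 * M * t)" "p t"]
      by (cases "t \<in> {0..pi}") (auto simp: w_def)
  qed
  ultimately show ?thesis by linarith
qed

section \<open>Cauchy data and the reflected problem\<close>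

definition zero_ext :: "(real \<Rightarrow> complex) \<Rightarrow> real \<Rightarrow> complex" where
  "zero_ext f t = indicator {0..pi} t *\<^sub>R f t"

lemma LINT_zero_ext_mult: "(LINT t:{0..pi}|lborel. f t * g t) = (\<integral>t. zero_ext f t * g t \<partial>lborel)"
  by (simp add: set_lebesgue_integral_def zero_ext_def)

lemma L2_norm_0pi_power2: "(L2_norm_0pi f)\<^sup>2 = (\<integral>t. (norm (zero_ext f t))\<^sup>2 \<partial>lborel)"
  and L2_norm_0pi_nonneg: "0 \<le> L2_norm_0pi f"
proof -
  have eq: "(norm (zero_ext f t))\<^sup>2 = indicator {0..pi} t *\<^sub>R (norm (f t))\<^sup>2" for t
    by (simp add: zero_ext_def indicator_def)
  have "0 \<le> (\<integral>t. (norm (zero_ext f t))\<^sup>2 \<partial>lborel)" by (rule Bochner_Integration.integral_nonneg) simp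
  then show "(L2_norm_0pi f)\<^sup>2 = (\<integral>t. (norm (zero_ext f t))\<^sup>2 \<partial>lborel)" "0 \<le> L2_norm_0pi f"
    unfolding eq by (simp_all add: L2_norm_0pi_def set_lebesgue_integral_def)
qed

lemma L2_ball_zero_ext:
  assumes "L2_0pi f" "L2_norm_0pi f \<le> Q"
  shows "L2_ball Q (zero_ext f)"
proof -
  have eq: "(norm (zero_ext f t))\<^sup>2 = indicator {0..pi} t *\<^sub>R (norm (f t))\<^sup>2" for t
    by (simp add: zero_ext_def indicator_def)
  have "(L2_norm_0pi f)\<^sup>2 \<le> Q\<^sup>2" using assms(2) L2_norm_0pi_nonneg[of f] by (simp add: power_mono)
  then show ?thesis
    using assms(1) unfolding L2_ball_def L2_norm_0pi_power2 unfolding eq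
    by (auto simp: L2_0pi_def set_borel_measurable_def set_integrable_def zero_ext_def[abs_def])
qed

lemma L2_ball_mono: "L2_ball Q f \<Longrightarrow> 0 \<le> Q \<Longrightarrow> Q \<le> Q' \<Longrightarrow> L2_ball Q' f"
  unfolding L2_ball_def using power_mono[of Q Q' 2] by (auto intro: order_trans)

lemma L2_ball_reflect:
  assumes "L2_ball Q f"
  shows "L2_ball Q (\<lambda>x. f (pi - x))"
proof -
  have [measurable]: "f \<in> borel_measurable borel" using assms by (simp add: L2_ball_def)
  have i: "integrable lborel (\<lambda>t. (norm (f t))\<^sup>2)" using assms by (simp add: L2_ball_def)
  show ?thesis
    using assms lborel_integrable_real_affine[OF i, of "-1" pi] lborel_integral_real_affine[of "-1" "\<lambda>t. (norm (f t))\<^sup>2" pi]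
    by (auto simp: L2_ball_def)
qed

lemma L2_0pi_diff:
  assumes "L2_0pi f" "L2_0pi g"
  shows "L2_0pi (\<lambda>x. f x - g x)"
proof -
  have f: "L2_ball (L2_norm_0pi f) (zero_ext f)" and g: "L2_ball (L2_norm_0pi g) (zero_ext g)"
    using assms by (simp_all add: L2_ball_zero_ext)
  have [measurable]: "zero_ext f \<in> borel_measurable borel" "zero_ext g \<in> borel_measurable borel"
    using f g by (simp_all add: L2_ball_def)
  have d: "indicator {0..pi} t *\<^sub>R (f t - g t) = zero_ext f t - zero_ext g t" for t
    by (simp add: zero_ext_def scaleR_diff_right)
  have n: "indicator {0..pi} t *\<^sub>R (norm (f t - g t))\<^sup>2 = (norm (zero_ext f t - zero_ext g t))\<^sup>2" for t
    unfolding d[symmetric] by (simp add: indicator_def)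
  have "integrable lborel (\<lambda>t. (norm (zero_ext f t - zero_ext g t))\<^sup>2)"
  proof (rule Bochner_Integration.integrable_bound)
    show "integrable lborel (\<lambda>t. 2 * (norm (zero_ext f t))\<^sup>2 + 2 * (norm (zero_ext g t))\<^sup>2)"
      using f g by (simp add: L2_ball_def)
    have "(norm (a - b))\<^sup>2 \<le> 2 * (norm a)\<^sup>2 + 2 * (norm b)\<^sup>2" for a b :: complex
    proof -
      have "(norm (a - b))\<^sup>2 \<le> (norm a + norm b)\<^sup>2" by (intro power_mono norm_triangle_ineq4) simp
      also have "\<dots> \<le> 2 * (norm a)\<^sup>2 + 2 * (norm b)\<^sup>2"
        using sum_squares_bound[of "norm a" "norm b"] by (simp add: power2_sum)
      finally show ?thesis .
    qed
    then show "AE t in lborel. norm ((norm (zero_ext f t - zero_ext g t))\<^sup>2) \<le> norm (2 * (norm (zero_ext f t))\<^sup>2 + 2 * (norm (zero_ext g t))\<^sup>2)"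
      by simp
  qed measurable
  then show ?thesis
    unfolding L2_0pi_def set_borel_measurable_def set_integrable_def d n by simp
qed

text \<open>On the original interval y(pi - x) has value 1 and slope - H at pi. Its Wronskian with
  phi or psi therefore equals Delta or Delta0 at pi, while at 0 it is determined by the initial
  values of phi or psi.\<close>

lemma cauchy_data_csol:
  assumes PQ: "P_Q Q q h H" and cd: "cauchy_data q h H N N0 \<omega> \<omega>0" and r: "r \<noteq> 0"
    and K: "bker borel K B pi"
    and eq: "\<And>x u. K x u = volterra_free (\<lambda>x. zero_ext q (pi - x)) H x u + volterra (\<lambda>x. zero_ext q (pi - x)) K x u"
  shows "csol K r pi = of_real (cos (r * pi)) + \<omega>0 * of_real (sin (r * pi) / r) +
      (\<integral>t. zero_ext N0 t * of_real (sin (r * t)) \<partial>lborel) / of_real r"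
    and "h * csol K r pi + dcsol (\<lambda>x. zero_ext q (pi - x)) H K r pi =
      of_real (- r * sin (r * pi)) + \<omega> * of_real (cos (r * pi)) + (\<integral>t. zero_ext N t * of_real (cos (r * t)) \<partial>lborel)"
proof -
  let ?\<rho> = "complex_of_real r" and ?rq = "\<lambda>x. zero_ext q (pi - x)"
  have Lq: "L2_0pi q" "L2_norm_0pi q \<le> Q" "norm h \<le> Q"
    using PQ norm_ge_zero[of h] norm_ge_zero[of H] L2_norm_0pi_nonneg[of q] unfolding P_Q_def by linarith+
  have Q: "0 \<le> Q" using Lq(3) norm_ge_zero order_trans by blast
  \<comment> \<open>The radius is Q + 1 because \<open>ex\<close> is applied to the slope h + 1 as
    well as to h.\<close>
  have ball: "L2_ball (Q + 1) (zero_ext q)"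
    using Q by (intro L2_ball_mono[OF L2_ball_zero_ext[OF Lq(1,2)]]) auto
  have qi: "integrable lborel (zero_ext q)" by (rule L2_ball_integrable(1)[OF ball]) (use Q in simp)
  have rqi: "integrable lborel ?rq" by (rule L2_ball_integrable(1)[OF L2_ball_reflect[OF ball]]) (use Q in simp)
  note y = is_sol_csol[OF rqi K eq r]
  have chi: "is_sol q ?\<rho> (\<lambda>x. csol K r (pi - x)) (\<lambda>x. - dcsol ?rq H K r (pi - x))"
    by (rule is_sol_cong[OF _ is_sol_reflect[OF y(1)]]) (simp add: zero_ext_def)
  \<comment> \<open>\<open>cauchy_data\<close> is a statement about every solution with given
    initial values, so such solutions must be produced. The kernels of the unreflected potential
    provide them for each slope of modulus at most Q + 1.\<close>
  have ex: "\<exists>u du. is_sol q ?\<rho> u du \<and> u 0 = 1 \<and> du 0 = a" if a: "norm a \<le> Q + 1" for a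
  proof -
    obtain L where L: "bker borel L (tm_bound (Q + 1)) pi" "\<And>x u. \<bar>u\<bar> > x \<Longrightarrow> L x u = 0"
      "\<And>x u. L x u = volterra_free (zero_ext q) a x u + volterra (zero_ext q) L x u"
      using transmutation_kernel[OF ball _ a] Q by auto
    have "is_sol q ?\<rho> (csol L r) (dcsol (zero_ext q) a L r)"
      by (rule is_sol_cong[OF _ is_sol_csol(1)[OF qi L(1,3) r]]) (simp add: zero_ext_def)
    then show ?thesis using is_sol_csol(2,3)[OF qi L(1,3) r] by blast
  qed
  obtain u du where u: "is_sol q ?\<rho> u du" "u 0 = 1" "du 0 = h"
    using ex[of h] Lq(3) by auto
  obtain v dv where v: "is_sol q ?\<rho> v dv" "v 0 = 1" "dv 0 = h + 1"
    using ex[of "h + 1"] Lq(3) norm_triangle_ineq[of h 1] by auto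
  note w = is_sol_diff[OF v(1) u(1)]
  \<comment> \<open>Both solutions belong to the same potential: the integral in
    \<open>wronskian_identity\<close> is zero, and the Wronskians at 0 and at pi agree.\<close>
  have z: "(LINT t:{0..pi}|lborel. (q t - q t) * g t) = (0 :: complex)" for g
    by (simp add: set_lebesgue_integral_def)
  have c1: "du pi + H * u pi = h * csol K r pi + dcsol ?rq H K r pi"
    using wronskian_identity[OF u(1) chi] y(2,3) u(2,3) unfolding z by (simp add: algebra_simps)
  have c2: "(dv pi - du pi) + H * (v pi - u pi) = csol K r pi"
    using wronskian_identity[OF w chi] y(2,3) u(2,3) v(2,3) unfolding z by (simp add: algebra_simps)
  have cds: "cos (?\<rho> * of_real t) = of_real (cos (r * t))" "sin (?\<rho> * of_real t) = of_real (sin (r * t))" for t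
    by (simp_all flip: cos_of_real sin_of_real)
  have "du pi + H * u pi = - ?\<rho> * sin (?\<rho> * of_real pi) + \<omega> * cos (?\<rho> * of_real pi)
          + (LINT t:{0..pi}|lborel. N t * cos (?\<rho> * of_real t))"
    using cd u unfolding cauchy_data_def by blast
  then show "h * csol K r pi + dcsol ?rq H K r pi =
      of_real (- r * sin (r * pi)) + \<omega> * of_real (cos (r * pi)) + (\<integral>t. zero_ext N t * of_real (cos (r * t)) \<partial>lborel)"
    unfolding c1 cds LINT_zero_ext_mult by simp
  have "?\<rho> \<noteq> 0" using r by simp
  moreover have "v 0 - u 0 = 0" "dv 0 - du 0 = 1" using u v by simp_all
  ultimately have "(dv pi - du pi) + H * (v pi - u pi) = cos (?\<rho> * of_real pi) + \<omega>0 * sin (?\<rho> * of_real pi) / ?\<rho>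
          + (LINT t:{0..pi}|lborel. N0 t * sin (?\<rho> * of_real t)) / ?\<rho>"
    using cd w unfolding cauchy_data_def by blast
  then show "csol K r pi = of_real (cos (r * pi)) + \<omega>0 * of_real (sin (r * pi) / r) +
      (\<integral>t. zero_ext N0 t * of_real (sin (r * t)) \<partial>lborel) / of_real r"
    unfolding c2 cds LINT_zero_ext_mult by simp
qed

section \<open>Kernels in the Wronskian identity\<close>

text \<open>The calculus of \<open>bker\<close> asks for shifts that are bounded at every real
  parameter. Clamping achieves this and is the identity on [0, pi], where the potentials
  live.\<close>

definition clamp_pi :: "real \<Rightarrow> real" where
  "clamp_pi x = max 0 (min x pi)"

lemma clamp_pi_measurable [measurable]: "clamp_pi \<in> borel_measurable borel"
  unfolding clamp_pi_def[abs_def] by measurable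

lemma clamp_pi_bounds: "0 \<le> clamp_pi x" "clamp_pi x \<le> pi" "\<bar>clamp_pi x\<bar> \<le> pi" "\<bar>pi - clamp_pi x\<bar> \<le> pi"
  by (auto simp: clamp_pi_def)

lemma clamp_pi_id: "x \<in> {0..pi} \<Longrightarrow> clamp_pi x = x"
  by (auto simp: clamp_pi_def)

text \<open>The kernel of (cos + ft K) (cos + ft L) - cos^2. The squared cosine belongs to point
  masses and is kept outside.\<close>

definition prod_ker :: "(real \<Rightarrow> real \<Rightarrow> complex) \<Rightarrow> (real \<Rightarrow> real \<Rightarrow> complex) \<Rightarrow> real \<Rightarrow> real \<Rightarrow> complex" where
  "prod_ker K L x u = mulk (clamp_pi x) (K x) (L x) u + sym_shift (clamp_pi x) (K x) u"

lemma bker_prod_ker: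
  assumes K: "bker borel K m pi" and L: "bker borel L m pi"
  shows "bker borel (prod_ker K L) ((1 + 2 * pi * m) * m + m) (pi + pi)"
  unfolding prod_ker_def[abs_def]
  by (intro bker_add bker_mulk[OF K L] bker_shift[OF K] clamp_pi_bounds) auto

lemma csol_mult:
  assumes K: "bker borel K m pi" and L: "bker borel L m pi" and x: "x \<in> {0..pi}"
  shows "csol K r x * csol L r x = (of_real (cos (r * x)))\<^sup>2 + ft (prod_ker K L x) r"
proof -
  have iK: "integrable lborel (K x)" and iL: "integrable lborel (L x)"
    using bker_integrable[OF K] bker_integrable[OF L] by auto
  have "ft (prod_ker K L x) r = (of_real (cos (r * x)) + ft (K x) r) * ft (L x) r + of_real (cos (r * x)) * ft (K x) r"
    unfolding prod_ker_def[abs_def] ft_add[OF integrable_mulk[OF iK iL] integrable_sym_shift[OF iK]]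
    by (simp add: ft_mulk[OF iK iL] ft_sym_shift[OF iK] clamp_pi_id[OF x])
  then show ?thesis by (simp add: csol_def algebra_simps power2_eq_square)
qed

text \<open>Each factor has its kernel, point masses included, in |u| <= x, so the product lives in
  |u| <= 2 x. Read at u = 2 t, only parameters x >= t survive, which gives the final equation its
  Volterra form.\<close>

lemma prod_ker_support:
  assumes K: "\<And>x u. \<bar>u\<bar> > x \<Longrightarrow> K x u = 0" and L: "\<And>x u. \<bar>u\<bar> > x \<Longrightarrow> L x u = 0"
    and x: "x \<in> {0..pi}" and u: "\<bar>u\<bar> > 2 * x"
  shows "prod_ker K L x u = 0"
proof -
  have "K x s * L x (u - s) = 0" for s
  proof (cases "\<bar>s\<bar> > x")
    case False
    then have "\<bar>u - s\<bar> > x" using u by linarith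
    then show ?thesis using L by simp
  qed (use K in simp)
  then have "(\<lambda>s. K x s * L x (u - s)) = (\<lambda>s. 0)" by (intro ext)
  then have "conv (K x) (L x) u = 0" unfolding conv_def by (simp only: Bochner_Integration.integral_zero)
  moreover have "\<bar>u - x\<bar> > x" "\<bar>u + x\<bar> > x" using u x by auto
  ultimately show ?thesis by (simp add: prod_ker_def mulk_def sym_shift_def clamp_pi_id[OF x] K L)
qed

text \<open>The kernel of dDelta0. Division by rho is carried out under the integral, since
  \<open>half_box t\<close> has the transform sin(rho t) / rho; a sup bound therefore costs only the
  L1 norm of the data.\<close>

definition sine_ker :: "complex \<Rightarrow> (real \<Rightarrow> complex) \<Rightarrow> real \<Rightarrow> complex" where
  "sine_ker w n u = w * half_box pi u + (\<integral>t. n t * half_box t u \<partial>lborel)"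

text \<open>A single function is presented as a family constant in a dummy real parameter, so that
  the \<open>bker\<close> calculus covers it.\<close>

lemma bker_sine_ker:
  assumes n: "integrable lborel n" "(\<integral>t. norm (n t) \<partial>lborel) \<le> D"
  shows "bker (borel :: real measure) (\<lambda>_. sine_ker w n) (norm w * (1 / 2) + D * (1 / 2)) pi"
proof -
  have "bker (borel \<Otimes>\<^sub>M borel) (\<lambda>p :: real \<times> real. half_box (snd p)) (1 / 2) pi"
    by (rule bker_reparam[OF bker_half_box]) simp
  from bker_superpose[OF n(1) this n(2)]
  have "bker (borel :: real measure) (\<lambda>p u. \<integral>t. n t * half_box t u \<partial>lborel) (D * (1 / 2)) pi" by simp
  moreover have "bker (borel :: real measure) (\<lambda>p u. w * half_box pi u) (norm w * (1 / 2)) pi"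
    by (rule bker_cmult[OF bker_reparam[OF bker_half_box]]) simp
  ultimately show ?thesis unfolding sine_ker_def[abs_def] by (rule bker_add[rotated])
qed

lemma ft_sine_ker:
  assumes n: "integrable lborel n" "\<And>t. t \<notin> {0..pi} \<Longrightarrow> n t = 0" and r: "r \<noteq> 0"
  shows "ft (sine_ker w n) r = w * of_real (sin (r * pi) / r) + (\<integral>t. n t * of_real (sin (r * t)) \<partial>lborel) / of_real r"
proof -
  have k: "bker (borel \<Otimes>\<^sub>M borel) (\<lambda>p :: real \<times> real. half_box (snd p)) (1 / 2) pi"
    by (rule bker_reparam[OF bker_half_box]) simp
  have ib: "integrable lborel (half_box pi)" by (rule bker_integrable[OF bker_half_box]) simp
  have isn: "integrable lborel (\<lambda>u. \<integral>t. n t * half_box t u \<partial>lborel)"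
    using bker_integrable[OF bker_superpose[OF n(1) k order.refl], of 0] by simp
  have "ft (sine_ker w n) r = w * ft (half_box pi) r + ft (\<lambda>u. \<integral>t. n t * half_box t u \<partial>lborel) r"
    unfolding sine_ker_def[abs_def] ft_add[OF integrable_mult_right[OF ib] isn] ft_cmult ..
  also have "ft (\<lambda>u. \<integral>t. n t * half_box t u \<partial>lborel) r = (\<integral>t. n t * ft (half_box t) r \<partial>lborel)"
    using ft_superpose[OF n(1) k, of 0 r] by simp
  also have "\<dots> = (\<integral>t. n t * of_real (sin (r * t)) / of_real r \<partial>lborel)"
  proof (intro Bochner_Integration.integral_cong refl)
    fix t
    show "n t * ft (half_box t) r = n t * of_real (sin (r * t)) / of_real r"
      using n(2)[of t] r by (cases "t \<in> {0..pi}") (simp_all add: ft_half_box)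
  qed
  finally show ?thesis using r by (simp add: ft_half_box)
qed

text \<open>The kernel of ft k times the integral part of y'(pi): the shift by pi - t stands for the
  factor cos(r (pi - t)), and \<open>mulk\<close> for the solution at t.\<close>

definition deriv_ker :: "(real \<Rightarrow> complex) \<Rightarrow> (real \<Rightarrow> real \<Rightarrow> complex) \<Rightarrow> (real \<Rightarrow> complex) \<Rightarrow> real \<Rightarrow> complex" where
  "deriv_ker q K k u = (\<integral>t. q t * sym_shift (pi - clamp_pi t) (mulk (clamp_pi t) (K t) k) u \<partial>lborel)"

lemma bker_deriv_ker_integrand:
  assumes K: "bker borel K m pi" and k: "bker (borel :: real measure) (\<lambda>_. k) C pi"
  shows "bker (borel \<Otimes>\<^sub>M borel) (\<lambda>p :: real \<times> real. sym_shift (pi - clamp_pi (snd p)) (mulk (clamp_pi (snd p)) (K (snd p)) k))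
     ((1 + 2 * pi * m) * C) (pi + pi + pi)"
proof (rule bker_shift)
  show "bker (borel \<Otimes>\<^sub>M borel) (\<lambda>p :: real \<times> real. mulk (clamp_pi (snd p)) (K (snd p)) k) ((1 + 2 * pi * m) * C) (pi + pi)"
    by (rule bker_mulk[OF bker_reparam[OF K] bker_reparam[OF k, of fst]]) (auto simp: clamp_pi_bounds space_pair_measure)
qed (auto simp: clamp_pi_bounds)

lemma bker_deriv_ker:
  assumes K: "bker borel K m pi" and k: "bker (borel :: real measure) (\<lambda>_. k) C pi"
    and q: "integrable lborel q" "(\<integral>t. norm (q t) \<partial>lborel) \<le> D"
  shows "bker (borel :: real measure) (\<lambda>_. deriv_ker q K k) (D * ((1 + 2 * pi * m) * C)) (pi + pi + pi)"
  using bker_superpose[OF q(1) bker_deriv_ker_integrand[OF K k] q(2)] by (simp add: deriv_ker_def[abs_def])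

text \<open>The free part of y'(pi) grows like r, so its product with ft k stays explicit here;
  \<open>ft_data_ker\<close> resolves it, where r times ft k is known.\<close>

lemma ft_deriv_ker:
  assumes K: "bker borel K m pi" and k: "bker (borel :: real measure) (\<lambda>_. k) C pi"
    and q: "integrable lborel q" "\<And>t. t \<notin> {0..pi} \<Longrightarrow> q t = 0"
  shows "ft k r * dcsol q H K r pi =
    ft k r * (of_real (- r * sin (r * pi)) + H * of_real (cos (r * pi))) + ft (deriv_ker q K k) r"
proof -
  have ik: "integrable lborel k" using bker_integrable[OF k, of 0] by simp
  have iK: "integrable lborel (K t)" for t using bker_integrable[OF K] by simp
  have "ft (deriv_ker q K k) r = (\<integral>t. q t * ft (sym_shift (pi - clamp_pi t) (mulk (clamp_pi t) (K t) k)) r \<partial>lborel)"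
    using ft_superpose[OF q(1) bker_deriv_ker_integrand[OF K k], of 0 r] by (simp add: deriv_ker_def[abs_def])
  also have "\<dots> = (\<integral>t. ft k r * (q t * csol K r t * (if 0 \<le> t \<and> t \<le> pi then of_real (cos (r * (pi - t))) else 0)) \<partial>lborel)"
  proof (intro Bochner_Integration.integral_cong refl)
    fix t
    show "q t * ft (sym_shift (pi - clamp_pi t) (mulk (clamp_pi t) (K t) k)) r =
      ft k r * (q t * csol K r t * (if 0 \<le> t \<and> t \<le> pi then of_real (cos (r * (pi - t))) else 0))"
      using q(2)[of t] by (cases "t \<in> {0..pi}")
        (simp_all add: ft_sym_shift[OF integrable_mulk[OF iK ik]] ft_mulk[OF iK ik] clamp_pi_id csol_def)
  qed
  finally show ?thesis by (simp add: dcsol_def ring_distribs)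
qed

text \<open>The odd function n(u) - n(- u) has as its transform 2 i times the sine integral of
  \<open>n\<close>, and the difference of its two shifts multiplies by - 2 i sin(r pi). Together
  this is 4 times the product of sine and sine integral, hence the division by 4.\<close>

definition odd_shift :: "(real \<Rightarrow> complex) \<Rightarrow> real \<Rightarrow> complex" where
  "odd_shift n u = ((n (u + pi) - n (- (u + pi))) - (n (u - pi) - n (- (u - pi)))) / 4"

lemma odd_shift_integrable_ft:
  assumes n: "integrable lborel n"
  shows "integrable lborel (odd_shift n)"
    and "ft (odd_shift n) r = of_real (sin (r * pi)) * (\<integral>t. n t * of_real (sin (r * t)) \<partial>lborel)"
proof -
  define Od where "Od u = n u - n (- u)" for u
  have Od: "integrable lborel Od" unfolding Od_def[abs_def] using n integrable_reflect[OF n] by simp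
  have e: "odd_shift n = (\<lambda>u. (1 / 4) * (Od (u + pi) - Od (u + - pi)))"
    by (simp add: odd_shift_def Od_def fun_eq_iff)
  note i = lborel_integrable_translate[OF Od, of pi] lborel_integrable_translate[OF Od, of "- pi"]
  show "integrable lborel (odd_shift n)" unfolding e using i by simp
  have "ft (odd_shift n) r = (1 / 4) * (cis (- (r * pi)) - cis (r * pi)) * ft Od r"
    unfolding e ft_cmult ft_diff[OF i] ft_translate[of Od pi r] ft_translate[of Od "- pi" r] by (simp add: algebra_simps)
  also have "cis (- (r * pi)) - cis (r * pi) = - 2 * \<i> * of_real (sin (r * pi))"
    by (simp add: complex_eq_iff)
  also have "ft Od r = 2 * \<i> * (\<integral>t. n t * of_real (sin (r * t)) \<partial>lborel)"
    unfolding Od_def[abs_def] by (rule ft_odd[OF n])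
  finally have "ft (odd_shift n) r = - (\<i> * \<i>) * (of_real (sin (r * pi)) * (\<integral>t. n t * of_real (sin (r * t)) \<partial>lborel))"
    by algebra
  then show "ft (odd_shift n) r = of_real (sin (r * pi)) * (\<integral>t. n t * of_real (sin (r * t)) \<partial>lborel)"
    by simp
qed

definition half_even :: "(real \<Rightarrow> complex) \<Rightarrow> real \<Rightarrow> complex" where
  "half_even n u = (n u + n (- u)) / 2"

lemma half_even_integrable_ft:
  assumes n: "integrable lborel n"
  shows "integrable lborel (half_even n)"
    and "ft (half_even n) r = (\<integral>t. n t * of_real (cos (r * t)) \<partial>lborel)"
    and "(\<integral>t. norm (half_even n t) \<partial>lborel) \<le> (\<integral>t. norm (n t) \<partial>lborel)"
proof -
  show i: "integrable lborel (half_even n)" unfolding half_even_def[abs_def] using n integrable_reflect[OF n] by simp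
  have "half_even n = (\<lambda>u. (1 / 2) * (n u + n (- u)))" by (simp add: half_even_def fun_eq_iff)
  then show "ft (half_even n) r = (\<integral>t. n t * of_real (cos (r * t)) \<partial>lborel)"
    using ft_even[OF n, of r] by (simp only: ft_cmult) simp
  have "(\<integral>t. norm (half_even n t) \<partial>lborel) \<le> (\<integral>t. (norm (n t) + norm (n (- t))) / 2 \<partial>lborel)"
    using n integrable_reflect[OF n] i
    by (intro integral_mono) (auto simp: half_even_def norm_divide norm_triangle_ineq)
  also have "\<dots> = (\<integral>t. norm (n t) \<partial>lborel)"
    using n integrable_reflect[OF n] lborel_integral_real_affine[of "-1" "\<lambda>t. norm (n t)" 0] by simp
  finally show "(\<integral>t. norm (half_even n t) \<partial>lborel) \<le> (\<integral>t. norm (n t) \<partial>lborel)" .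
qed

text \<open>Here \<open>w\<close>, \<open>w0\<close>, \<open>n\<close>, \<open>n0\<close> stand for the differences of the Cauchy data, so that
  \<^term>\<open>w - w0\<close> is the difference of the coefficients \<open>h\<close>.\<close>
definition data_ker :: "(real \<Rightarrow> complex) \<Rightarrow> (real \<Rightarrow> real \<Rightarrow> complex) \<Rightarrow> (real \<Rightarrow> real \<Rightarrow> complex) \<Rightarrow> complex \<Rightarrow> complex
    \<Rightarrow> complex \<Rightarrow> complex \<Rightarrow> (real \<Rightarrow> complex) \<Rightarrow> (real \<Rightarrow> complex) \<Rightarrow> real \<Rightarrow> complex" where
  "data_ker q K L h H w w0 n n0 u =
     w * sym_shift pi (L pi) u + sym_shift pi (half_even n) u + conv (half_even n) (L pi) u
     - h * mulk pi (L pi) (sine_ker w0 n0) u - (w - w0) * prod_ker K L pi u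
     - H * sym_shift pi (sine_ker w0 n0) u - deriv_ker q L (sine_ker w0 n0) u + odd_shift n0 u"

text \<open>The expression on the left is the Wronskian of the two solutions at pi;
  \<open>d1\<close> is the slope of the first one and \<open>h + (w - w0)\<close> its coefficient h,
  expressed through the second problem. The constant \<open>w0\<close> is the only contribution that
  is not the transform of an integrable function.\<close>

lemma ft_data_ker:
  assumes K: "bker borel K m pi" and L: "bker borel L m pi"
    and q: "integrable lborel q" "\<And>t. t \<notin> {0..pi} \<Longrightarrow> q t = 0"
    and n: "integrable lborel n" and n0: "integrable lborel n0" "\<And>t. t \<notin> {0..pi} \<Longrightarrow> n0 t = 0"
    and r: "r \<noteq> 0"
    and dy: "d1 = w * of_real (cos (r * pi)) + (\<integral>t. n t * of_real (cos (r * t)) \<partial>lborel) + h * csol L r pi + dcsol q H L r pi - (h + (w - w0)) * csol K r pi"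
    and y: "csol K r pi - csol L r pi = ft (sine_ker w0 n0) r"
  shows "integrable lborel (data_ker q K L h H w w0 n n0)"
    and "d1 * csol L r pi - csol K r pi * dcsol q H L r pi = w0 + ft (data_ker q K L h H w w0 n n0) r"
proof -
  let ?k = "sine_ker w0 n0"
  note k = bker_sine_ker[OF n0(1) order.refl, of w0]
  have ik: "integrable lborel ?k" using bker_integrable[OF k, of 0] by simp
  have iL: "integrable lborel (L pi)" using bker_integrable[OF L] by simp
  have iV: "integrable lborel (prod_ker K L pi)" using bker_integrable[OF bker_prod_ker[OF K L]] by simp
  have iW: "integrable lborel (deriv_ker q L ?k)" using bker_integrable[OF bker_deriv_ker[OF L k q(1) order.refl], of 0] by simp
  note iA = half_even_integrable_ft(1)[OF n]
  note ints [simp] = ik iL iV iW iA integrable_sym_shift[OF iL] integrable_sym_shift[OF iA] integrable_conv[OF iA iL]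
    integrable_mulk[OF iL ik] integrable_sym_shift[OF ik] odd_shift_integrable_ft(1)[OF n0(1)]
  show "integrable lborel (data_ker q K L h H w w0 n n0)"
    unfolding data_ker_def[abs_def] by simp
  define c where "c = complex_of_real (cos (r * pi))"
  define s where "s = complex_of_real (sin (r * pi))"
  define y1 where "y1 = csol K r pi"
  define y2 where "y2 = csol L r pi"
  define S0 where "S0 = (\<integral>t. n0 t * of_real (sin (r * t)) \<partial>lborel)"
  define A where "A = (\<integral>t. n t * of_real (cos (r * t)) \<partial>lborel)"
  define k0 where "k0 = ft ?k r"
  define d2 where "d2 = dcsol q H L r pi"
  have cs: "c\<^sup>2 + s\<^sup>2 = 1"
    using sin_cos_squared_add2[of "r * pi"] by (simp add: c_def s_def flip: of_real_power of_real_add)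
  have y2: "y2 = c + ft (L pi) r" by (simp add: y2_def c_def csol_def)
  have y12: "y1 * y2 = c\<^sup>2 + ft (prod_ker K L pi) r"
    unfolding y1_def y2_def c_def by (rule csol_mult[OF K L]) simp
  have kd: "k0 * d2 = k0 * (- of_real r * s + H * c) + ft (deriv_ker q L ?k) r"
    unfolding k0_def d2_def s_def c_def using ft_deriv_ker[OF L k q, of r H] by simp
  \<comment> \<open>ft k is of order 1 / r, and this exact form of r times ft k is what tames the
    term - r s in y'(pi).\<close>
  have rk: "of_real r * k0 = w0 * s + S0"
  proof -
    have "k0 = w0 * of_real (sin (r * pi) / r) + S0 / of_real r"
      unfolding k0_def S0_def by (rule ft_sine_ker[OF n0 r])
    then show ?thesis using r by (simp add: s_def field_simps)
  qed
  have ft: "ft (data_ker q K L h H w w0 n n0) r =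
     w * (c * ft (L pi) r) + c * A + A * ft (L pi) r
     - h * (y2 * k0) - (w - w0) * ft (prod_ker K L pi) r
     - H * (c * k0) - ft (deriv_ker q L ?k) r + s * S0"
    unfolding data_ker_def[abs_def] y2 k0_def A_def S0_def c_def s_def
    by (simp add: ft_add ft_diff ft_cmult ft_sym_shift ft_conv ft_mulk half_even_integrable_ft(2)[OF n] odd_shift_integrable_ft(2)[OF n0(1)])
  have y1: "y1 = y2 + k0" using y by (simp add: y1_def y2_def k0_def algebra_simps)
  have d1: "d1 = w * c + A + h * y2 + d2 - (h + (w - w0)) * y1"
    using dy by (simp add: c_def A_def y1_def y2_def d2_def)
  have "d1 * y2 - y1 * d2 = (w * c + A) * y2 - h * (y2 * k0) - (w - w0) * (y1 * y2) - k0 * d2"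
    unfolding d1 using y1 by algebra
  also have "\<dots> = (w * c + A) * y2 - h * (y2 * k0) - (w - w0) * (c\<^sup>2 + ft (prod_ker K L pi) r)
      + s * (w0 * s + S0) - H * (c * k0) - ft (deriv_ker q L ?k) r"
    unfolding y12 kd using rk by algebra
  \<comment> \<open>The terms w c^2 from (w c + A) y2 and - (w - w0) c^2 leave w0 c^2, which
    completes w0 s^2 to the constant w0.\<close>
  also have "\<dots> = w0 * (c\<^sup>2 + s\<^sup>2) + ft (data_ker q K L h H w w0 n n0) r"
    unfolding ft using y2 by algebra
  finally show "d1 * csol L r pi - csol K r pi * dcsol q H L r pi = w0 + ft (data_ker q K L h H w w0 n n0) r"
    unfolding cs by (simp add: y1_def y2_def d2_def)
qed

text \<open>By cos^2(r t) = (1 + cos(2 r t)) / 2 half of the integral of \<open>q\<close> splits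
  off. The weight 1/8 of the local term collects 1/2 from this formula, 1/2 from the substitution u
  = 2 t and 1/2 from the even extension in u.\<close>

lemma ft_product_integral:
  assumes K: "bker borel K m pi" and L: "bker borel L m pi"
    and q: "integrable lborel q" "\<And>t. t \<notin> {0..pi} \<Longrightarrow> q t = 0"
  shows "(\<integral>t. q t * (csol K r t * csol L r t) \<partial>lborel) = (\<integral>t. q t \<partial>lborel) / 2 +
     ft (\<lambda>u. (q (u / 2) + q (- u / 2)) / 8 + (\<integral>t. q t * prod_ker K L t u \<partial>lborel)) r"
    and "integrable lborel (\<lambda>u. (q (u / 2) + q (- u / 2)) / 8 + (\<integral>t. q t * prod_ker K L t u \<partial>lborel))"
proof -
  note V = bker_prod_ker[OF K L]
  have V2: "bker (borel \<Otimes>\<^sub>M borel) (\<lambda>p :: real \<times> real. prod_ker K L (snd p)) ((1 + 2 * pi * m) * m + m) (pi + pi)"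
    by (rule bker_reparam[OF V]) simp
  have [measurable]: "q \<in> borel_measurable borel" using q by auto
  have iq2: "integrable lborel (\<lambda>u. q (u / 2))"
    using lborel_integrable_real_affine[OF q(1), of "1/2" 0] by simp
  have iE: "integrable lborel (\<lambda>u. q (u / 2) + q (- u / 2))"
    using integrable_reflect[OF iq2] iq2 by simp
  have iV: "integrable lborel (\<lambda>u. \<integral>t. q t * prod_ker K L t u \<partial>lborel)"
    using bker_integrable[OF bker_superpose[OF q(1) V2 order.refl], of 0] by simp
  show "integrable lborel (\<lambda>u. (q (u / 2) + q (- u / 2)) / 8 + (\<integral>t. q t * prod_ker K L t u \<partial>lborel))"
    using iE iV by simp
  have icos: "integrable lborel (\<lambda>t. q t * of_real (g t))" if [measurable]: "g \<in> borel_measurable borel" and "\<And>t. \<bar>g t\<bar> \<le> 1" for g :: "real \<Rightarrow> real"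
    by (rule integrable_mult_bounded[OF q(1), of _ 1]) (use that in auto)
  have iftV: "integrable lborel (\<lambda>t. q t * ft (prod_ker K L t) r)"
    by (rule integrable_mult_bounded[OF q(1) _ bker_norm_ft_le[OF V]]) (use bker_ft_measurable[OF V] in auto)
  have "(\<integral>t. q t * (csol K r t * csol L r t) \<partial>lborel) =
     (\<integral>t. q t / 2 + q t * of_real (cos (2 * r * t)) / 2 + q t * ft (prod_ker K L t) r \<partial>lborel)"
  proof (intro Bochner_Integration.integral_cong refl)
    fix t
    show "q t * (csol K r t * csol L r t) = q t / 2 + q t * of_real (cos (2 * r * t)) / 2 + q t * ft (prod_ker K L t) r"
    proof (cases "t \<in> {0..pi}")
      case True
      have "(complex_of_real (cos (r * t)))\<^sup>2 = (1 + of_real (cos (2 * r * t))) / 2"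
        using cos_double_cos[of "r * t"] by (simp add: mult.assoc flip: of_real_power)
      then show ?thesis unfolding csol_mult[OF K L True] by (simp add: ring_distribs add_divide_distrib)
    qed (use q(2) in simp)
  qed
  also have "\<dots> = (\<integral>t. q t \<partial>lborel) / 2 + (\<integral>t. q t * of_real (cos (2 * r * t)) \<partial>lborel) / 2 + (\<integral>t. q t * ft (prod_ker K L t) r \<partial>lborel)"
    using q(1) icos[of "\<lambda>t. cos (2 * r * t)"] iftV by simp
  also have "(\<integral>t. q t * of_real (cos (2 * r * t)) \<partial>lborel) = (\<integral>u. q (u / 2) * of_real (cos (r * u)) \<partial>lborel) / 2"
    using lborel_integral_real_affine[of 2 "\<lambda>u. q (u / 2) * of_real (cos (r * u))" 0] by (simp add: mult_ac scaleR_conv_of_real)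
  also have "(\<integral>t. q t * ft (prod_ker K L t) r \<partial>lborel) = ft (\<lambda>u. \<integral>t. q t * prod_ker K L t u \<partial>lborel) r"
    using ft_superpose[OF q(1) V2, of 0 r] by simp
  also have "(\<integral>u. q (u / 2) * of_real (cos (r * u)) \<partial>lborel) = ft (\<lambda>u. q (u / 2) + q (- u / 2)) r / 2"
    using ft_even[OF iq2, of r] by simp
  finally have *: "(\<integral>t. q t * (csol K r t * csol L r t) \<partial>lborel) = (\<integral>t. q t \<partial>lborel) / 2 +
     ((1 / 8) * ft (\<lambda>u. q (u / 2) + q (- u / 2)) r + ft (\<lambda>u. \<integral>t. q t * prod_ker K L t u \<partial>lborel) r)"
    by simp
  have "ft (\<lambda>u. (1 / 8) * (q (u / 2) + q (- u / 2)) + (\<integral>t. q t * prod_ker K L t u \<partial>lborel)) r =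
     (1 / 8) * ft (\<lambda>u. q (u / 2) + q (- u / 2)) r + ft (\<lambda>u. \<integral>t. q t * prod_ker K L t u \<partial>lborel) r"
    by (subst ft_add[OF integrable_mult_right[OF iE] iV]) (simp only: ft_cmult)
  then show "(\<integral>t. q t * (csol K r t * csol L r t) \<partial>lborel) = (\<integral>t. q t \<partial>lborel) / 2 +
     ft (\<lambda>u. (q (u / 2) + q (- u / 2)) / 8 + (\<integral>t. q t * prod_ker K L t u \<partial>lborel)) r"
    unfolding * by simp
qed

section \<open>Stability\<close>

text \<open>Unlike \<open>L2_ball\<close> this has no support condition, because the data terms are
  shifted and dilated copies of the data.\<close>

definition L2_le :: "real \<Rightarrow> (real \<Rightarrow> complex) \<Rightarrow> bool" where
  "L2_le d f \<longleftrightarrow> f \<in> borel_measurable borel \<and> integrable lborel (\<lambda>u. (norm (f u))\<^sup>2) \<and>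
     (\<integral>u. (norm (f u))\<^sup>2 \<partial>lborel) \<le> d\<^sup>2"

lemma L2_ball_imp_L2_le: "L2_ball d f \<Longrightarrow> L2_le d f"
  by (simp add: L2_ball_def L2_le_def)

lemma L2_le_affine:
  assumes f: "L2_le d f" and c: "1 \<le> \<bar>c\<bar>"
  shows "L2_le d (\<lambda>u. f (b + c * u))"
proof -
  have [measurable]: "f \<in> borel_measurable borel" and i: "integrable lborel (\<lambda>u. (norm (f u))\<^sup>2)"
    and le: "(\<integral>u. (norm (f u))\<^sup>2 \<partial>lborel) \<le> d\<^sup>2"
    using f by (auto simp: L2_le_def)
  have c0: "c \<noteq> 0" using c by auto
  have eq: "(\<integral>u. (norm (f u))\<^sup>2 \<partial>lborel) = \<bar>c\<bar> * (\<integral>u. (norm (f (b + c * u)))\<^sup>2 \<partial>lborel)"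
    using lborel_integral_real_affine[OF c0, of "\<lambda>u. (norm (f u))\<^sup>2" b] by simp
  have "1 * (\<integral>u. (norm (f (b + c * u)))\<^sup>2 \<partial>lborel) \<le> \<bar>c\<bar> * (\<integral>u. (norm (f (b + c * u)))\<^sup>2 \<partial>lborel)"
    by (intro mult_right_mono c Bochner_Integration.integral_nonneg) simp
  then show ?thesis
    using le lborel_integrable_real_affine[OF i c0, of b] unfolding L2_le_def eq by auto
qed

text \<open>By convexity of the square, averages do not enlarge \<open>d\<close>; so the data terms,
  written as averages, inherit the bound of the data without a factor.\<close>

lemma L2_le_average:
  assumes f: "L2_le d f" and g: "L2_le d g"
  shows "L2_le d (\<lambda>u. (f u + g u) / 2)"
proof -
  have [measurable]: "f \<in> borel_measurable borel" "g \<in> borel_measurable borel"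
    using f g by (auto simp: L2_le_def)
  have le: "(norm ((a + b) / 2))\<^sup>2 \<le> ((norm a)\<^sup>2 + (norm b)\<^sup>2) / 2" for a b :: complex
  proof -
    have "(norm ((a + b) / 2))\<^sup>2 \<le> ((norm a + norm b) / 2)\<^sup>2"
      by (intro power_mono) (auto simp: norm_divide norm_triangle_ineq)
    also have "\<dots> \<le> ((norm a)\<^sup>2 + (norm b)\<^sup>2) / 2"
      using sum_squares_bound[of "norm a" "norm b"] by (simp add: power2_sum power_divide)
    finally show ?thesis .
  qed
  have ir: "integrable lborel (\<lambda>u. ((norm (f u))\<^sup>2 + (norm (g u))\<^sup>2) / 2)"
    using f g by (simp add: L2_le_def)
  have il: "integrable lborel (\<lambda>u. (norm ((f u + g u) / 2))\<^sup>2)"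
    by (rule Bochner_Integration.integrable_bound[OF ir]) (use le in auto)
  have "(\<integral>u. (norm ((f u + g u) / 2))\<^sup>2 \<partial>lborel) \<le> (\<integral>u. ((norm (f u))\<^sup>2 + (norm (g u))\<^sup>2) / 2 \<partial>lborel)"
    by (rule integral_mono[OF il ir le])
  also have "\<dots> \<le> d\<^sup>2" using f g by (simp add: L2_le_def)
  finally show ?thesis using il unfolding L2_le_def by simp
qed

lemma L2_le_uminus: "L2_le d f \<Longrightarrow> L2_le d (\<lambda>u. - f u)"
  by (simp add: L2_le_def)

lemma norm_sym_shift_le: "(\<And>u. norm (f u) \<le> B) \<Longrightarrow> norm (sym_shift a f u) \<le> B"
  using norm_triangle_mono[of "f (u - a)" B "f (u + a)" B] by (simp add: sym_shift_def norm_divide)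

definition prod_bound :: "real \<Rightarrow> real" where
  "prod_bound m = (1 + 2 * pi * m) * m + m"

text \<open>The coefficients of \<open>d\<close> in the bounds of the summands of
  \<open>data_ker\<close>, in their order and without the two that are merely square integrable.
  Here \<open>k\<close> bounds \<open>sine_ker\<close> per unit of \<open>d\<close>: 1/2 for w0 and
  sqrt(pi) / 2 for the L1 norm of n0.\<close>

definition data_bound :: "real \<Rightarrow> real" where
  "data_bound Q = (let m = tm_bound Q; k = (1 + sqrt pi) / 2 in
     m + sqrt pi * m + Q * ((1 + 2 * pi * m) * k) + prod_bound m + Q * k + Q * sqrt pi * ((1 + 2 * pi * m) * k))"

text \<open>The data \<open>n\<close> and \<open>n0\<close> need not be bounded, so the two summands
  that merely shift and reflect them stay on the right. Every other summand passes the data through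
  an integral against a bounded kernel or multiplies such a kernel by a difference of numbers, and
  is at most a multiple of \<open>d\<close>.\<close>

lemma norm_data_ker_le:
  assumes Q: "0 \<le> Q" and d: "0 \<le> d"
    and K: "bker borel K (tm_bound Q) pi" and L: "bker borel L (tm_bound Q) pi"
    and q: "L2_ball Q q" and n: "L2_ball d n" and n0: "L2_ball d n0"
    and h: "norm h \<le> Q" and H: "norm H \<le> Q"
    and w: "norm w \<le> d" "norm w0 \<le> d" "norm (w - w0) \<le> d"
  shows "norm (data_ker q K L h H w w0 n n0 u) \<le>
     norm (sym_shift pi (half_even n) u) + norm (odd_shift n0 u) + d * data_bound Q"
proof -
  define m where "m = tm_bound Q"
  define k where "k = (1 + sqrt pi) / 2"
  have m: "0 \<le> m" unfolding m_def by (rule bker_nonneg[OF K])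
  have k: "0 \<le> k" by (simp add: k_def)
  let ?s = "sine_ker w0 n0"
  note qi = L2_ball_integrable[OF q Q] and ni = L2_ball_integrable[OF n d] and n0i = L2_ball_integrable[OF n0 d]
  have bs: "bker (borel :: real measure) (\<lambda>_. ?s) (d * k) pi"
  proof (rule bker_mono[OF bker_sine_ker[OF n0i]])
    have "norm w0 * (1 / 2) + d * sqrt pi * (1 / 2) \<le> d * (1 / 2) + d * sqrt pi * (1 / 2)" using w(2) by simp
    then show "norm w0 * (1 / 2) + d * sqrt pi * (1 / 2) \<le> d * k" by (simp add: k_def field_simps)
  qed simp
  have L': "bker borel (\<lambda>_ :: real. L pi) m pi" using bker_reparam[OF L, of "\<lambda>_. pi"] by (simp add: m_def)
  have 1: "norm (w * sym_shift pi (L pi) u) \<le> d * m"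
    unfolding norm_mult by (intro mult_mono w norm_sym_shift_le bker_bound[OF L'] d norm_ge_zero)
  have 2: "norm (conv (half_even n) (L pi) u) \<le> d * sqrt pi * m"
    by (rule order_trans[OF norm_conv_le[OF half_even_integrable_ft(1)[OF ni(1)] bker_bound[OF L']]])
       (intro mult_right_mono m order_trans[OF half_even_integrable_ft(3)[OF ni(1)] ni(2)])
  have bm: "bker (borel :: real measure) (\<lambda>_. mulk pi (L pi) ?s) ((1 + 2 * pi * m) * (d * k)) (pi + pi)"
    by (rule bker_mulk[OF L' bs]) auto
  have 3: "norm (h * mulk pi (L pi) ?s u) \<le> Q * ((1 + 2 * pi * m) * (d * k))"
    unfolding norm_mult by (intro mult_mono h Q bker_bound[OF bm] norm_ge_zero)
  have 4: "norm ((w - w0) * prod_ker K L pi u) \<le> d * prod_bound m"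
    unfolding norm_mult prod_bound_def m_def by (intro mult_mono w d bker_bound[OF bker_prod_ker[OF K L]] norm_ge_zero)
  have 5: "norm (H * sym_shift pi ?s u) \<le> Q * (d * k)"
    unfolding norm_mult by (intro mult_mono H Q norm_sym_shift_le bker_bound[OF bs] norm_ge_zero)
  have 6: "norm (deriv_ker q L ?s u) \<le> Q * sqrt pi * ((1 + 2 * pi * m) * (d * k))"
    unfolding m_def by (rule bker_bound[OF bker_deriv_ker[OF L bs qi]])
  have "norm (data_ker q K L h H w w0 n n0 u) \<le> norm (w * sym_shift pi (L pi) u) + norm (sym_shift pi (half_even n) u)
    + norm (conv (half_even n) (L pi) u) + norm (h * mulk pi (L pi) ?s u) + norm ((w - w0) * prod_ker K L pi u)
    + norm (H * sym_shift pi ?s u) + norm (deriv_ker q L ?s u) + norm (odd_shift n0 u)"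
    unfolding data_ker_def
    by (intro order_trans[OF norm_triangle_ineq] order_trans[OF norm_triangle_ineq4] add_mono order.refl)
  also have "\<dots> \<le> d * m + norm (sym_shift pi (half_even n) u) + d * sqrt pi * m + Q * ((1 + 2 * pi * m) * (d * k))
     + d * prod_bound m + Q * (d * k) + Q * sqrt pi * ((1 + 2 * pi * m) * (d * k)) + norm (odd_shift n0 u)"
    using 1 2 3 4 5 6 by (intro add_mono) auto
  also have "\<dots> = norm (sym_shift pi (half_even n) u) + norm (odd_shift n0 u) + d * data_bound Q"
    unfolding data_bound_def Let_def m_def[symmetric] k_def[symmetric] by (simp add: algebra_simps)
  finally show ?thesis .
qed

text \<open>192 = 3 * 64: the equation is multiplied by 8, hence 64, and the square of a sum of
  three terms costs 3. Inside, 2 counts \<open>g1\<close> and \<open>g2\<close>, and pi is the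
  length of the interval over which the constant term is squared.\<close>

definition l2_const :: "real \<Rightarrow> real" where
  "l2_const Q = sqrt (192 * (2 + pi * (data_bound Q)\<^sup>2))"

text \<open>The 8 comes from solving for q in q / 8; the added 1 makes the rate positive, as
  \<open>gronwall_backward\<close> demands.\<close>

definition gronwall_rate :: "real \<Rightarrow> real" where
  "gronwall_rate Q = 8 * prod_bound (tm_bound Q) + 1"

definition l1_const :: "real \<Rightarrow> real" where
  "l1_const Q = 2 * exp (2 * gronwall_rate Q * pi) * (l2_const Q * sqrt pi)"

text \<open>Comes from |q| <= b + c on an interval of length pi, where c is the Gronwall rate times
  the L1 bound, and from (b + c)^2 <= 2 b^2 + 2 c^2.\<close>

definition stab_const :: "real \<Rightarrow> real" where
  "stab_const Q = sqrt (2 * (l2_const Q)\<^sup>2 + 2 * pi * (gronwall_rate Q * l1_const Q)\<^sup>2)"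

text \<open>At u = 2 t with t > 0 the reflected value q(- t) is zero, so the local term isolates
  q(t) / 8, and the kernel involves only s >= t. Gronwall gives the L1 bound, and inserting that
  into the pointwise inequality gives the L2 bound.\<close>

lemma volterra_stability:
  assumes Q: "0 \<le> Q" and d: "0 \<le> d"
    and K: "bker borel K (tm_bound Q) pi" and L: "bker borel L (tm_bound Q) pi"
    and Ks: "\<And>x u. \<bar>u\<bar> > x \<Longrightarrow> K x u = 0" and Ls: "\<And>x u. \<bar>u\<bar> > x \<Longrightarrow> L x u = 0"
    and q: "integrable lborel q" "\<And>t. t \<notin> {0..pi} \<Longrightarrow> q t = 0"
    and G: "G \<in> borel_measurable borel"
    and g1: "L2_le d g1" and g2: "L2_le d g2"
    and Gle: "\<And>t. norm (G (2 * t)) \<le> norm (g1 t) + norm (g2 t) + d * data_bound Q"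
    and eq: "AE u in lborel. (q (u / 2) + q (- u / 2)) / 8 + (\<integral>s. q s * prod_ker K L s u \<partial>lborel) = G u"
  shows "(\<integral>t. norm (q t) \<partial>lborel) \<le> d * l1_const Q"
    and "(\<integral>t. (norm (q t))\<^sup>2 \<partial>lborel) \<le> (d * stab_const Q)\<^sup>2"
proof -
  define V where "V = prod_bound (tm_bound Q)"
  define Gc where "Gc = data_bound Q"
  define M where "M = gronwall_rate Q"
  define \<beta> where "\<beta> = l2_const Q"
  have bV: "bker borel (prod_ker K L) V (pi + pi)" unfolding V_def prod_bound_def by (rule bker_prod_ker[OF K L])
  have V: "0 \<le> V" by (rule bker_nonneg[OF bV])
  have M: "0 < M" "8 * V \<le> M" using V by (simp_all add: M_def gronwall_rate_def V_def)
  have Gc: "0 \<le> Gc"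
    using bker_nonneg[OF K] Q V by (simp add: Gc_def data_bound_def Let_def V_def)
  have \<beta>: "0 \<le> \<beta>" "\<beta>\<^sup>2 = 192 * (2 + pi * Gc\<^sup>2)" by (simp_all add: \<beta>_def l2_const_def Gc_def)
  have [measurable]: "q \<in> borel_measurable borel" using q by auto
  note [measurable] = G
  have [measurable]: "g1 \<in> borel_measurable borel" "g2 \<in> borel_measurable borel" using g1 g2 by (auto simp: L2_le_def)
  let ?p = "\<lambda>t. norm (q t)"
  let ?\<Phi> = "\<lambda>t. \<integral>s. ?p s * (if t \<le> s then 1 else 0) \<partial>lborel"
  define b where "b t = indicator {0..pi} t * (8 * (norm (g1 t) + norm (g2 t) + d * Gc))" for t
  have b0: "0 \<le> b t" for t using d Gc by (simp add: b_def)
  have [measurable]: "b \<in> borel_measurable borel" unfolding b_def[abs_def] by measurable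
  let ?B = "\<lambda>t. 192 * ((norm (g1 t))\<^sup>2 + (norm (g2 t))\<^sup>2 + (d * Gc)\<^sup>2 * indicator {0..pi} t)"
  have b2: "(b t)\<^sup>2 \<le> ?B t" for t
  proof -
    have "(x + y + z)\<^sup>2 \<le> 3 * (x\<^sup>2 + y\<^sup>2 + z\<^sup>2)" for x y z :: real
      using sum_squares_bound[of x y] sum_squares_bound[of y z] sum_squares_bound[of x z]
      by (simp add: power2_eq_square algebra_simps)
    from this[of "norm (g1 t)" "norm (g2 t)" "d * Gc"]
    have "64 * (norm (g1 t) + norm (g2 t) + d * Gc)\<^sup>2 \<le> 192 * ((norm (g1 t))\<^sup>2 + (norm (g2 t))\<^sup>2 + (d * Gc)\<^sup>2)"
      by linarith
    moreover have "(b t)\<^sup>2 = indicator {0..pi} t * (64 * (norm (g1 t) + norm (g2 t) + d * Gc)\<^sup>2)"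
      unfolding b_def power_mult_distrib by (simp add: indicator_def)
    ultimately show ?thesis by (simp add: indicator_def)
  qed
  have iB: "integrable lborel ?B" using g1 g2 by (simp add: L2_le_def)
  have ib2: "integrable lborel (\<lambda>t. (b t)\<^sup>2)"
    by (rule Bochner_Integration.integrable_bound[OF iB]) (use b2 in \<open>auto intro: order_trans[OF _ abs_ge_self]\<close>)
  have "(\<integral>t. (b t)\<^sup>2 \<partial>lborel) \<le> (\<integral>t. ?B t \<partial>lborel)" by (rule integral_mono[OF ib2 iB b2])
  also have "\<dots> = 192 * ((\<integral>t. (norm (g1 t))\<^sup>2 \<partial>lborel) + (\<integral>t. (norm (g2 t))\<^sup>2 \<partial>lborel) + (d * Gc)\<^sup>2 * pi)"
    using g1 g2 by (simp add: L2_le_def)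
  also have "\<dots> \<le> 192 * (d\<^sup>2 + d\<^sup>2 + (d * Gc)\<^sup>2 * pi)" using g1 g2 by (simp add: L2_le_def)
  also have "\<dots> = (d * \<beta>)\<^sup>2" by (simp add: power_mult_distrib \<beta>(2) algebra_simps)
  finally have Ib2: "(\<integral>t. (b t)\<^sup>2 \<partial>lborel) \<le> (d * \<beta>)\<^sup>2" .
  have "L2_ball (d * \<beta>) (\<lambda>t. complex_of_real (b t))"
  proof -
    have "b t = 0" if "t \<notin> {0..pi}" for t using that by (simp add: b_def)
    then show ?thesis using ib2 Ib2 by (simp add: L2_ball_def)
  qed
  note bi = L2_ball_integrable[OF this mult_nonneg_nonneg[OF d \<beta>(1)]]
  have ib: "integrable lborel b" and Ib: "(\<integral>t. b t \<partial>lborel) \<le> d * \<beta> * sqrt pi"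
    using bi b0 by (simp_all add: complex_of_real_integrable_eq)
  have i\<Phi>: "integrable lborel (\<lambda>s. ?p s * (if t \<le> s then 1 else 0 :: real))" for t
    by (rule Bochner_Integration.integrable_bound[of _ ?p]) (use q in auto)
  have bV2: "bker (borel \<Otimes>\<^sub>M borel) (\<lambda>p :: real \<times> real. prod_ker K L (snd p)) V (pi + pi)"
    by (rule bker_reparam[OF bV]) simp
  have [measurable]: "(\<lambda>u. \<integral>s. q s * prod_ker K L s u \<partial>lborel) \<in> borel_measurable borel"
    using bker_section_measurable[OF bker_superpose[OF q(1) bV2 order.refl], of 0] by simp
  have "Measurable.pred borel (\<lambda>u. (q (u / 2) + q (- u / 2)) / 8 + (\<integral>s. q s * prod_ker K L s u \<partial>lborel) = G u)"
    by measurable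
  from AE_borel_affine[OF _ this eq, of 2 0]
  have eq2: "AE t in lborel. (q t + q (- t)) / 8 + (\<integral>s. q s * prod_ker K L s (2 * t) \<partial>lborel) = G (2 * t)"
    by simp
  \<comment> \<open>The point t = 0 is excluded because q(- t) = 0 is guaranteed only for t >
    0.\<close>
  have ineq: "AE t in lborel. t \<in> {0..pi} \<longrightarrow> ?p t \<le> b t + M * ?\<Phi> t"
    using eq2 AE_lborel_singleton[of 0]
  proof eventually_elim
    case (elim t)
    show ?case
    proof
      assume t: "t \<in> {0..pi}"
      have "norm (\<integral>s. q s * prod_ker K L s (2 * t) \<partial>lborel) \<le> (\<integral>s. V * (?p s * (if t \<le> s then 1 else 0)) \<partial>lborel)"
      proof (rule order_trans[OF integral_norm_bound], rule integral_mono_AE')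
        show "AE s in lborel. norm (q s * prod_ker K L s (2 * t)) \<le> V * (?p s * (if t \<le> s then 1 else 0))"
        proof (rule AE_I2)
          fix s
          show "norm (q s * prod_ker K L s (2 * t)) \<le> V * (?p s * (if t \<le> s then 1 else 0))"
          proof (cases "s \<in> {0..pi}")
            case True
            show ?thesis
            proof (cases "t \<le> s")
              case True
              then show ?thesis using mult_left_mono[OF bker_bound[OF bV, of s "2 * t"] norm_ge_zero[of "q s"]]
                by (simp add: norm_mult mult.commute)
            next
              case False
              then have "prod_ker K L s (2 * t) = 0" using t by (intro prod_ker_support[OF Ks Ls True]) auto
              then show ?thesis using False by simp
            qed
          qed (use q(2) in simp)
        qed
        show "AE s in lborel. 0 \<le> V * (?p s * (if t \<le> s then 1 else 0))" using V by simp
      qed (intro integrable_mult_right i\<Phi>)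
      then have I: "norm (\<integral>s. q s * prod_ker K L s (2 * t) \<partial>lborel) \<le> V * ?\<Phi> t" by simp
      have "q (- t) = 0" using t elim(2) by (intro q(2)) auto
      then have "q t = 8 * (G (2 * t) - (\<integral>s. q s * prod_ker K L s (2 * t) \<partial>lborel))"
        using elim(1) by (simp add: field_simps)
      then have "?p t = 8 * norm (G (2 * t) - (\<integral>s. q s * prod_ker K L s (2 * t) \<partial>lborel))"
        by (simp only: norm_mult norm_numeral)
      also have "\<dots> \<le> 8 * (norm (G (2 * t)) + norm (\<integral>s. q s * prod_ker K L s (2 * t) \<partial>lborel))"
        using norm_triangle_ineq4 by (intro mult_left_mono) auto
      also have "\<dots> \<le> 8 * ((norm (g1 t) + norm (g2 t) + d * Gc) + V * ?\<Phi> t)"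
        using I Gle[of t] by (intro mult_left_mono add_mono) (auto simp: Gc_def)
      also have "\<dots> = b t + 8 * V * ?\<Phi> t" using t by (simp add: b_def)
      also have "\<dots> \<le> b t + M * ?\<Phi> t"
        by (intro add_left_mono mult_right_mono M Bochner_Integration.integral_nonneg) simp
      finally show "?p t \<le> b t + M * ?\<Phi> t" .
    qed
  qed
  have "(\<integral>t. ?p t \<partial>lborel) \<le> 2 * exp (2 * M * pi) * (\<integral>t. b t \<partial>lborel)"
    by (rule gronwall_backward[OF _ _ _ ib b0 M(1) ineq]) (use q in auto)
  also have "\<dots> \<le> 2 * exp (2 * M * pi) * (d * \<beta> * sqrt pi)" using Ib by (intro mult_left_mono) auto
  also have "\<dots> = d * l1_const Q" by (simp add: l1_const_def M_def \<beta>_def)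
  finally show L1: "(\<integral>t. ?p t \<partial>lborel) \<le> d * l1_const Q" .
  \<comment> \<open>The L1 bound makes the Volterra term uniformly bounded, so the pointwise
    inequality can be squared and integrated.\<close>
  let ?c = "M * (d * l1_const Q)"
  have p2: "AE t in lborel. (?p t)\<^sup>2 \<le> 2 * (b t)\<^sup>2 + 2 * ?c\<^sup>2 * indicator {0..pi} t"
    using ineq
  proof eventually_elim
    case (elim t)
    show ?case
    proof (cases "t \<in> {0..pi}")
      case True
      have "?\<Phi> t \<le> (\<integral>s. ?p s \<partial>lborel)" using i\<Phi> q(1) by (intro integral_mono) auto
      then have "M * ?\<Phi> t \<le> ?c" using L1 M by (intro mult_left_mono) auto
      then have "?p t \<le> b t + ?c" using elim True by auto
      then have "(?p t)\<^sup>2 \<le> (b t + ?c)\<^sup>2" by (intro power_mono) auto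
      also have "\<dots> \<le> 2 * (b t)\<^sup>2 + 2 * ?c\<^sup>2" using sum_squares_bound[of "b t" ?c] by (simp add: power2_sum)
      finally show ?thesis using True by simp
    qed (use q(2) in simp)
  qed
  have "(\<integral>t. (?p t)\<^sup>2 \<partial>lborel) \<le> (\<integral>t. 2 * (b t)\<^sup>2 + 2 * ?c\<^sup>2 * indicator {0..pi} t \<partial>lborel)"
    by (rule integral_mono_AE') (use p2 ib2 in auto)
  also have "\<dots> = 2 * (\<integral>t. (b t)\<^sup>2 \<partial>lborel) + 2 * ?c\<^sup>2 * pi" using ib2 by simp
  also have "\<dots> \<le> 2 * (d * \<beta>)\<^sup>2 + 2 * ?c\<^sup>2 * pi" using Ib2 by simp
  also have "\<dots> = (d * stab_const Q)\<^sup>2"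
  proof -
    have "(stab_const Q)\<^sup>2 = 2 * \<beta>\<^sup>2 + 2 * pi * (M * l1_const Q)\<^sup>2"
      by (simp add: stab_const_def \<beta>_def M_def)
    then show ?thesis by (simp add: power_mult_distrib algebra_simps)
  qed
  finally show "(\<integral>t. (norm (q t))\<^sup>2 \<partial>lborel) \<le> (d * stab_const Q)\<^sup>2" .
qed

text \<open>Each term is an iterated average of four copies of \<open>n\<close> or
  \<open>- n\<close>, taken at arguments of slope 2 or - 2.\<close>

lemma L2_le_data_terms:
  assumes n: "L2_le d n"
  shows "L2_le d (\<lambda>t. sym_shift pi (half_even n) (2 * t))" and "L2_le d (\<lambda>t. odd_shift n (2 * t))"
proof -
  have a: "L2_le d (\<lambda>t. n (b + c * t))" if "1 \<le> \<bar>c\<bar>" for b c by (rule L2_le_affine[OF n that])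
  have "L2_le d (\<lambda>t. ((n (- pi + 2 * t) + n (pi + - 2 * t)) / 2 + (n (pi + 2 * t) + n (- pi + - 2 * t)) / 2) / 2)"
    by (intro L2_le_average a) auto
  then show "L2_le d (\<lambda>t. sym_shift pi (half_even n) (2 * t))"
    by (simp add: sym_shift_def half_even_def add.commute)
  have "L2_le d (\<lambda>t. ((n (pi + 2 * t) + - n (- pi + - 2 * t)) / 2 + (- n (- pi + 2 * t) + n (pi + - 2 * t)) / 2) / 2)"
    by (intro L2_le_average L2_le_uminus a) auto
  also have "(\<lambda>t. ((n (pi + 2 * t) + - n (- pi + - 2 * t)) / 2 + (- n (- pi + 2 * t) + n (pi + - 2 * t)) / 2) / 2) =
      (\<lambda>t. odd_shift n (2 * t))"
    by (rule ext) (simp add: odd_shift_def add.commute field_simps)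
  finally show "L2_le d (\<lambda>t. odd_shift n (2 * t))" .
qed

text \<open>In the constant, \<open>stab_const Q\<close> pays for the potentials, 1 for h because dh
  = domega - domega0, and \<open>1 + l1_const Q / 2\<close> for H because dH is domega0 minus half
  of the integral of dq.\<close>

lemma cauchy_data_stability:
  assumes Q: "0 < Q" and PQ1: "P_Q Q q1 h1 H1" and PQ2: "P_Q Q q2 h2 H2"
    and cd1: "cauchy_data q1 h1 H1 N1 N01 \<omega>1 \<omega>01" and cd2: "cauchy_data q2 h2 H2 N2 N02 \<omega>2 \<omega>02"
    and d: "d = L2_norm_0pi (\<lambda>x. N1 x - N2 x) + L2_norm_0pi (\<lambda>x. N01 x - N02 x) + norm (\<omega>1 - \<omega>2) + norm (\<omega>01 - \<omega>02)"
  shows "L2_norm_0pi (\<lambda>x. q1 x - q2 x) + norm (h1 - h2) + norm (H1 - H2) \<le> (stab_const Q + 2 + l1_const Q / 2) * d"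
proof -
  have d_ge: "0 \<le> d" "L2_norm_0pi (\<lambda>x. N1 x - N2 x) \<le> d" "L2_norm_0pi (\<lambda>x. N01 x - N02 x) \<le> d"
    "norm (\<omega>1 - \<omega>2) + norm (\<omega>01 - \<omega>02) \<le> d"
    unfolding d using L2_norm_0pi_nonneg[of "\<lambda>x. N1 x - N2 x"] L2_norm_0pi_nonneg[of "\<lambda>x. N01 x - N02 x"]
      norm_ge_zero[of "\<omega>1 - \<omega>2"] norm_ge_zero[of "\<omega>01 - \<omega>02"] by linarith+
  have Q0: "0 \<le> Q" using Q by simp
  let ?r1 = "\<lambda>x. zero_ext q1 (pi - x)" and ?r2 = "\<lambda>x. zero_ext q2 (pi - x)"
  have P: "L2_0pi q \<and> L2_ball Q (zero_ext q) \<and> norm h \<le> Q \<and> norm H \<le> Q" if "P_Q Q q h H" for q h H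
  proof -
    have "L2_0pi q" "L2_norm_0pi q \<le> Q" "norm h \<le> Q" "norm H \<le> Q"
      using that norm_ge_zero[of h] norm_ge_zero[of H] L2_norm_0pi_nonneg[of q] unfolding P_Q_def by linarith+
    then show ?thesis using L2_ball_zero_ext by blast
  qed
  note P1 = P[OF PQ1] and P2 = P[OF PQ2]
  have b1: "L2_ball Q ?r1" and b2: "L2_ball Q ?r2" using P1 P2 by (auto intro: L2_ball_reflect)
  note i1 = L2_ball_integrable(1)[OF b1 Q0] and i2 = L2_ball_integrable(1)[OF b2 Q0]
  obtain K where K: "bker borel K (tm_bound Q) pi" "\<And>x u. \<bar>u\<bar> > x \<Longrightarrow> K x u = 0"
    "\<And>x u. K x u = volterra_free ?r1 H1 x u + volterra ?r1 K x u"
    using transmutation_kernel[OF b1 Q0, of H1] P1 by blast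
  obtain L where L: "bker borel L (tm_bound Q) pi" "\<And>x u. \<bar>u\<bar> > x \<Longrightarrow> L x u = 0"
    "\<And>x u. L x u = volterra_free ?r2 H2 x u + volterra ?r2 L x u"
    using transmutation_kernel[OF b2 Q0, of H2] P2 by blast
  define q where "q x = ?r1 x - ?r2 x" for x
  have q: "integrable lborel q" "\<And>t. t \<notin> {0..pi} \<Longrightarrow> q t = 0"
    using i1 i2 by (auto simp: q_def[abs_def] zero_ext_def)
  have r20: "?r2 t = 0" if "t \<notin> {0..pi}" for t using that by (auto simp: zero_ext_def indicator_def)
  define n where "n = zero_ext (\<lambda>x. N1 x - N2 x)"
  define n0 where "n0 = zero_ext (\<lambda>x. N01 x - N02 x)"
  have N: "L2_0pi N1" "L2_0pi N01" "L2_0pi N2" "L2_0pi N02" using cd1 cd2 by (simp_all add: cauchy_data_def)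
  have iN: "integrable lborel (zero_ext f)" if "L2_0pi f" for f
    by (rule L2_ball_integrable(1)[OF L2_ball_zero_ext[OF that order.refl] L2_norm_0pi_nonneg])
  have nb: "L2_ball d n" and n0b: "L2_ball d n0"
    unfolding n_def n0_def using N d_ge by (auto intro!: L2_ball_zero_ext L2_0pi_diff)
  note ni = L2_ball_integrable(1)[OF nb d_ge(1)] and n0i = L2_ball_integrable(1)[OF n0b d_ge(1)]
  have n00: "n0 t = 0" if "t \<notin> {0..pi}" for t using that by (simp add: n0_def zero_ext_def)
  define w where "w = \<omega>1 - \<omega>2"
  define w0 where "w0 = \<omega>01 - \<omega>02"
  have Iq: "(\<integral>t. q t \<partial>lborel) = (LINT t:{0..pi}|lborel. q1 t) - (LINT t:{0..pi}|lborel. q2 t)"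
  proof -
    have "(\<integral>t. zero_ext f (pi - t) \<partial>lborel) = (LINT t:{0..pi}|lborel. f t)" for f
      using lborel_integral_real_affine[of "-1" "zero_ext f" pi] by (simp add: set_lebesgue_integral_def zero_ext_def)
    then show ?thesis unfolding q_def using i1 i2 by simp
  qed
  have om: "\<omega>1 = h1 + H1 + (LINT t:{0..pi}|lborel. q1 t) / 2" "\<omega>01 = H1 + (LINT t:{0..pi}|lborel. q1 t) / 2"
    "\<omega>2 = h2 + H2 + (LINT t:{0..pi}|lborel. q2 t) / 2" "\<omega>02 = H2 + (LINT t:{0..pi}|lborel. q2 t) / 2"
    using cd1 cd2 unfolding cauchy_data_def by blast+
  have hh: "h1 - h2 = w - w0" unfolding w_def w0_def om by simp
  have HH: "H1 - H2 = w0 - (\<integral>t. q t \<partial>lborel) / 2"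
    unfolding w0_def om Iq by (simp add: diff_divide_distrib)
  have wd: "norm w \<le> d" "norm w0 \<le> d" "norm (w - w0) \<le> d"
    using d_ge(4) norm_ge_zero[of w] norm_ge_zero[of w0] norm_triangle_ineq4[of w w0] unfolding w_def w0_def by linarith+
  let ?G = "data_ker ?r2 K L h2 H2 w w0 n n0"
  let ?E = "\<lambda>u. (q (u / 2) + q (- u / 2)) / 8 + (\<integral>t. q t * prod_ker K L t u \<partial>lborel)"
  \<comment> \<open>The second problem serves as reference: its potential, h and H occur in the
    kernel with bounds in terms of Q, and everything else in \<open>?G\<close> that refers to the
    first problem is the kernel \<open>K\<close>, bounded likewise, or a difference of data.\<close>
  have main: "integrable lborel ?G \<and> ft ?E r = ft ?G r" if r: "r \<noteq> 0" for r
  proof -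
    note c1 = cauchy_data_csol[OF PQ1 cd1 r K(1,3)] and c2 = cauchy_data_csol[OF PQ2 cd2 r L(1,3)]
    have dn: "(\<integral>t. n t * of_real (g t) \<partial>lborel) = (\<integral>t. zero_ext N1 t * of_real (g t) \<partial>lborel) - (\<integral>t. zero_ext N2 t * of_real (g t) \<partial>lborel)"
      and dn0: "(\<integral>t. n0 t * of_real (g t) \<partial>lborel) = (\<integral>t. zero_ext N01 t * of_real (g t) \<partial>lborel) - (\<integral>t. zero_ext N02 t * of_real (g t) \<partial>lborel)"
      if [measurable]: "g \<in> borel_measurable borel" and g: "\<And>t. \<bar>g t\<bar> \<le> 1" for g :: "real \<Rightarrow> real"
    proof -
      have i: "integrable lborel (\<lambda>t. zero_ext f t * complex_of_real (g t))" if "L2_0pi f" for f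
        by (rule integrable_mult_bounded[OF iN[OF that], of _ 1]) (use g in auto)
      have z: "zero_ext (\<lambda>x. f x - f' x) t * c = zero_ext f t * c - zero_ext f' t * c" for f f' t c
        by (simp add: zero_ext_def algebra_simps)
      show "(\<integral>t. n t * of_real (g t) \<partial>lborel) = (\<integral>t. zero_ext N1 t * of_real (g t) \<partial>lborel) - (\<integral>t. zero_ext N2 t * of_real (g t) \<partial>lborel)"
        "(\<integral>t. n0 t * of_real (g t) \<partial>lborel) = (\<integral>t. zero_ext N01 t * of_real (g t) \<partial>lborel) - (\<integral>t. zero_ext N02 t * of_real (g t) \<partial>lborel)"
        unfolding n_def n0_def z by (rule Bochner_Integration.integral_diff[OF i i], fact, fact)+
    qed
    have y: "csol K r pi - csol L r pi = ft (sine_ker w0 n0) r"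
    proof -
      have "ft (sine_ker w0 n0) r = w0 * of_real (sin (r * pi) / r) + (\<integral>t. n0 t * of_real (sin (r * t)) \<partial>lborel) / of_real r"
        by (rule ft_sine_ker[OF n0i n00 r])
      then show ?thesis
        unfolding c1(1) c2(1) w0_def using dn0[of "\<lambda>t. sin (r * t)"] by (simp add: left_diff_distrib diff_divide_distrib)
    qed
    have h1: "h1 = h2 + (w - w0)" using hh by (simp add: algebra_simps)
    have dy: "dcsol ?r1 H1 K r pi = w * of_real (cos (r * pi)) + (\<integral>t. n t * of_real (cos (r * t)) \<partial>lborel)
        + h2 * csol L r pi + dcsol ?r2 H2 L r pi - (h2 + (w - w0)) * csol K r pi"
    proof -
      have "(h1 * csol K r pi + dcsol ?r1 H1 K r pi) - (h2 * csol L r pi + dcsol ?r2 H2 L r pi) =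
        w * of_real (cos (r * pi)) + (\<integral>t. n t * of_real (cos (r * t)) \<partial>lborel)"
        unfolding c1(2) c2(2) w_def using dn[of "\<lambda>t. cos (r * t)"] by (simp add: algebra_simps)
      then show ?thesis unfolding h1[symmetric] by algebra
    qed
    note F = ft_data_ker[OF K(1) L(1) i2 r20 ni n0i n00 r dy y]
    note y1 = is_sol_csol[OF i1 K(1,3) r] and y2 = is_sol_csol[OF i2 L(1,3) r]
    have "(\<integral>t. q t * (csol K r t * csol L r t) \<partial>lborel) = (LINT t:{0..pi}|lborel. q t * (csol K r t * csol L r t))"
      unfolding set_lebesgue_integral_def
      by (intro Bochner_Integration.integral_cong refl) (use q(2) in \<open>auto simp: indicator_def\<close>)
    also have "\<dots> = (dcsol ?r1 H1 K r pi * csol L r pi - csol K r pi * dcsol ?r2 H2 L r pi) - (H1 - H2)"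
      using wronskian_identity[OF y1(1) y2(1)] by (simp add: q_def y1(2,3) y2(2,3))
    also have "dcsol ?r1 H1 K r pi * csol L r pi - csol K r pi * dcsol ?r2 H2 L r pi = w0 + ft ?G r"
      by (rule F(2))
    \<comment> \<open>By \<open>HH\<close>, w0 minus dH is half of the integral of q, the very
      constant that \<open>ft_product_integral\<close> splits off on the other side. What remains is
      an equality of two transforms.\<close>
    also have "w0 + ft ?G r - (H1 - H2) = (\<integral>t. q t \<partial>lborel) / 2 + ft ?G r" unfolding HH by simp
    finally show ?thesis using ft_product_integral(1)[OF K(1) L(1) q, of r] F(1) by simp
  qed
  have iG: "integrable lborel ?G" using main[of 1] by simp
  have iE: "integrable lborel ?E" by (rule ft_product_integral(2)[OF K(1) L(1) q])
  have "AE u in lborel. ?E u - ?G u = 0"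
  proof (rule ft_unique)
    show "integrable lborel (\<lambda>u. ?E u - ?G u)" using iE iG by (rule Bochner_Integration.integrable_diff)
    show "ft (\<lambda>u. ?E u - ?G u) r = 0" if "r \<noteq> 0" for r
    proof -
      have "ft ?E r = ft ?G r" using main[OF that] by blast
      then have "ft ?E r - ft ?G r = 0" by (simp only: diff_self)
      then show ?thesis by (rule trans[OF ft_diff[OF iE iG]])
    qed
  qed
  then have eq: "AE u in lborel. ?E u = ?G u" by eventually_elim simp
  have Gm: "?G \<in> borel_measurable borel" using iG by auto
  have gle: "norm (?G (2 * t)) \<le> norm (sym_shift pi (half_even n) (2 * t)) + norm (odd_shift n0 (2 * t)) + d * data_bound Q" for t
    using P2 by (intro norm_data_ker_le Q0 d_ge K(1) L(1) b2 nb n0b wd) auto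
  note S = volterra_stability[OF Q0 d_ge(1) K(1) L(1) K(2) L(2) q Gm
      L2_le_data_terms(1)[OF L2_ball_imp_L2_le[OF nb]] L2_le_data_terms(2)[OF L2_ball_imp_L2_le[OF n0b]] gle eq]
  have "(L2_norm_0pi (\<lambda>x. q1 x - q2 x))\<^sup>2 = (\<integral>t. (norm (q t))\<^sup>2 \<partial>lborel)"
  proof -
    have "zero_ext (\<lambda>x. q1 x - q2 x) (pi - t) = q t" for t by (simp add: q_def zero_ext_def scaleR_diff_right)
    then show ?thesis
      unfolding L2_norm_0pi_power2
      using lborel_integral_real_affine[of "-1" "\<lambda>t. (norm (zero_ext (\<lambda>x. q1 x - q2 x) t))\<^sup>2" pi] by simp
  qed
  also have "\<dots> \<le> (d * stab_const Q)\<^sup>2" by (rule S(2))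
  finally have q_le: "L2_norm_0pi (\<lambda>x. q1 x - q2 x) \<le> d * stab_const Q"
    by (rule power2_le_imp_le) (simp add: d_ge(1) stab_const_def)
  have h_le: "norm (h1 - h2) \<le> d" unfolding hh by (rule wd)
  have "norm (H1 - H2) \<le> norm w0 + norm (\<integral>t. q t \<partial>lborel) / 2"
    unfolding HH using norm_triangle_ineq4[of w0 "(\<integral>t. q t \<partial>lborel) / 2"] by (simp add: norm_divide)
  also have "norm (\<integral>t. q t \<partial>lborel) \<le> d * l1_const Q"
    by (rule order_trans[OF integral_norm_bound S(1)])
  finally have "norm (H1 - H2) \<le> d + d * l1_const Q / 2" using wd(2) by simp
  with q_le h_le show ?thesis by (simp add: algebra_simps)
qed

theorem theorem2p7:
  fixes Q :: real
  assumes "Q > 0"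
  shows "\<exists>C::real. \<forall>q1 h1 H1 N1 N01 \<omega>1 \<omega>01 q2 h2 H2 N2 N02 \<omega>2 \<omega>02.
     P_Q Q q1 h1 H1 \<and> P_Q Q q2 h2 H2 \<and>
     cauchy_data q1 h1 H1 N1 N01 \<omega>1 \<omega>01 \<and> cauchy_data q2 h2 H2 N2 N02 \<omega>2 \<omega>02 \<longrightarrow>
     L2_norm_0pi (\<lambda>x. q1 x - q2 x) + norm (h1 - h2) + norm (H1 - H2)
       \<le> C * (L2_norm_0pi (\<lambda>x. N1 x - N2 x) + L2_norm_0pi (\<lambda>x. N01 x - N02 x)
              + norm (\<omega>1 - \<omega>2) + norm (\<omega>01 - \<omega>02))"
  using cauchy_data_stability[OF assms] by (intro exI[of _ "stab_const Q + 2 + l1_const Q / 2"]) blast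

end
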